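(* Let $n\ge 2$ be an integer and $\alpha,\beta,m,M>0$. Let $\mathcal{G}=\langle g_1,g_2\rangle$ be a finite group with representations $\rho:\mathcal{G}\to O(3)$, $\tau:\mathcal{G}\to O(2)$ and $\sigma:\mathcal{G}\to\Sigma_n$ such that, for $j=1,2$, $$g_j\cdot q(t)=\big(\rho(g_j)\,q_{\sigma(g_j^{-1})1}(\tau(g_j^{-1})t),\ \ldots,\ \rho(g_j)\,q_{\sigma(g_j^{-1})n}(\tau(g_j^{-1})t)\big),$$ where $$\rho(g_1)=\mathrm{id},\quad \sigma(g_1^{-1})i=i-1,\quad \tau(g_1^{-1})t=t+\tfrac{2\pi}{n},$$ $$\rho(g_2)=-\mathrm{id},\quad \sigma(g_2^{-1})i=i,\quad \tau(g_2^{-1})t=t+\pi .$$ Let $\mathcal{H}_{\mathcal{G}}=\{q\in\mathcal{H}\mid g\cdot q=q\ \ \forall g\in\mathcal{G}\}$. Then the minimizer of $\mathcal{A}|_{\mathcal{H}_{\mathcal{G}}}$ is $\tilde q(t)$ (defined in the context), and thus a uniform circular solution of $$m\ddot q_i(t)=\nabla_{q_i}V(q_1,\ldots,q_n),\qquad q_i\in\mathbb{R}^3,\ i=1,\ldots,n .$$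
   Context: Let $C_1=(1,0,0)$ and $C_2=(-1,0,0)$ in $\mathbb{R}^3$ (positions of two fixed centers, each of mass $M$); $n$ particles of mass $m$ move at positions $q_1,\ldots,q_n$. For $q=(q_1,\ldots,q_n)\in(\mathbb{R}^{3})^n$ put $$V(q_1,\ldots,q_n)=\sum_{1\le i<j\le n}\frac{m^2}{|q_i-q_j|^{\alpha}}+\sum_{i=1}^n\Big(\frac{mM}{|q_i-C_1|^{\beta}}+\frac{mM}{|q_i-C_2|^{\beta}}\Big).$$ $H^1_{2\pi}(\mathbb{R},\mathbb{R}^{d})$ denotes the Sobolev space of $2\pi$-periodic functions $\mathbb{R}\to\mathbb{R}^d$ that are, together with their weak derivative, square integrable on $[0,2\pi]$. Set $$\mathcal{H}=\{q\in H^1_{2\pi}(\mathbb{R},\mathbb{R}^{3n}) \mid q_i(t)\ne q_j(t)\ \forall i\neq j,\ \forall t\in\mathbb{R};\ q_k(t)\ne C_1,\ q_k(t)\neq C_2,\ k=1,\ldots,n,\ \forall t\in\mathbb{R}\},$$ $$\mathcal{A}:\mathcal{H}\to\mathbb{R}\cup\{+\infty\},\qquad \mathcal{A}(q)=\int_0^{2\pi}\Big[\frac m2\sum_{i=1}^n|\dot q_i(t)|^2+V(q_1(t),\ldots,q_n(t))\Big]dt,$$ $$\Lambda=\Big\{q\in\mathcal{H}\ \Big|\ \int_0^{2\pi} q_i(t)\,dt=0,\ \ q_i(t)=q_1\big(t+(i-1)\tfrac{2\pi}{n}\big),\ i=1,\ldots,n\Big\}.$$ $\Sigma_n$ is the symmetric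 group on $\{1,\ldots,n\}$; particle indices are taken modulo $n$; $O(2)$ acts on the time circle $\mathbb{R}/2\pi\mathbb{Z}$. A relative equilibrium motion (associated with the regular polygon) is a motion in which the $n$ particles lie at the vertices of a regular $n$-gon and perform a uniform circular motion around its center. The symbol $\tilde q(t)=(\tilde q_1(t),\ldots,\tilde q_n(t))$ denotes the relative equilibrium motion on which the absolute minimum of $\mathcal{A}$ on $\Lambda$ is attained; at every instant $\tilde q_1(t),\ldots,\tilde q_n(t)$ lie at the vertices of a regular $n$-gon centered at the origin in the $yz$-plane. *)

theory Defs
  imports "HOL-Analysis.Analysis" "HOL-Algebra.Sym_Groups" "HOL-Number_Theory.Cong"
begin

text \<open>
  A motion of \<open>n\<close> particles is a function \<open>q :: nat \<Rightarrow> real \<Rightarrow> real^3\<close>, where \<open>q i t\<close> is the position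
  of particle \<open>i \<in> {1..n}\<close> at time \<open>t\<close>; a configuration is a function \<open>x :: nat \<Rightarrow> real^3\<close>.
  The values at indices outside \<open>{1..n}\<close> are irrelevant: no definition below depends on them.
\<close>

definition periodic_2pi :: "(real \<Rightarrow> 'a) \<Rightarrow> bool" where
  "periodic_2pi f \<longleftrightarrow> (\<forall>t. f (t + 2 * pi) = f t)"

definition smooth_real :: "(real \<Rightarrow> real) \<Rightarrow> bool" where
  "smooth_real \<phi> \<longleftrightarrow> (\<forall>k t. ((deriv ^^ k) \<phi>) differentiable (at t))"

definition L2_2pi :: "(real \<Rightarrow> 'a::euclidean_space) \<Rightarrow> bool" where
  "L2_2pi f \<longleftrightarrow> periodic_2pi f \<and> f \<in> borel_measurable lborel \<and>
     set_integrable lborel {0..2 * pi} (\<lambda>t. (norm (f t))\<^sup>2)"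

text \<open>
  Weak derivatives of periodic functions are tested against smooth \<open>2\<pi>\<close>-periodic functions,
  that is, the functions are viewed as distributions on the circle.
\<close>

definition is_weak_deriv :: "(real \<Rightarrow> 'a::euclidean_space) \<Rightarrow> (real \<Rightarrow> 'a) \<Rightarrow> bool" where
  "is_weak_deriv u v \<longleftrightarrow> (\<forall>\<phi>. smooth_real \<phi> \<and> periodic_2pi \<phi> \<longrightarrow>
     (LINT t:{0..2 * pi}|lborel. deriv \<phi> t *\<^sub>R u t) =
     - (LINT t:{0..2 * pi}|lborel. \<phi> t *\<^sub>R v t))"

text \<open>
  Every class (modulo equality almost everywhere) in the Sobolev space has exactly one continuous
  member. As the collision conditions below are pointwise, the class is represented by this member.
\<close>

definition H1_2pi :: "(real \<Rightarrow> 'a::euclidean_space) set" where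
  "H1_2pi = {u. continuous_on UNIV u \<and> L2_2pi u \<and> (\<exists>v. L2_2pi v \<and> is_weak_deriv u v)}"

text \<open>The weak derivative is determined up to a null set, hence so are integrals involving it.\<close>

definition weak_deriv :: "(real \<Rightarrow> 'a::euclidean_space) \<Rightarrow> real \<Rightarrow> 'a" where
  "weak_deriv u = (SOME v. L2_2pi v \<and> is_weak_deriv u v)"

definition C1 :: "real^3" where "C1 = vector [1, 0, 0]"
definition C2 :: "real^3" where "C2 = vector [-1, 0, 0]"

definition potential :: "nat \<Rightarrow> real \<Rightarrow> real \<Rightarrow> real \<Rightarrow> real \<Rightarrow> (nat \<Rightarrow> real^3) \<Rightarrow> real" where
  "potential n \<alpha> \<beta> m M x =
     (\<Sum>i\<in>{1..n}. \<Sum>j\<in>{i<..n}. m\<^sup>2 / norm (x i - x j) powr \<alpha>) +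
     (\<Sum>i\<in>{1..n}. m * M / norm (x i - C1) powr \<beta> + m * M / norm (x i - C2) powr \<beta>)"

definition H_space :: "nat \<Rightarrow> (nat \<Rightarrow> real \<Rightarrow> real^3) set" where
  "H_space n = {q. (\<forall>i\<in>{1..n}. q i \<in> H1_2pi) \<and>
     (\<forall>i\<in>{1..n}. \<forall>j\<in>{1..n}. i \<noteq> j \<longrightarrow> (\<forall>t. q i t \<noteq> q j t)) \<and>
     (\<forall>k\<in>{1..n}. \<forall>t. q k t \<noteq> C1 \<and> q k t \<noteq> C2)}"

definition action ::
    "nat \<Rightarrow> real \<Rightarrow> real \<Rightarrow> real \<Rightarrow> real \<Rightarrow> (nat \<Rightarrow> real \<Rightarrow> real^3) \<Rightarrow> ennreal" where
  "action n \<alpha> \<beta> m M q = (\<integral>\<^sup>+ t\<in>{0..2 * pi}.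
     ennreal (m / 2 * (\<Sum>i\<in>{1..n}. (norm (weak_deriv (q i) t))\<^sup>2) +
              potential n \<alpha> \<beta> m M (\<lambda>i. q i t)) \<partial>lborel)"

definition Lambda_space :: "nat \<Rightarrow> (nat \<Rightarrow> real \<Rightarrow> real^3) set" where
  "Lambda_space n = {q \<in> H_space n. \<forall>i\<in>{1..n}.
     (LINT t:{0..2 * pi}|lborel. q i t) = 0 \<and>
     (\<forall>t. q i t = q 1 (t + (real i - 1) * (2 * pi / real n)))}"

text \<open>
  Uniform circular motion with center \<open>c\<close> in the plane \<open>c + span {a, b}\<close>, the particles being
  placed, in an order given by \<open>p\<close>, at the vertices of a regular \<open>n\<close>-gon. The sign of \<open>\<omega>\<close> gives the
  sense of rotation.
\<close>

definition relative_equilibrium ::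
    "nat \<Rightarrow> real^3 \<Rightarrow> real^3 \<Rightarrow> real^3 \<Rightarrow> (nat \<Rightarrow> real \<Rightarrow> real^3) \<Rightarrow> bool" where
  "relative_equilibrium n c a b q \<longleftrightarrow>
     norm a = 1 \<and> norm b = 1 \<and> a \<bullet> b = 0 \<and>
     (\<exists>R \<omega> \<theta> p. R > 0 \<and> \<omega> \<noteq> 0 \<and> p permutes {1..n} \<and>
       (\<forall>i\<in>{1..n}. \<forall>t. q i t = c +
          (R * cos (\<omega> * t + \<theta> + 2 * pi * real (p i) / real n)) *\<^sub>R a +
          (R * sin (\<omega> * t + \<theta> + 2 * pi * real (p i) / real n)) *\<^sub>R b))"

text \<open>
  The motion \<open>q\<close> is the relative equilibrium, about the origin and in the \<open>yz\<close>-plane, on which the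
  action attains its minimum on \<open>\<Lambda>\<close>. As the action is invariant under rotations about the
  \<open>x\<close>-axis and under time reversal, such a motion is determined only up to its initial phase and its
  sense of rotation, whence a predicate.
\<close>

definition is_tilde_q ::
    "nat \<Rightarrow> real \<Rightarrow> real \<Rightarrow> real \<Rightarrow> real \<Rightarrow> (nat \<Rightarrow> real \<Rightarrow> real^3) \<Rightarrow> bool" where
  "is_tilde_q n \<alpha> \<beta> m M q \<longleftrightarrow>
     relative_equilibrium n 0 (vector [0, 1, 0]) (vector [0, 0, 1]) q \<and>
     is_arg_min (action n \<alpha> \<beta> m M) (\<lambda>r. r \<in> Lambda_space n) q"

definition solves_newton ::
    "nat \<Rightarrow> real \<Rightarrow> real \<Rightarrow> real \<Rightarrow> real \<Rightarrow> (nat \<Rightarrow> real \<Rightarrow> real^3) \<Rightarrow> bool" where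
  "solves_newton n \<alpha> \<beta> m M q \<longleftrightarrow> (\<exists>v a. \<forall>i\<in>{1..n}. \<forall>t.
     (q i has_vector_derivative v i t) (at t) \<and>
     (v i has_vector_derivative a i t) (at t) \<and>
     GDERIV (\<lambda>y. potential n \<alpha> \<beta> m M ((\<lambda>j. q j t)(i := y))) (q i t) :> (m *\<^sub>R a i t))"

definition orthogonal_group :: "(real^'d^'d) monoid" where
  "orthogonal_group = \<lparr>carrier = {A. orthogonal_matrix A}, mult = (**), one = mat 1\<rparr>"

definition circle_point :: "real \<Rightarrow> real^2" where
  "circle_point t = vector [cos t, sin t]"

text \<open>
  \<open>O(2)\<close> acts on the time circle, identified with the unit circle by \<open>circle_point\<close>. The result is
  some representative modulo \<open>2\<pi>\<close>, which suffices since it only enters as the argument of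
  \<open>2\<pi>\<close>-periodic functions.
\<close>

definition time_act :: "real^2^2 \<Rightarrow> real \<Rightarrow> real" where
  "time_act A t = (SOME s. circle_point s = A *v circle_point t)"

definition motion_act ::
    "('g, 'b) monoid_scheme \<Rightarrow> ('g \<Rightarrow> real^3^3) \<Rightarrow> ('g \<Rightarrow> real^2^2) \<Rightarrow> ('g \<Rightarrow> nat \<Rightarrow> nat) \<Rightarrow>
     'g \<Rightarrow> (nat \<Rightarrow> real \<Rightarrow> real^3) \<Rightarrow> nat \<Rightarrow> real \<Rightarrow> real^3" where
  "motion_act G \<rho> \<tau> \<sigma> g q i t = \<rho> g *v q (\<sigma> (inv\<^bsub>G\<^esub> g) i) (time_act (\<tau> (inv\<^bsub>G\<^esub> g)) t)"

definition HG_space ::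
    "('g, 'b) monoid_scheme \<Rightarrow> ('g \<Rightarrow> real^3^3) \<Rightarrow> ('g \<Rightarrow> real^2^2) \<Rightarrow> ('g \<Rightarrow> nat \<Rightarrow> nat) \<Rightarrow>
     nat \<Rightarrow> (nat \<Rightarrow> real \<Rightarrow> real^3) set" where
  "HG_space G \<rho> \<tau> \<sigma> n = {q \<in> H_space n.
     \<forall>g\<in>carrier G. \<forall>i\<in>{1..n}. \<forall>t. motion_act G \<rho> \<tau> \<sigma> g q i t = q i t}"

end

theory Submission
  imports Defs
begin

text \<open>
  The potential is bounded below by its tangent at a suitable regular polygon. As
  \<open>r \<mapsto> r powr (- \<alpha> / 2)\<close> is strictly convex, each interaction is at least an affine function
  of a squared distance. Integrating, \<open>\<integral>|q i t - q j t|\<^sup>2\<close> is the squared \<open>L\<^sup>2\<close>-norm of a difference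
  of two translates of one loop, so that Fourier series give
  \<open>\<integral>|u (t + h) - u t|\<^sup>2 \<le> 4 sin\<^sup>2 (h / 2) \<integral>|u'|\<^sup>2\<close>; and \<open>\<integral>|q i t|\<^sup>2 \<le> \<integral>|q i'|\<^sup>2\<close> is the
  Poincare-Wirtinger inequality. If the radius of the polygon is a critical point of the action
  among rotating polygons, the kinetic energy cancels and a constant remains, which the polygon
  attains. Equality forces Fourier modes of order one and equal distances to both centers, hence
  a uniform circular motion in the \<open>yz\<close>-plane. The group only serves to identify the invariant
  motions as the choreographies with \<open>q i (t + \<pi>) = - q i t\<close>; these have mean zero and include the
  rotating polygons.
\<close>

section \<open>Trigonometric polynomials\<close>

text \<open>A single kinetic term has to pay for the estimates of all pairs and of both centers. The
  tangent slopes fix the price of each estimate, and criticality of the squared radius K says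
  exactly that the prices add up to the coefficient m / 2. The factor 4 sin^2 (h / 2) for translates
  is also a squared chord of the unit polygon, so one rotating polygon makes all estimates sharp at
  once. At the centers the terms linear in q cancel, since C1 + C2 = 0 and both tangents are taken
  at K + 1. Everything is done for each particle separately: the equality case then concerns a
  single loop, and the choreography condition determines the others. Finally,
  \<open>weak_deriv\<close> is a choice among functions that agree almost everywhere; to evaluate
  the action of the polygon one needs uniqueness of weak derivatives, which is obtained from the
  completeness of the trigonometric system.\<close>

text \<open>
  With \<open>k\<close> ranging over all integers these functions form a single orthogonal family whose members
  all have squared norm \<open>2\<pi>\<close>, and whose derivatives and translates involve only \<open>cas k\<close> and \<open>cas (- k)\<close>.
\<close>

definition cas :: "int \<Rightarrow> real \<Rightarrow> real" where
  "cas k t = cos (of_int k * t) + sin (of_int k * t)"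

inductive trig_poly :: "(real \<Rightarrow> real) \<Rightarrow> bool" where
  monom: "trig_poly (\<lambda>t. c * cas k t)"
| add: "trig_poly p \<Longrightarrow> trig_poly q \<Longrightarrow> trig_poly (\<lambda>t. p t + q t)"

lemma cas_0 [simp]: "cas 0 t = 1"
  by (simp add: cas_def)

text \<open>With \<open>a = k t\<close> and \<open>b = l t\<close> the product is
  \<open>cos (a - b) + sin (a + b)\<close>: the even part of \<open>cas (k - l)\<close> plus the odd
  part of \<open>cas (k + l)\<close>, each a combination of two opposite frequencies.\<close>

lemma cas_mult:
  "cas k t * cas l t =
     1/2 * cas (k - l) t + 1/2 * cas (l - k) t + (1/2 * cas (k + l) t + (-1/2) * cas (- k - l) t)"
proof -
  define a b where "a = of_int k * t" and "b = of_int l * t"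
  have args: "of_int (k - l) * t = a - b" "of_int (l - k) * t = b - a"
    "of_int (k + l) * t = a + b" "of_int (- k - l) * t = - (a + b)"
    by (simp_all add: a_def b_def algebra_simps)
  show ?thesis
    unfolding cas_def args unfolding a_def[symmetric] b_def[symmetric]
    by (simp add: cos_add sin_add cos_diff sin_diff algebra_simps)
qed

lemma trig_poly_const: "trig_poly (\<lambda>t. c)"
  using trig_poly.monom[of c 0] by simp

lemma trig_poly_cmult: "trig_poly p \<Longrightarrow> trig_poly (\<lambda>t. c * p t)"
proof (induction rule: trig_poly.induct)
  case (monom d k)
  then show ?case using trig_poly.monom[of "c * d" k] by (simp add: mult.assoc)
next
  case (add p q)
  then show ?case by (simp add: distrib_left trig_poly.add)
qed

lemma trig_poly_mult:
  assumes "trig_poly p" "trig_poly q" shows "trig_poly (\<lambda>t. p t * q t)"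
  using assms(1)
proof (induction rule: trig_poly.induct)
  case (monom c k)
  from assms(2) show ?case
  proof (induction rule: trig_poly.induct)
    case (monom d l)
    have "trig_poly (\<lambda>t. (c * d) * (cas k t * cas l t))"
      unfolding cas_mult by (intro trig_poly_cmult trig_poly.intros)
    then show ?case by (simp add: mult_ac)
  next
    case (add p q)
    then show ?case by (simp add: distrib_left trig_poly.add)
  qed
next
  case (add p1 p2)
  then show ?case by (simp add: distrib_right trig_poly.add)
qed

lemma trig_poly_cos: "trig_poly cos" and trig_poly_sin: "trig_poly sin"
proof -
  have "trig_poly (\<lambda>t. 1/2 * cas 1 t + 1/2 * cas (-1) t)"
    by (intro trig_poly.intros)
  then show "trig_poly cos" by (simp add: cas_def field_simps)
  have "trig_poly (\<lambda>t. 1/2 * cas 1 t + (-1/2) * cas (-1) t)"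
    by (intro trig_poly.intros)
  then show "trig_poly sin" by (simp add: cas_def field_simps)
qed

text \<open>Turns the output of the Stone-Weierstrass theorem on the circle into trigonometric
  polynomials: a real linear functional of \<open>cis t\<close> is a combination of
  \<open>cos t\<close> and \<open>sin t\<close>, and products stay in the class.\<close>

lemma trig_poly_real_polynomial_function:
  fixes g :: "complex \<Rightarrow> real"
  assumes "real_polynomial_function g" shows "trig_poly (\<lambda>t. g (cis t))"
  using assms
proof (induction rule: real_polynomial_function.induct)
  case (linear f)
  then interpret bounded_linear f .
  have "f (cis t) = f 1 * cos t + f \<i> * sin t" for t
  proof -
    have "cis t = cos t *\<^sub>R 1 + sin t *\<^sub>R \<i>" by (simp add: complex_eq_iff)
    then show ?thesis by (metis add scale mult.commute real_scaleR_def)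
  qed
  then show ?case
    by (simp add: trig_poly.add trig_poly_cmult trig_poly_cos trig_poly_sin)
qed (auto intro: trig_poly_const trig_poly.add trig_poly_mult)

text \<open>
  A function with \<open>f 0 = f (2\<pi>)\<close> descends to the unit circle, as \<open>cis\<close> is a quotient map on
  \<open>[0, 2\<pi>]\<close>; there the Stone-Weierstrass theorem applies.
\<close>

lemma trig_poly_dense:
  fixes f :: "real \<Rightarrow> real"
  assumes contf: "continuous_on {0..2*pi} f" and per: "f 0 = f (2*pi)" and "e > 0"
  obtains p where "trig_poly p" "\<And>t. t \<in> {0..2*pi} \<Longrightarrow> \<bar>f t - p t\<bar> < e"
proof -
  define F where "F = (\<lambda>z. f (Arg2pi z))"
  have F_cis: "F (cis t) = f t" if "t \<in> {0..2*pi}" for t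
  proof (cases "t = 2*pi")
    case True
    then show ?thesis using per by (simp add: F_def Arg2pi_of_real[of 1, simplified])
  next
    case False
    then have "Arg2pi (cis t) = t"
      using that by (intro Arg2pi_unique[of 1]) (auto simp: cis_conv_exp)
    then show ?thesis by (simp add: F_def)
  qed
  have img: "cis ` {0..2*pi} = sphere 0 1"
  proof
    show "sphere 0 1 \<subseteq> cis ` {0..2*pi}"
    proof
      fix z :: complex assume "z \<in> sphere 0 1"
      then have "z = cis (Arg2pi z)" using Arg2pi_eq[of z] by (simp add: cis_conv_exp)
      then show "z \<in> cis ` {0..2*pi}" using Arg2pi_ge_0[of z] Arg2pi_lt_2pi[of z] by force
    qed
  qed auto
  \<comment> \<open>\<open>Arg2pi\<close> jumps at 1, so composition gives no continuity there.
    Instead, the preimage under \<open>F\<close> of a closed set is the \<open>cis\<close>-image of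
    a compact subset of the interval.\<close>
  have contF: "continuous_on (sphere 0 1) F"
  proof (subst continuous_on_closed, intro allI impI)
    fix B assume B: "closedin (top_of_set (F ` sphere 0 1)) B"
    have FB: "F ` sphere 0 1 = f ` {0..2*pi}"
      using F_cis by (force simp flip: img simp: image_image)
    have "closedin (top_of_set {0..2*pi}) ({0..2*pi} \<inter> f -` B)"
      using contf B unfolding FB continuous_on_closed by blast
    then have "compact ({0..2*pi} \<inter> f -` B)"
      by (meson closedin_compact compact_Icc)
    then have "compact (cis ` ({0..2*pi} \<inter> f -` B))"
      by (intro compact_continuous_image continuous_on_cis continuous_intros)
    moreover have "cis ` ({0..2*pi} \<inter> f -` B) = sphere 0 1 \<inter> F -` B"
      using F_cis by (force simp flip: img)
    ultimately show "closedin (top_of_set (sphere 0 1)) (sphere 0 1 \<inter> F -` B)"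
      by (metis closed_subset compact_imp_closed inf_le1)
  qed
  obtain g where g: "real_polynomial_function g" "\<And>z. z \<in> sphere 0 1 \<Longrightarrow> \<bar>F z - g z\<bar> < e"
    using Stone_Weierstrass_real_polynomial_function[OF _ contF \<open>e > 0\<close>] by auto
  show thesis
  proof
    show "trig_poly (\<lambda>t. g (cis t))" using g(1) by (rule trig_poly_real_polynomial_function)
    show "\<bar>f t - g (cis t)\<bar> < e" if "t \<in> {0..2*pi}" for t
      using g(2)[of "cis t"] F_cis[OF that] by simp
  qed
qed

section \<open>Fourier series\<close>

definition circ :: "real measure" where
  "circ = restrict_space lborel {0..2 * pi}"

lemma space_circ [simp]: "space circ = {0..2 * pi}"
  by (simp add: circ_def)

lemma integral_circ_eq_set:
  fixes f :: "real \<Rightarrow> 'a::euclidean_space"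
  shows "(LINT t:{0..2*pi}|lborel. f t) = integral\<^sup>L circ f"
  unfolding circ_def set_lebesgue_integral_def by (subst integral_restrict_space) auto

lemma integrable_circ_iff_set:
  fixes f :: "real \<Rightarrow> 'a::euclidean_space"
  shows "integrable circ f \<longleftrightarrow> set_integrable lborel {0..2*pi} f"
  unfolding circ_def set_integrable_def by (subst integrable_restrict_space) auto

lemma integrable_circ_continuous [intro]:
  fixes f :: "real \<Rightarrow> 'a::euclidean_space"
  assumes "continuous_on {0..2*pi} f" shows "integrable circ f"
  unfolding integrable_circ_iff_set using assms by (rule borel_integrable_atLeastAtMost')

lemma integral_circ_eq_HK:
  fixes f :: "real \<Rightarrow> 'a::euclidean_space"
  assumes "integrable circ f" shows "integral\<^sup>L circ f = integral {0..2*pi} f"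
  using set_borel_integral_eq_integral(2) assms
  unfolding integrable_circ_iff_set integral_circ_eq_set[symmetric] by blast

lemma finite_measure_circ: "finite_measure circ"
  by (rule finite_measureI) (simp add: circ_def emeasure_restrict_space)

interpretation circ: finite_measure circ
  by (rule finite_measure_circ)

lemma measure_circ_space [simp]: "measure circ {0..2*pi} = 2 * pi"
  unfolding circ_def by (subst measure_restrict_space) auto

lemma integral_circ_const:
  fixes c :: "'a::euclidean_space" shows "(\<integral>t. c \<partial>circ) = (2 * pi) *\<^sub>R c"
  by simp

lemma borel_measurable_circ: "f \<in> borel_measurable lborel \<Longrightarrow> f \<in> borel_measurable circ"
  unfolding circ_def by (intro measurable_restrict_space1) auto

lemma integral_circ_FTC:
  fixes F :: "real \<Rightarrow> 'a::euclidean_space"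
  assumes "\<And>t. t \<in> {0..2*pi} \<Longrightarrow> (F has_vector_derivative f t) (at t within {0..2*pi})"
    and "continuous_on {0..2*pi} f"
  shows "integral\<^sup>L circ f = F (2*pi) - F 0"
proof -
  have "(f has_integral (F (2*pi) - F 0)) {0..2*pi}"
    using assms(1) by (intro fundamental_theorem_of_calculus) auto
  then show ?thesis
    using integral_circ_eq_HK[OF integrable_circ_continuous[OF assms(2)]] by (simp add: integral_unique)
qed

lemma continuous_integral_circ_zero:
  fixes f :: "real \<Rightarrow> real"
  assumes cont: "continuous_on {0..2*pi} f" and nn: "\<And>t. t \<in> {0..2*pi} \<Longrightarrow> 0 \<le> f t"
    and "integral\<^sup>L circ f \<le> 0" and t: "t \<in> {0..2*pi}"
  shows "f t = 0"
proof -
  have "integral {0..2*pi} f \<ge> 0"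
    using nn integrable_continuous_interval[OF cont] by (intro integral_nonneg) auto
  then have "integral {0..2*pi} f = 0"
    using assms(3) integral_circ_eq_HK[OF integrable_circ_continuous[OF cont]] by simp
  then show ?thesis
    using integral_eq_0_iff[OF cont] nn t by simp
qed

text \<open>For a primitive \<open>F\<close> of \<open>f\<close>, the function
  \<open>F (s + 2 * pi) - F s\<close> has derivative \<open>f (s + 2 * pi) - f s = 0\<close>, so it
  takes the same value at \<open>s = h\<close> and at \<open>s = 0\<close>.\<close>

lemma integral_circ_shift:
  fixes f :: "real \<Rightarrow> 'a::euclidean_space"
  assumes cont: "continuous_on UNIV f" and per: "periodic_2pi f"
  shows "(\<integral>t. f (t + h) \<partial>circ) = integral\<^sup>L circ f"
proof -
  \<comment> \<open>This base point lies to the left of both \<open>0\<close> and \<open>h\<close>,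
    so that \<open>F\<close> is differentiable wherever it is used.\<close>
  define a where "a = - \<bar>h\<bar> - 1"
  define F where "F = (\<lambda>x. integral {a..x} f)"
  have F: "(F has_vector_derivative f x) (at x)" if "x > a" for x
  proof -
    have "(F has_vector_derivative f x) (at x within {a..x+1})"
      unfolding F_def using that cont
      by (intro integral_has_vector_derivative) (auto intro: continuous_on_subset)
    moreover have "at x within {a..x+1} = at x"
      using that by (intro at_within_interior) auto
    ultimately show ?thesis by simp
  qed
  have shift: "(\<integral>t. f (t + s) \<partial>circ) = F (s + 2*pi) - F s" if "s > a" for s
  proof -
    have "((\<lambda>t. F (t + s)) has_vector_derivative f (t + s)) (at t within {0..2*pi})"
      if "t \<in> {0..2*pi}" for t
    proof -
      have "((\<lambda>t. t + s) has_vector_derivative 1) (at t)"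
        by (auto intro!: derivative_eq_intros)
      then have "((F \<circ> (\<lambda>t. t + s)) has_vector_derivative 1 *\<^sub>R f (t + s)) (at t)"
        using that \<open>s > a\<close> by (intro vector_diff_chain_at F) auto
      then show ?thesis by (simp add: o_def has_vector_derivative_at_within)
    qed
    moreover have "continuous_on {0..2*pi} (\<lambda>t. f (t + s))"
      by (intro continuous_on_compose2[OF cont] continuous_intros) auto
    ultimately have "(\<integral>t. f (t + s) \<partial>circ) = F (2*pi + s) - F (0 + s)"
      by (rule integral_circ_FTC)
    then show ?thesis by (simp add: add.commute)
  qed
  have "\<exists>c. \<forall>s\<in>{a<..}. F (s + 2*pi) - F s = c"
  proof (rule has_vector_derivative_zero_constant)
    fix s assume s: "s \<in> {a<..}"
    have "((\<lambda>t. t + 2*pi) has_vector_derivative 1) (at s)"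
      by (auto intro!: derivative_eq_intros)
    then have "((F \<circ> (\<lambda>t. t + 2*pi)) has_vector_derivative 1 *\<^sub>R f (s + 2*pi)) (at s)"
      using s pi_gt_zero by (intro vector_diff_chain_at F) (auto simp del: pi_gt_zero)
    then have "((\<lambda>t. F (t + 2*pi) - F t) has_vector_derivative f (s + 2*pi) - f s) (at s)"
      using s by (intro has_vector_derivative_diff F) (auto simp: o_def)
    then show "((\<lambda>t. F (t + 2*pi) - F t) has_vector_derivative 0) (at s within {a<..})"
      using per by (simp add: periodic_2pi_def has_vector_derivative_at_within)
  qed auto
  then obtain c where c: "F (s + 2*pi) - F s = c" if "s > a" for s by auto
  have "h > a" "0 > a" by (auto simp: a_def)
  then show ?thesis using shift[of h] shift[of 0] c[of h] c[of 0] by simp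
qed

section \<open>Square integrable functions and their Fourier coefficients\<close>

definition sq_int :: "(real \<Rightarrow> real) \<Rightarrow> bool" where
  "sq_int f \<longleftrightarrow> f \<in> borel_measurable circ \<and> integrable circ (\<lambda>t. (f t)\<^sup>2)"

lemma sq_int_mult:
  assumes "sq_int f" "sq_int g" shows "integrable circ (\<lambda>t. f t * g t)"
proof (rule Bochner_Integration.integrable_bound)
  show "integrable circ (\<lambda>t. (f t)\<^sup>2 + (g t)\<^sup>2)" using assms by (simp add: sq_int_def)
  show "(\<lambda>t. f t * g t) \<in> borel_measurable circ" using assms unfolding sq_int_def by (intro borel_measurable_times) auto
  have "\<bar>f t * g t\<bar> \<le> (f t)\<^sup>2 + (g t)\<^sup>2" for t
  proof -
    have "0 \<le> (\<bar>f t\<bar> - \<bar>g t\<bar>)\<^sup>2" by simp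
    then have "2 * \<bar>f t * g t\<bar> \<le> (f t)\<^sup>2 + (g t)\<^sup>2" by (simp add: power2_diff abs_mult)
    then show ?thesis using abs_ge_zero[of "f t * g t"] by linarith
  qed
  then show "AE t in circ. norm (f t * g t) \<le> norm ((f t)\<^sup>2 + (g t)\<^sup>2)" by simp
qed

lemma sq_int_continuous: "continuous_on {0..2*pi} f \<Longrightarrow> sq_int f"
  unfolding sq_int_def
  by (auto intro!: continuous_intros borel_measurable_integrable)

lemma sq_int_add: "sq_int f \<Longrightarrow> sq_int g \<Longrightarrow> sq_int (\<lambda>t. f t + g t)"
  using sq_int_mult[of f g] by (auto simp: sq_int_def power2_sum mult.assoc)

lemma sq_int_cmult: "sq_int f \<Longrightarrow> sq_int (\<lambda>t. c * f t)"
  by (auto simp: sq_int_def power_mult_distrib)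

lemma sq_int_diff: "sq_int f \<Longrightarrow> sq_int g \<Longrightarrow> sq_int (\<lambda>t. f t - g t)"
  using sq_int_add[of f "\<lambda>t. (-1) * g t"] sq_int_cmult[of g "-1"] by simp

lemma sq_int_integrable: "sq_int f \<Longrightarrow> integrable circ f"
  using sq_int_mult[of f "\<lambda>_. 1"] by (simp add: sq_int_continuous)

lemma continuous_on_cas [continuous_intros]: "continuous_on S (cas k)"
  unfolding cas_def by (intro continuous_intros)

lemma sq_int_cas: "sq_int (cas k)"
  by (intro sq_int_continuous continuous_intros)

lemma cas_has_vector_derivative:
  "(cas k has_vector_derivative of_int k * cas (-k) t) (at t within S)"
  unfolding cas_def has_real_derivative_iff_has_vector_derivative[symmetric]
  by (auto intro!: derivative_eq_intros simp: algebra_simps)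

lemma cas_periodic: "cas k (t + 2 * pi) = cas k t"
proof -
  have "cas k (t + 2*pi) = cos (of_int k * t + 2 * pi * of_int k) + sin (of_int k * t + 2 * pi * of_int k)"
    by (simp add: cas_def algebra_simps)
  then show ?thesis by (simp add: cos_add sin_add cas_def)
qed

lemma integral_cas: "integral\<^sup>L circ (cas k) = (if k = 0 then 2 * pi else 0)"
proof (cases "k = 0")
  case True
  then have "cas k = (\<lambda>_. 1)" by auto
  then show ?thesis using True by simp
next
  case False
  have "integral\<^sup>L circ (cas k) = cas (-k) (2*pi) / (- of_int k) - cas (-k) 0 / (- of_int k)"
  proof (rule integral_circ_FTC)
    fix t
    have "((\<lambda>t. cas (-k) t / (- of_int k)) has_vector_derivative
           (of_int (-k) * cas k t) / (- of_int k)) (at t within {0..2*pi})"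
      using cas_has_vector_derivative[of "-k" t]
      by (intro has_vector_derivative_divide) simp_all
    then show "((\<lambda>t. cas (-k) t / (- of_int k)) has_vector_derivative cas k t) (at t within {0..2*pi})"
      using False by simp
  qed (intro continuous_intros)
  then show ?thesis using False cas_periodic[of "-k" 0] by simp
qed

lemma integral_cas_mult:
  "(\<integral>t. cas k t * cas l t \<partial>circ) = (if k = l then 2 * pi else 0)"
proof -
  have [simp]: "integrable circ (cas j)" for j by (intro sq_int_integrable sq_int_cas)
  show ?thesis unfolding cas_mult by (auto simp: integral_cas)
qed

definition coef :: "int \<Rightarrow> (real \<Rightarrow> real) \<Rightarrow> real" where
  "coef k f = (\<integral>t. cas k t * f t \<partial>circ)"

lemma coef_diff: "sq_int f \<Longrightarrow> sq_int g \<Longrightarrow> coef k (\<lambda>t. f t - g t) = coef k f - coef k g"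
  unfolding coef_def by (simp add: right_diff_distrib sq_int_mult sq_int_cas)

lemma coef_cmult: "coef k (\<lambda>t. c * f t) = c * coef k f"
  unfolding coef_def by (simp add: mult.left_commute)

lemma coef_cas: "coef k (cas l) = (if k = l then 2 * pi else 0)"
  unfolding coef_def by (rule integral_cas_mult)

lemma coef_sum:
  "(\<And>i. i \<in> I \<Longrightarrow> sq_int (f i)) \<Longrightarrow> coef k (\<lambda>t. \<Sum>i\<in>I. f i t) = (\<Sum>i\<in>I. coef k (f i))"
  unfolding coef_def sum_distrib_left
  by (intro Bochner_Integration.integral_sum sq_int_mult sq_int_cas)

text \<open>The orthogonal projection of \<open>f\<close> onto the span of the \<open>cas k\<close>
  with \<open>k\<close> in \<open>K\<close>; \<open>2 * pi\<close> is their squared norm.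
  \<open>K\<close> is arbitrary because it is later matched to the frequencies of a given
  trigonometric polynomial.\<close>

definition fpart :: "int set \<Rightarrow> (real \<Rightarrow> real) \<Rightarrow> real \<Rightarrow> real" where
  "fpart K f t = (\<Sum>k\<in>K. coef k f / (2 * pi) * cas k t)"

lemma continuous_on_fpart [continuous_intros]: "continuous_on S (fpart K f)"
  unfolding fpart_def by (intro continuous_intros)

lemma sq_int_fpart: "sq_int (fpart K f)"
  by (intro sq_int_continuous continuous_intros)

lemma coef_fpart: "finite K \<Longrightarrow> coef k (fpart K f) = (if k \<in> K then coef k f else 0)"
  unfolding fpart_def
  by (subst coef_sum) (simp_all add: sq_int_cmult sq_int_cas coef_cmult[of k "coef _ f / (2*pi)"] coef_cas
      if_distrib[of "(*) _"] del: times_divide_eq_left cong: if_cong, simp)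

lemma integral_mult_fpart:
  assumes "sq_int g"
  shows "(\<integral>t. g t * fpart K f t \<partial>circ) = (\<Sum>k\<in>K. coef k f * coef k g) / (2 * pi)"
proof -
  have "(\<integral>t. g t * fpart K f t \<partial>circ) = (\<integral>t. (\<Sum>k\<in>K. coef k f / (2 * pi) * (cas k t * g t)) \<partial>circ)"
    by (simp add: fpart_def sum_distrib_left mult_ac)
  also have "\<dots> = (\<Sum>k\<in>K. coef k f / (2 * pi) * coef k g)"
    using assms by (simp add: coef_def sq_int_mult sq_int_cas)
  finally show ?thesis by (simp add: sum_divide_distrib)
qed

text \<open>Pythagoras: \<open>fpart K f\<close> has the same inner product with \<open>f\<close> as
  with itself, so the residual is orthogonal to it.\<close>

lemma integral_residual:
  assumes "sq_int f" "finite K"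
  shows "(\<integral>t. (f t - fpart K f t)\<^sup>2 \<partial>circ) = (\<integral>t. (f t)\<^sup>2 \<partial>circ) - (\<Sum>k\<in>K. (coef k f)\<^sup>2) / (2 * pi)"
proof -
  have "(\<integral>t. fpart K f t * fpart K f t \<partial>circ) = (\<Sum>k\<in>K. (coef k f)\<^sup>2) / (2 * pi)"
    by (subst integral_mult_fpart) (auto simp: sq_int_fpart coef_fpart assms power2_eq_square)
  moreover have "(\<integral>t. f t * fpart K f t \<partial>circ) = (\<Sum>k\<in>K. (coef k f)\<^sup>2) / (2 * pi)"
    by (subst integral_mult_fpart) (auto simp: assms power2_eq_square)
  moreover have "(\<lambda>t. (f t - fpart K f t)\<^sup>2) =
      (\<lambda>t. f t * f t - 2 * (f t * fpart K f t) + fpart K f t * fpart K f t)"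
    by (auto simp: power2_eq_square algebra_simps)
  ultimately show ?thesis
    using sq_int_mult[OF assms(1) assms(1)] sq_int_mult[OF assms(1) sq_int_fpart, of K f]
      sq_int_mult[OF sq_int_fpart sq_int_fpart, of K f K f]
    by (simp add: power2_eq_square)
qed

lemma bessel:
  assumes "sq_int f" "finite K"
  shows "(\<Sum>k\<in>K. (coef k f)\<^sup>2) \<le> 2 * pi * (\<integral>t. (f t)\<^sup>2 \<partial>circ)"
proof -
  have "0 \<le> (\<integral>t. (f t - fpart K f t)\<^sup>2 \<partial>circ)" by simp
  then show ?thesis unfolding integral_residual[OF assms] using pi_gt_zero
    by (simp add: pos_divide_le_eq mult.commute)
qed

lemma bessel_summable:
  assumes "sq_int f" shows "(\<lambda>k. (coef k f)\<^sup>2) summable_on UNIV"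
proof (rule nonneg_bdd_above_summable_on)
  show "bdd_above (sum (\<lambda>k. (coef k f)\<^sup>2) ` {K. K \<subseteq> UNIV \<and> finite K})"
    using bessel[OF assms] by (intro bdd_aboveI2) blast
qed simp

lemma bessel_infsum:
  assumes "sq_int f" shows "(\<Sum>\<^sub>\<infinity>k. (coef k f)\<^sup>2) \<le> 2 * pi * (\<integral>t. (f t)\<^sup>2 \<partial>circ)"
  by (rule infsum_le_finite_sums[OF bessel_summable[OF assms] bessel[OF assms]])

lemma trig_poly_continuous: "trig_poly p \<Longrightarrow> continuous_on S p"
  by (induction rule: trig_poly.induct) (intro continuous_intros | assumption)+

lemma sq_int_trig_poly: "trig_poly p \<Longrightarrow> sq_int p"
  by (intro sq_int_continuous trig_poly_continuous)

text \<open>\<open>K\<close> collects the frequencies of \<open>p\<close>. Orthogonality, rather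
  than an expansion of \<open>p\<close>, is the form used for Parseval's identity and for the
  uniqueness of Fourier coefficients.\<close>

lemma trig_poly_orthogonal:
  assumes "trig_poly p"
  shows "\<exists>K. finite K \<and>
    (\<forall>r. sq_int r \<longrightarrow> (\<forall>k\<in>K. coef k r = 0) \<longrightarrow> (\<integral>t. r t * p t \<partial>circ) = 0)"
  using assms
proof (induction rule: trig_poly.induct)
  case (monom c k)
  show ?case
  proof (intro conjI exI[of _ "{k}"] allI impI)
    fix r assume "sq_int r" "\<forall>j\<in>{k}. coef j r = 0"
    have "(\<integral>t. r t * (c * cas k t) \<partial>circ) = c * coef k r"
      unfolding coef_def by (subst integral_mult_right_zero[symmetric]) (simp add: mult_ac)
    then show "(\<integral>t. r t * (c * cas k t) \<partial>circ) = 0" using \<open>\<forall>j\<in>{k}. _\<close> by simp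
  qed simp
next
  case (add p q)
  then obtain K L where *: "finite K" "finite L"
    "\<forall>r. sq_int r \<longrightarrow> (\<forall>k\<in>K. coef k r = 0) \<longrightarrow> (\<integral>t. r t * p t \<partial>circ) = 0"
    "\<forall>r. sq_int r \<longrightarrow> (\<forall>k\<in>L. coef k r = 0) \<longrightarrow> (\<integral>t. r t * q t \<partial>circ) = 0"
    by blast
  note pq = add.hyps[THEN sq_int_trig_poly]
  show ?case
  proof (intro conjI exI[of _ "K \<union> L"] allI impI)
    fix r assume r: "sq_int r" "\<forall>j\<in>K \<union> L. coef j r = 0"
    then have "(\<integral>t. r t * p t \<partial>circ) = 0" "(\<integral>t. r t * q t \<partial>circ) = 0"
      using *(3,4) by blast+
    then show "(\<integral>t. r t * (p t + q t) \<partial>circ) = 0"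
      by (simp add: distrib_left sq_int_mult[OF r(1) pq(1)] sq_int_mult[OF r(1) pq(2)])
  qed (use *(1,2) in simp)
qed

text \<open>Bessel's inequality is one half. For the other, \<open>f\<close> is projected onto the
  frequencies of a uniformly close trigonometric polynomial; the residual is at most the error of
  that polynomial, as projections are best approximations. For weak derivatives, which need not be
  continuous, Bessel's inequality takes the place of this identity.\<close>

theorem parseval:
  assumes cont: "continuous_on {0..2*pi} f" and per: "f 0 = f (2*pi)"
  shows "((\<lambda>k. (coef k f)\<^sup>2) has_sum (2 * pi * (\<integral>t. (f t)\<^sup>2 \<partial>circ))) UNIV"
proof -
  have f: "sq_int f" using cont by (rule sq_int_continuous)
  have "2 * pi * (\<integral>t. (f t)\<^sup>2 \<partial>circ) \<le> (\<Sum>\<^sub>\<infinity>k. (coef k f)\<^sup>2) + e" if "e > 0" for e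
  proof -
    \<comment> \<open>Chosen so that \<open>(2 * pi * d)\<^sup>2 = e\<close>.\<close>
    define d where "d = sqrt e / (2 * pi)"
    have "d > 0" using that by (simp add: d_def)
    then obtain p where p: "trig_poly p" "\<And>t. t \<in> {0..2*pi} \<Longrightarrow> \<bar>f t - p t\<bar> < d"
      using trig_poly_dense[OF cont per] by blast
    have sp: "sq_int p" using p(1) by (rule sq_int_trig_poly)
    obtain K where K: "finite K"
      "\<forall>r. sq_int r \<longrightarrow> (\<forall>k\<in>K. coef k r = 0) \<longrightarrow> (\<integral>t. r t * p t \<partial>circ) = 0"
      using trig_poly_orthogonal[OF p(1)] by blast
    define r where "r = (\<lambda>t. f t - fpart K f t)"
    have sr: "sq_int r" unfolding r_def by (intro sq_int_diff f sq_int_fpart)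
    have cr: "coef k r = 0" if "k \<in> K" for k
      using that K(1) by (simp add: r_def coef_diff f sq_int_fpart coef_fpart)
    have "(\<integral>t. r t * p t \<partial>circ) = 0" using K(2) sr cr by blast
    moreover have "(\<integral>t. r t * fpart K f t \<partial>circ) = 0"
      using cr by (simp add: integral_mult_fpart sr)
    \<comment> \<open>As \<open>r\<close> is orthogonal to \<open>p\<close> and to
      \<open>fpart K f\<close>, its square integral equals its inner product with
      \<open>f - p\<close>; the inequality between arithmetic and geometric mean then lets the left
      side absorb half of it.\<close>
    moreover have "(\<lambda>t. r t * (f t - p t)) = (\<lambda>t. r t * r t + r t * fpart K f t - r t * p t)"
      by (auto simp: r_def algebra_simps)
    ultimately have "(\<integral>t. r t * (f t - p t) \<partial>circ) = (\<integral>t. r t * r t \<partial>circ)"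
      by (simp add: sq_int_mult sr sp sq_int_fpart)
    moreover have "(\<integral>t. r t * (f t - p t) \<partial>circ) \<le> (\<integral>t. (1/2) * (r t * r t) + (1/2) * d\<^sup>2 \<partial>circ)"
    proof (rule integral_mono)
      fix t assume "t \<in> space circ"
      then have "\<bar>f t - p t\<bar> \<le> \<bar>d\<bar>" using p(2)[of t] by auto
      then have "(f t - p t)\<^sup>2 \<le> d\<^sup>2" using abs_le_square_iff by blast
      moreover have "0 \<le> (r t - (f t - p t))\<^sup>2" by simp
      then have "2 * (r t * (f t - p t)) \<le> r t * r t + (f t - p t)\<^sup>2"
        unfolding power2_diff[of "r t"] by (simp add: power2_eq_square)
      ultimately show "r t * (f t - p t) \<le> (1/2) * (r t * r t) + (1/2) * d\<^sup>2" by linarith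
    qed (simp_all add: sq_int_mult sr sq_int_diff f sp)
    moreover have "(\<integral>t. (1/2) * (r t * r t) + (1/2) * d\<^sup>2 \<partial>circ) =
        (1/2) * (\<integral>t. r t * r t \<partial>circ) + 2 * pi * ((1/2) * d\<^sup>2)"
      using sq_int_mult[OF sr sr] integral_circ_const[of "(1/2) * d\<^sup>2"]
      by (subst Bochner_Integration.integral_add) (auto simp only:
          Bochner_Integration.integral_mult_right_zero real_scaleR_def intro!: integrable_mult_right circ.integrable_const)
    ultimately have "(\<integral>t. (r t)\<^sup>2 \<partial>circ) \<le> 2 * pi * d\<^sup>2"
      by (simp add: power2_eq_square)
    then have "(\<integral>t. (f t)\<^sup>2 \<partial>circ) - (\<Sum>k\<in>K. (coef k f)\<^sup>2) / (2 * pi) \<le> 2 * pi * d\<^sup>2"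
      unfolding r_def integral_residual[OF f K(1)] .
    then have "2 * pi * (\<integral>t. (f t)\<^sup>2 \<partial>circ) \<le> (\<Sum>k\<in>K. (coef k f)\<^sup>2) + (2 * pi * d)\<^sup>2"
      by (simp add: field_simps power2_eq_square)
    also have "(2 * pi * d)\<^sup>2 = e" using that by (simp add: d_def)
    also have "(\<Sum>k\<in>K. (coef k f)\<^sup>2) \<le> (\<Sum>\<^sub>\<infinity>k. (coef k f)\<^sup>2)"
      using bessel_summable[OF f] K(1) by (intro finite_sum_le_infsum) auto
    finally show ?thesis by simp
  qed
  then have "2 * pi * (\<integral>t. (f t)\<^sup>2 \<partial>circ) \<le> (\<Sum>\<^sub>\<infinity>k. (coef k f)\<^sup>2)"
    by (rule field_le_epsilon)
  with bessel_infsum[OF f] have "(\<Sum>\<^sub>\<infinity>k. (coef k f)\<^sup>2) = 2 * pi * (\<integral>t. (f t)\<^sup>2 \<partial>circ)" by simp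
  then show ?thesis using has_sum_infsum[OF bessel_summable[OF f]] by simp
qed

lemma bij_uminus_int: "bij_betw uminus (UNIV :: int set) UNIV"
  by (rule bij_betwI[of _ _ _ uminus]) auto

lemma periodic_2pi_int:
  assumes "periodic_2pi f" shows "f (t + 2 * pi * of_int k) = f t"
proof -
  have nat: "f (t + 2 * pi * real j) = f t" for j t
  proof (induction j)
    case (Suc j)
    have "f (t + 2 * pi * real (Suc j)) = f ((t + 2 * pi * real j) + 2 * pi)"
      by (simp add: algebra_simps)
    then show ?case using assms Suc by (simp add: periodic_2pi_def)
  qed simp
  show ?thesis
  proof (cases "k \<ge> 0")
    case True
    then show ?thesis using nat[of t "nat k"] by simp
  next
    case False
    then show ?thesis using nat[of "t + 2 * pi * of_int k" "nat (-k)"] by simp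
  qed
qed

lemma periodic_2pi_endpoints: "periodic_2pi f \<Longrightarrow> f 0 = f (2 * pi)"
  unfolding periodic_2pi_def by (drule spec[of _ 0]) simp

lemma periodic_2pi_eqI:
  assumes "periodic_2pi f" "periodic_2pi g" and eq: "\<And>t. t \<in> {0..2*pi} \<Longrightarrow> f t = g t"
  shows "f t = g t"
proof -
  define k where "k = \<lfloor>t / (2 * pi)\<rfloor>"
  define s where "s = t - 2 * pi * of_int k"
  have "of_int k \<le> t / (2*pi)" "t / (2*pi) < of_int k + 1"
    by (auto simp: k_def)
  then have "s \<in> {0..2*pi}" by (auto simp: s_def field_simps)
  moreover have "f t = f s" "g t = g s"
    using periodic_2pi_int[OF assms(1), of s k] periodic_2pi_int[OF assms(2), of s k]
    by (simp_all add: s_def)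
  ultimately show ?thesis using eq by simp
qed

text \<open>Squared, this compares the frequency \<open>k\<close> with the first one: the larger
  change of a higher mode under translation is covered by the factor \<open>k\<^sup>2\<close> in its
  kinetic energy.\<close>

lemma sin_int_mult_le: "\<bar>sin (of_int k * x)\<bar> \<le> \<bar>of_int k\<bar> * \<bar>sin (x::real)\<bar>"
proof -
  have nat: "\<bar>sin (real j * x)\<bar> \<le> real j * \<bar>sin x\<bar>" for j
  proof (induction j)
    case (Suc j)
    have "\<bar>sin (real (Suc j) * x)\<bar> = \<bar>sin (real j * x) * cos x + cos (real j * x) * sin x\<bar>"
      using sin_add[of "real j * x" x] by (simp add: distrib_right add.commute)
    also have "\<dots> \<le> \<bar>sin (real j * x)\<bar> * 1 + 1 * \<bar>sin x\<bar>"
      by (rule order_trans[OF abs_triangle_ineq], unfold abs_mult)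
         (intro add_mono mult_left_mono mult_right_mono; simp)
    finally show ?case using Suc by (simp add: distrib_right)
  qed simp
  have "\<bar>sin (of_int k * x)\<bar> = \<bar>sin (real (nat \<bar>k\<bar>) * x)\<bar>"
    by (cases "k \<ge> 0") auto
  then show ?thesis using nat[of "nat \<bar>k\<bar>"] by simp
qed

section \<open>Wirtinger's inequality and translates of a periodic function\<close>

context
  fixes u v :: "real \<Rightarrow> real"
  assumes contu: "continuous_on UNIV u" and peru: "periodic_2pi u"
    and v: "sq_int v" and weak: "\<And>k. coef k v = - of_int k * coef (- k) u"
begin

lemma continuous_circ: "continuous_on {0..2*pi} u"
  using contu by (rule continuous_on_subset) simp

text \<open>The index changes its sign because the derivative of \<open>cas k\<close> is a multiple
  of \<open>cas (- k)\<close>; the sums over all integers do not notice this.\<close>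

lemma weak_coef_square: "(of_int k)\<^sup>2 * (coef k u)\<^sup>2 = (coef (- k) v)\<^sup>2"
  using weak[of "- k"] by (simp add: power_mult_distrib)

lemma parseval_weak: "((\<lambda>k. (coef k u)\<^sup>2) has_sum (2 * pi * (\<integral>t. (u t)\<^sup>2 \<partial>circ))) UNIV"
proof (rule parseval)
  show "continuous_on {0..2*pi} u" by (rule continuous_circ)
  show "u 0 = u (2*pi)" using peru by (rule periodic_2pi_endpoints)
qed

lemma weak_summable: "(\<lambda>k. (of_int k)\<^sup>2 * (coef k u)\<^sup>2) summable_on UNIV"
  unfolding weak_coef_square
  using bessel_summable[OF v] summable_on_reindex_bij_betw[OF bij_uminus_int, of "\<lambda>k. (coef k v)\<^sup>2"]
  by simp

lemma weak_infsum: "(\<Sum>\<^sub>\<infinity>k. (of_int k)\<^sup>2 * (coef k u)\<^sup>2) \<le> 2 * pi * (\<integral>t. (v t)\<^sup>2 \<partial>circ)"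
  unfolding weak_coef_square
  using bessel_infsum[OF v] infsum_reindex_bij_betw[OF bij_uminus_int, of "\<lambda>k. (coef k v)\<^sup>2"]
  by simp

text \<open>The defect in Wirtinger's inequality dominates a series whose terms are all nonnegative,
  the mean condition taking care of \<open>k = 0\<close>. A single term is kept:
  \<open>k = 1\<close> gives the inequality, and the terms with \<open>k\<close> of modulus at least
  2 give the equality case.\<close>

lemma poincare_excess:
  assumes mean: "coef 0 u = 0"
  shows "((of_int k)\<^sup>2 - 1) * (coef k u)\<^sup>2 \<le> 2 * pi * ((\<integral>t. (v t)\<^sup>2 \<partial>circ) - (\<integral>t. (u t)\<^sup>2 \<partial>circ))"
proof -
  let ?g = "\<lambda>k. (of_int k)\<^sup>2 * (coef k u)\<^sup>2 + (-1) * (coef k u)\<^sup>2"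
  have s: "(?g has_sum ((\<Sum>\<^sub>\<infinity>k. (of_int k)\<^sup>2 * (coef k u)\<^sup>2)
      + (-1) * (2 * pi * (\<integral>t. (u t)\<^sup>2 \<partial>circ)))) UNIV"
    by (intro has_sum_add has_sum_cmult_right has_sum_infsum weak_summable parseval_weak)
  have nn: "?g j \<ge> 0" for j
  proof (cases "j = 0")
    case False
    then have "1 \<le> \<bar>of_int j :: real\<bar>" by linarith
    then have "1 \<le> (of_int j :: real)\<^sup>2" using power_mono[of 1 "\<bar>of_int j :: real\<bar>" 2] by simp
    then show ?thesis using mult_right_mono[of 1 "(of_int j)\<^sup>2" "(coef j u)\<^sup>2"] by simp
  qed (use mean in simp)
  have "sum ?g {k} \<le> infsum ?g UNIV"
    using nn by (intro finite_sum_le_infsum has_sum_imp_summable[OF s]) auto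
  also have "\<dots> \<le> 2 * pi * (\<integral>t. (v t)\<^sup>2 \<partial>circ) - 2 * pi * (\<integral>t. (u t)\<^sup>2 \<partial>circ)"
    using weak_infsum unfolding infsumI[OF s] by simp
  finally show ?thesis by (simp add: algebra_simps)
qed

lemma poincare:
  assumes "coef 0 u = 0" shows "(\<integral>t. (u t)\<^sup>2 \<partial>circ) \<le> (\<integral>t. (v t)\<^sup>2 \<partial>circ)"
  using poincare_excess[OF assms, of 1] pi_gt_zero by (simp add: zero_le_mult_iff)

text \<open>Without defect all modes except \<open>1\<close> and \<open>-1\<close> vanish. Hence
  \<open>u\<close> and its projection onto these two have the same coefficients, and Parseval's
  identity together with continuity makes them equal everywhere.\<close>

lemma poincare_equality:
  assumes mean: "coef 0 u = 0" and eq: "(\<integral>t. (v t)\<^sup>2 \<partial>circ) = (\<integral>t. (u t)\<^sup>2 \<partial>circ)"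
  shows "\<exists>a b. \<forall>t. u t = a * cos t + b * sin t"
proof -
  let ?p = "fpart {1, -1} u"
  define g where "g = (\<lambda>t. u t - ?p t)"
  have "coef k u = 0" if "k \<noteq> 1" "k \<noteq> -1" for k
  proof (cases "k = 0")
    case False
    with that have "2 \<le> \<bar>of_int k :: real\<bar>" by linarith
    then have "2\<^sup>2 \<le> (of_int k :: real)\<^sup>2" using power_mono[of 2 "\<bar>of_int k :: real\<bar>" 2] by simp
    then have "(of_int k)\<^sup>2 - 1 > (0::real)" by simp
    moreover have "((of_int k)\<^sup>2 - 1) * (coef k u)\<^sup>2 \<le> 0"
      using poincare_excess[OF mean, of k] eq by simp
    ultimately show ?thesis by (simp add: mult_le_0_iff)
  qed (use mean in simp)
  then have "coef k g = 0" for k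
    unfolding g_def coef_diff[OF sq_int_continuous[OF continuous_circ] sq_int_fpart]
    by (simp add: coef_fpart)
  moreover have contg: "continuous_on {0..2*pi} g"
    unfolding g_def by (intro continuous_intros continuous_circ)
  moreover have perp: "periodic_2pi ?p"
    by (simp add: periodic_2pi_def fpart_def cas_periodic)
  then have "g 0 = g (2*pi)"
    using periodic_2pi_endpoints[OF peru] periodic_2pi_endpoints[OF perp] by (simp add: g_def)
  ultimately have "((\<lambda>k::int. 0::real) has_sum (2 * pi * (\<integral>t. (g t)\<^sup>2 \<partial>circ))) UNIV"
    using parseval[of g] by simp
  then have "2 * pi * (\<integral>t. (g t)\<^sup>2 \<partial>circ) = 0"
    using infsumI by fastforce
  then have zero: "(\<integral>t. (g t)\<^sup>2 \<partial>circ) \<le> 0" by simp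
  have "(g t)\<^sup>2 = 0" if "t \<in> {0..2*pi}" for t
    using contg that by (intro continuous_integral_circ_zero[of "\<lambda>t. (g t)\<^sup>2"] zero continuous_intros) auto
  then have "u t = ?p t" if "t \<in> {0..2*pi}" for t
    using that by (simp add: g_def)
  then have "u t = ?p t" for t
    using periodic_2pi_eqI[OF peru perp] by blast
  then have "\<forall>t. u t = (coef 1 u + coef (-1) u) / (2*pi) * cos t + (coef 1 u - coef (-1) u) / (2*pi) * sin t"
    by (simp add: fpart_def cas_def distrib_left left_diff_distrib add_divide_distrib diff_divide_distrib distrib_right)
  then show ?thesis by blast
qed

text \<open>Translation rotates the pair of coefficients at \<open>k\<close> and \<open>- k\<close>
  by the angle \<open>of_int k * h\<close>. The proof moves the shift from \<open>u\<close> to the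
  kernel.\<close>

lemma coef_shift: "coef k (\<lambda>t. u (t + h)) = cos (of_int k * h) * coef k u - sin (of_int k * h) * coef (-k) u"
proof -
  have "coef k (\<lambda>t. u (t + h)) = (\<integral>t. (\<lambda>t. cas k (t - h) * u t) (t + h) \<partial>circ)"
    by (simp add: coef_def)
  also have "\<dots> = (\<integral>t. cas k (t - h) * u t \<partial>circ)"
  proof (rule integral_circ_shift)
    show "continuous_on UNIV (\<lambda>t. cas k (t - h) * u t)"
      by (intro continuous_intros contu continuous_on_compose2[OF continuous_on_cas]) auto
    have "t + 2*pi - h = (t - h) + 2*pi" for t by simp
    then show "periodic_2pi (\<lambda>t. cas k (t - h) * u t)"
      using peru cas_periodic[of k] unfolding periodic_2pi_def by metis
  qed
  also have "\<dots> = (\<integral>t. cos (of_int k * h) * (cas k t * u t) - sin (of_int k * h) * (cas (-k) t * u t) \<partial>circ)"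
    by (simp add: cas_def algebra_simps cos_diff sin_diff)
  also have "\<dots> = cos (of_int k * h) * coef k u - sin (of_int k * h) * coef (-k) u"
  proof -
    have "sq_int u" by (rule sq_int_continuous[OF continuous_circ])
    then show ?thesis by (simp add: coef_def sq_int_mult sq_int_cas)
  qed
  finally show ?thesis .
qed

text \<open>On the modes \<open>k\<close> and \<open>- k\<close> together, shift minus identity
  multiplies squared lengths by \<open>2 - 2 * cos (k * h) = 4 * (sin (k * h / 2))\<^sup>2\<close>,
  which is at most \<open>k\<^sup>2\<close> times its value for \<open>k = 1\<close>. The constant
  is thus that of uniform rotation.\<close>

lemma shift_difference_bound:
  "(\<integral>t. (u (t + h) - u t)\<^sup>2 \<partial>circ) \<le> 4 * (sin (h / 2))\<^sup>2 * (\<integral>t. (v t)\<^sup>2 \<partial>circ)"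
proof -
  let ?w = "\<lambda>t. u (t + h) - u t"
  \<comment> \<open>The terms at \<open>k\<close> and \<open>- k\<close> are added before they are
    compared, since the shift mixes them; both series are thereby counted twice.\<close>
  let ?f = "\<lambda>k. (coef k ?w)\<^sup>2 + (coef (-k) ?w)\<^sup>2"
  let ?e = "\<lambda>k. (coef k v)\<^sup>2 + (coef (-k) v)\<^sup>2"
  have contS: "continuous_on {0..2*pi} (\<lambda>t. u (t + h))"
    by (intro continuous_on_compose2[OF contu] continuous_intros) auto
  have "?w 0 = ?w (2*pi)"
    using periodic_2pi_endpoints[OF peru] peru by (simp add: periodic_2pi_def add.commute[of "2*pi"])
  then have w: "((\<lambda>k. (coef k ?w)\<^sup>2) has_sum (2 * pi * (\<integral>t. (?w t)\<^sup>2 \<partial>circ))) UNIV"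
    by (intro parseval continuous_intros contS continuous_circ)
  have w': "((\<lambda>k. (coef (-k) ?w)\<^sup>2) has_sum (2 * pi * (\<integral>t. (?w t)\<^sup>2 \<partial>circ))) UNIV"
    using w has_sum_reindex_bij_betw[OF bij_uminus_int, of "\<lambda>k. (coef k ?w)\<^sup>2"] by simp
  have f: "(?f has_sum (4 * pi * (\<integral>t. (?w t)\<^sup>2 \<partial>circ))) UNIV"
    using has_sum_add[OF w w'] by (simp add: mult.assoc)
  have e1: "((\<lambda>k. (coef k v)\<^sup>2) has_sum (\<Sum>\<^sub>\<infinity>k. (coef k v)\<^sup>2)) UNIV"
    by (intro has_sum_infsum bessel_summable v)
  have e2: "((\<lambda>k. (coef (-k) v)\<^sup>2) has_sum (\<Sum>\<^sub>\<infinity>k. (coef k v)\<^sup>2)) UNIV"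
    using e1 has_sum_reindex_bij_betw[OF bij_uminus_int, of "\<lambda>k. (coef k v)\<^sup>2"] by simp
  have e: "((\<lambda>k. 4 * (sin (h/2))\<^sup>2 * ?e k) has_sum (4 * (sin (h/2))\<^sup>2 * (2 * (\<Sum>\<^sub>\<infinity>k. (coef k v)\<^sup>2)))) UNIV"
    using has_sum_cmult_right[OF has_sum_add[OF e1 e2], of "4 * (sin (h/2))\<^sup>2"] by simp
  have "?f k \<le> 4 * (sin (h/2))\<^sup>2 * ?e k" for k
  proof -
    define c s where "c = cos (of_int k * h)" and "s = sin (of_int k * h)"
    have cs: "c\<^sup>2 + s\<^sup>2 = 1" by (simp add: c_def s_def)
    have half: "2 - 2 * c = 4 * (sin (of_int k * (h/2)))\<^sup>2"
      using cos_double_sin[of "of_int k * (h/2)"] by (simp add: c_def)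
    have d: "coef j ?w = coef j (\<lambda>t. u (t + h)) - coef j u" for j
      by (intro coef_diff sq_int_continuous contS continuous_circ)
    have ck: "coef k ?w = (c - 1) * coef k u - s * coef (-k) u"
      "coef (-k) ?w = (c - 1) * coef (-k) u + s * coef k u"
      unfolding d coef_shift by (simp_all add: c_def s_def algebra_simps)
    have "?f k = ((c\<^sup>2 + s\<^sup>2) + 1 - 2 * c) * ((coef k u)\<^sup>2 + (coef (-k) u)\<^sup>2)"
      unfolding ck by (simp add: power2_eq_square algebra_simps)
    also have "\<dots> = 4 * (sin (of_int k * (h/2)))\<^sup>2 * ((coef k u)\<^sup>2 + (coef (-k) u)\<^sup>2)"
      unfolding cs using half by simp
    also have "\<dots> \<le> 4 * ((of_int k)\<^sup>2 * (sin (h/2))\<^sup>2) * ((coef k u)\<^sup>2 + (coef (-k) u)\<^sup>2)"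
    proof (intro mult_right_mono mult_left_mono)
      have "\<bar>sin (of_int k * (h/2))\<bar> \<le> \<bar>of_int k * sin (h/2)\<bar>"
        using sin_int_mult_le[of k "h/2"] by (simp add: abs_mult)
      then show "(sin (of_int k * (h/2)))\<^sup>2 \<le> (of_int k)\<^sup>2 * (sin (h/2))\<^sup>2"
        unfolding abs_le_square_iff by (simp add: power_mult_distrib)
    qed auto
    also have "\<dots> = 4 * (sin (h/2))\<^sup>2 *
        ((of_int (-k))\<^sup>2 * (coef (-k) u)\<^sup>2 + (of_int k)\<^sup>2 * (coef k u)\<^sup>2)"
      by (simp add: algebra_simps)
    also have "\<dots> = 4 * (sin (h/2))\<^sup>2 * ?e k"
      by (simp only: weak_coef_square minus_minus)
    finally show ?thesis .
  qed
  then have "4 * pi * (\<integral>t. (?w t)\<^sup>2 \<partial>circ) \<le> 4 * (sin (h/2))\<^sup>2 * (2 * (\<Sum>\<^sub>\<infinity>k. (coef k v)\<^sup>2))"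
    by (intro has_sum_mono[OF f e])
  also have "\<dots> \<le> 4 * (sin (h/2))\<^sup>2 * (2 * (2 * pi * (\<integral>t. (v t)\<^sup>2 \<partial>circ)))"
    using bessel_infsum[OF v] by (intro mult_left_mono) auto
  finally have "(4 * pi) * (\<integral>t. (?w t)\<^sup>2 \<partial>circ) \<le> (4 * pi) * (4 * (sin (h/2))\<^sup>2 * (\<integral>t. (v t)\<^sup>2 \<partial>circ))"
    by (simp only: mult_ac)
  then show ?thesis by (rule mult_left_le_imp_le) simp
qed

end

text \<open>
  Such a function is orthogonal to all continuous functions. As \<open>sgn w\<close> is an almost everywhere
  limit of continuous functions \<open>g n\<close>, which may be clipped to \<open>[-1, 1]\<close> and made to vanish at \<open>0\<close> and
  \<open>2\<pi>\<close>, dominated convergence yields \<open>\<integral>|w| = 0\<close>.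
\<close>

lemma coef_zero_imp_AE_zero:
  assumes w: "sq_int w" and coef: "\<And>k. coef k w = 0"
  shows "AE t in circ. w t = 0"
proof -
  have iw: "integrable circ w" by (rule sq_int_integrable[OF w])
  have trig: "(\<integral>t. w t * p t \<partial>circ) = 0" if "trig_poly p" for p
    using trig_poly_orthogonal[OF that] w coef by blast
  have cont: "(\<integral>t. w t * f t \<partial>circ) = 0"
    if f: "continuous_on {0..2*pi} f" "f 0 = f (2*pi)" for f
  proof -
    have "\<bar>\<integral>t. w t * f t \<partial>circ\<bar> \<le> e * (\<integral>t. \<bar>w t\<bar> \<partial>circ)" if "e > 0" for e
    proof -
      obtain p where p: "trig_poly p" "\<And>t. t \<in> {0..2*pi} \<Longrightarrow> \<bar>f t - p t\<bar> < e"
        using trig_poly_dense[OF f \<open>e > 0\<close>] by blast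
      note sp = sq_int_trig_poly[OF p(1)] and sf = sq_int_continuous[OF f(1)]
      have "(\<integral>t. w t * f t \<partial>circ) = (\<integral>t. w t * (f t - p t) \<partial>circ)"
        using trig[OF p(1)] by (simp add: right_diff_distrib sq_int_mult w sp sf)
      also have "\<bar>\<dots>\<bar> \<le> (\<integral>t. \<bar>w t * (f t - p t)\<bar> \<partial>circ)"
        by (rule integral_abs_bound)
      also have "\<dots> \<le> (\<integral>t. e * \<bar>w t\<bar> \<partial>circ)"
      proof (rule integral_mono)
        fix t assume "t \<in> space circ"
        then have "\<bar>f t - p t\<bar> \<le> e" using p(2)[of t] by simp
        then show "\<bar>w t * (f t - p t)\<bar> \<le> e * \<bar>w t\<bar>"
          by (simp add: abs_mult mult.commute[of e] mult_left_mono)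
      qed (intro integrable_abs integrable_mult_right iw sq_int_mult w sq_int_diff sf sp)+
      finally show ?thesis by simp
    qed
    note bound = this
    have "\<bar>\<integral>t. w t * f t \<partial>circ\<bar> \<le> 0 + e" if "e > 0" for e
    proof -
      let ?I = "\<integral>t. \<bar>w t\<bar> \<partial>circ"
      have I: "?I \<ge> 0" by simp
      have "\<bar>\<integral>t. w t * f t \<partial>circ\<bar> \<le> e / (?I + 1) * ?I"
        using that I by (intro bound divide_pos_pos) linarith+
      also have "\<dots> \<le> e / (?I + 1) * (?I + 1)"
        using that I by (intro mult_left_mono divide_nonneg_nonneg) linarith+
      also have "\<dots> = e" using add_nonneg_pos[OF I zero_less_one] by (intro nonzero_eq_divide_eq[THEN iffD1]) auto
      finally show ?thesis by simp
    qed
    then have "\<bar>\<integral>t. w t * f t \<partial>circ\<bar> \<le> 0" by (rule field_le_epsilon)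
    then show ?thesis by simp
  qed
  define s where "s t = (if t \<in> {0..2*pi} then sgn (w t) else 0)" for t
  have "s \<in> borel_measurable lborel"
  proof -
    have "(\<lambda>t. sgn (w t)) \<in> borel_measurable circ"
      using w unfolding sq_int_def by (intro measurable_compose[OF _ borel_measurable_sgn]) blast
    then have "(\<lambda>t. indicator {0..2*pi} t *\<^sub>R sgn (w t)) \<in> borel_measurable lborel"
      unfolding circ_def by (subst (asm) borel_measurable_restrict_space_iff) auto
    also have "(\<lambda>t. indicator {0..2*pi} t *\<^sub>R sgn (w t)) = s"
      by (auto simp: s_def)
    finally show ?thesis .
  qed
  then have "s \<in> borel_measurable lebesgue" by (rule measurable_completion)
  then have "s measurable_on UNIV" by (rule lebesgue_measurable_imp_measurable_on) simp
  then obtain N g where N: "negligible N" and g: "\<And>n. continuous_on UNIV (g n)"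
    "\<And>t. t \<notin> N \<Longrightarrow> (\<lambda>n. g n t) \<longlonglongrightarrow> s t"
    unfolding measurable_on_def by auto
  define h where "h n t = min 1 (real n * (t * (2 * pi - t))) * max (-1) (min 1 (g n t))" for n t
  have conth: "continuous_on {0..2*pi} (h n)" for n
    unfolding h_def using continuous_on_subset[OF g(1), of "{0..2*pi}" n]
    by (intro continuous_intros) auto
  have h_zero: "(\<integral>t. w t * h n t \<partial>circ) = 0" for n
    by (rule cont[OF conth]) (simp add: h_def)
  have lim: "(\<lambda>n. h n t) \<longlonglongrightarrow> sgn (w t)" if t: "0 < t" "t < 2*pi" "t \<notin> N" for t
  proof -
    have "\<forall>\<^sub>F n in sequentially. real n \<ge> 1 / (t * (2 * pi - t))"
      using filterlim_real_sequentially by (simp add: filterlim_at_top)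
    then have "\<forall>\<^sub>F n in sequentially. min 1 (real n * (t * (2 * pi - t))) = 1"
      by eventually_elim (use t in \<open>simp add: field_simps\<close>)
    then have 1: "(\<lambda>n. min 1 (real n * (t * (2 * pi - t)))) \<longlonglongrightarrow> 1"
      by (rule tendsto_eventually)
    have "(\<lambda>n. max (-1) (min 1 (g n t))) \<longlonglongrightarrow> max (-1) (min 1 (sgn (w t)))"
      using g(2)[OF t(3)] t by (intro tendsto_intros) (simp add: s_def)
    also have "max (-1) (min 1 (sgn (w t))) = sgn (w t)" by (simp add: sgn_if)
    finally show ?thesis unfolding h_def using tendsto_mult[OF 1] by fastforce
  qed
  have AE_N: "AE t in circ. 0 < t \<and> t < 2*pi \<and> t \<notin> N"
  proof -
    \<comment> \<open>The endpoints join the exceptional set: every \<open>h n\<close> vanishes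
      there, while \<open>sgn (w t)\<close> may not.\<close>
    have "N \<union> {0, 2*pi} \<in> null_sets lebesgue"
      using N by (simp add: negligible_iff_null_sets[symmetric] negligible_Un)
    then have "AE t in lebesgue. t \<notin> N \<union> {0, 2*pi}" by (rule AE_not_in)
    then have "AE t in lborel. t \<notin> N \<union> {0, 2*pi}" by (simp only: AE_completion_iff)
    then have "AE t in lborel. t \<in> {0..2*pi} \<longrightarrow> 0 < t \<and> t < 2*pi \<and> t \<notin> N"
      by eventually_elim auto
    then show ?thesis unfolding circ_def by (subst AE_restrict_space_iff) auto
  qed
  have "(\<lambda>n. \<integral>t. w t * h n t \<partial>circ) \<longlonglongrightarrow> (\<integral>t. \<bar>w t\<bar> \<partial>circ)"
  proof (rule integral_dominated_convergence[where w = "\<lambda>t. \<bar>w t\<bar>"])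
    show "AE t in circ. (\<lambda>n. w t * h n t) \<longlonglongrightarrow> \<bar>w t\<bar>"
      using AE_N
    proof eventually_elim
      case (elim t)
      then have "(\<lambda>n. w t * h n t) \<longlonglongrightarrow> w t * sgn (w t)"
        by (intro tendsto_intros lim) auto
      then show ?case by (simp add: abs_sgn)
    qed
    show "AE t in circ. norm (w t * h n t) \<le> \<bar>w t\<bar>" for n
    proof (rule AE_I2)
      fix t assume "t \<in> space circ"
      then have "0 \<le> min 1 (real n * (t * (2 * pi - t)))" by simp
      then have "\<bar>min 1 (real n * (t * (2 * pi - t)))\<bar> \<le> 1" by linarith
      moreover have "\<bar>max (-1) (min 1 (g n t))\<bar> \<le> 1" by linarith
      ultimately have "\<bar>h n t\<bar> \<le> 1" unfolding h_def abs_mult by (simp add: mult_le_one)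
      then show "norm (w t * h n t) \<le> \<bar>w t\<bar>" by (simp add: abs_mult mult_left_le)
    qed
    show "(\<lambda>t. w t * h n t) \<in> borel_measurable circ" for n
      using sq_int_mult[OF w sq_int_continuous[OF conth]] by (rule borel_measurable_integrable)
    show "(\<lambda>t. \<bar>w t\<bar>) \<in> borel_measurable circ" "integrable circ (\<lambda>t. \<bar>w t\<bar>)"
      using iw by auto
  qed
  then have "(\<integral>t. \<bar>w t\<bar> \<partial>circ) = 0"
    unfolding h_zero using LIMSEQ_unique tendsto_const by blast
  then have "AE t in circ. \<bar>w t\<bar> = 0"
    using iw by (subst (asm) integral_nonneg_eq_0_iff_AE) auto
  then show ?thesis by simp
qed

section \<open>Sobolev functions\<close>

text \<open>Makes \<open>cas k\<close> an admissible test function for weak derivatives. The span of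
  \<open>cas k\<close> and \<open>cas (- k)\<close> is closed under differentiation, so it contains
  all iterated derivatives.\<close>

lemma cas_smooth: "smooth_real (cas k)"
proof -
  have "\<exists>a b. (deriv ^^ j) (cas k) = (\<lambda>t. a * cas k t + b * cas (-k) t)" for j
  proof (induction j)
    case 0
    show ?case by (intro exI[of _ 1] exI[of _ 0]) auto
  next
    case (Suc j)
    then obtain a b where "(deriv ^^ j) (cas k) = (\<lambda>t. a * cas k t + b * cas (-k) t)" by blast
    moreover have "deriv (\<lambda>t. a * cas k t + b * cas (-k) t) =
        (\<lambda>t. (- b * of_int k) * cas k t + (a * of_int k) * cas (-k) t)"
    proof
      fix t
      have d: "(cas l has_field_derivative of_int l * cas (-l) t) (at t)" for l
        using cas_has_vector_derivative[of l t UNIV]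
        by (simp add: has_real_derivative_iff_has_vector_derivative)
      have "((\<lambda>t. a * cas k t + b * cas (-k) t) has_field_derivative
          a * (of_int k * cas (-k) t) + b * (of_int (-k) * cas (- (-k)) t)) (at t)"
        by (intro DERIV_add DERIV_cmult d)
      then show "deriv (\<lambda>t. a * cas k t + b * cas (-k) t) t =
          (- b * of_int k) * cas k t + (a * of_int k) * cas (-k) t"
        by (simp add: DERIV_imp_deriv algebra_simps)
    qed
    ultimately have "(deriv ^^ Suc j) (cas k) =
        (\<lambda>t. (- b * of_int k) * cas k t + (a * of_int k) * cas (-k) t)"
      by (simp only: funpow.simps o_apply)
    then show ?case by blast
  qed
  then obtain a b where ab: "(deriv ^^ j) (cas k) = (\<lambda>t. a j * cas k t + b j * cas (-k) t)" for j
    by metis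
  have "cas l differentiable (at t)" for l t
    using cas_has_vector_derivative[of l t UNIV] by (rule differentiableI_vector)
  then show ?thesis unfolding smooth_real_def ab by auto
qed

lemma deriv_cas: "deriv (cas k) t = of_int k * cas (-k) t"
  using cas_has_vector_derivative[of k t UNIV]
  by (intro DERIV_imp_deriv) (simp add: has_real_derivative_iff_has_vector_derivative)

lemma L2_2pi_circ:
  assumes "L2_2pi f"
  shows "f \<in> borel_measurable circ" "integrable circ (\<lambda>t. (norm (f t))\<^sup>2)"
  using assms by (auto simp: L2_2pi_def integrable_circ_iff_set borel_measurable_circ)

lemma L2_2pi_scaleR_integrable:
  fixes f :: "real \<Rightarrow> 'a::euclidean_space"
  assumes "L2_2pi f" and g: "continuous_on {0..2*pi} g"
  shows "integrable circ (\<lambda>t. g t *\<^sub>R f t)"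
proof (rule Bochner_Integration.integrable_bound)
  have g_meas: "g \<in> borel_measurable circ"
    using g by (intro borel_measurable_integrable) auto
  show "(\<lambda>t. g t *\<^sub>R f t) \<in> borel_measurable circ"
    using L2_2pi_circ(1)[OF assms(1)] g_meas by (intro borel_measurable_scaleR) auto
  show "integrable circ (\<lambda>t. (g t)\<^sup>2 + (norm (f t))\<^sup>2)"
    using L2_2pi_circ(2)[OF assms(1)]
    by (intro Bochner_Integration.integrable_add integrable_circ_continuous[OF continuous_on_power[OF g]])
  have "\<bar>g t\<bar> * norm (f t) \<le> (g t)\<^sup>2 + (norm (f t))\<^sup>2" for t
  proof -
    have "0 \<le> (\<bar>g t\<bar> - norm (f t))\<^sup>2" by simp
    then have "2 * (\<bar>g t\<bar> * norm (f t)) \<le> (g t)\<^sup>2 + (norm (f t))\<^sup>2" by (simp add: power2_diff)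
    then show ?thesis using mult_nonneg_nonneg[OF abs_ge_zero[of "g t"] norm_ge_zero[of "f t"]] by linarith
  qed
  then show "AE t in circ. norm (g t *\<^sub>R f t) \<le> norm ((g t)\<^sup>2 + (norm (f t))\<^sup>2)" by simp
qed

lemma L2_2pi_inner:
  fixes f :: "real \<Rightarrow> 'a::euclidean_space"
  assumes "L2_2pi f" shows "sq_int (\<lambda>t. f t \<bullet> b)"
  unfolding sq_int_def
proof
  show meas: "(\<lambda>t. f t \<bullet> b) \<in> borel_measurable circ"
    using L2_2pi_circ(1)[OF assms] by (intro borel_measurable_inner) auto
  show "integrable circ (\<lambda>t. (f t \<bullet> b)\<^sup>2)"
  proof (rule Bochner_Integration.integrable_bound)
    show "integrable circ (\<lambda>t. (norm (f t))\<^sup>2 * (norm b)\<^sup>2)"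
      using L2_2pi_circ(2)[OF assms] by simp
    show "(\<lambda>t. (f t \<bullet> b)\<^sup>2) \<in> borel_measurable circ"
      using meas by (intro borel_measurable_power)
    have "(f t \<bullet> b)\<^sup>2 \<le> (norm (f t))\<^sup>2 * (norm b)\<^sup>2" for t
      using Cauchy_Schwarz_ineq2[of "f t" b] by (metis abs_ge_zero power2_abs power_mono power_mult_distrib)
    then show "AE t in circ. norm ((f t \<bullet> b)\<^sup>2) \<le> norm ((norm (f t))\<^sup>2 * (norm b)\<^sup>2)"
      by simp
  qed
qed

lemma norm_square_eq_sum_Basis: "(norm (x::'a::euclidean_space))\<^sup>2 = (\<Sum>b\<in>Basis. (x \<bullet> b)\<^sup>2)"
  unfolding power2_norm_eq_inner by (subst euclidean_inner) (simp add: power2_eq_square)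

lemma L2_2pi_norm_integral:
  fixes f :: "real \<Rightarrow> 'a::euclidean_space"
  assumes "L2_2pi f"
  shows "(\<integral>t. (norm (f t))\<^sup>2 \<partial>circ) = (\<Sum>b\<in>Basis. \<integral>t. (f t \<bullet> b)\<^sup>2 \<partial>circ)"
  unfolding norm_square_eq_sum_Basis
  using L2_2pi_inner[OF assms] by (intro Bochner_Integration.integral_sum) (simp add: sq_int_def)

text \<open>The definition of a weak derivative, tested with \<open>cas k\<close> and read in the
  direction \<open>b\<close>. This identity connects weak derivatives to the Fourier
  arguments.\<close>

lemma weak_deriv_coef:
  fixes u v :: "real \<Rightarrow> 'a::euclidean_space"
  assumes "L2_2pi u" "L2_2pi v" "is_weak_deriv u v"
  shows "coef k (\<lambda>t. v t \<bullet> b) = - of_int k * coef (- k) (\<lambda>t. u t \<bullet> b)"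
proof -
  have int: "integrable circ (\<lambda>t. (of_int k * cas (-k) t) *\<^sub>R u t)" "integrable circ (\<lambda>t. cas k t *\<^sub>R v t)"
    by (intro L2_2pi_scaleR_integrable assms continuous_intros)+
  have "periodic_2pi (cas k)" by (simp add: periodic_2pi_def cas_periodic)
  then have "(\<integral>t. (of_int k * cas (-k) t) *\<^sub>R u t \<partial>circ) = - (\<integral>t. cas k t *\<^sub>R v t \<partial>circ)"
    using assms(3)[unfolded is_weak_deriv_def integral_circ_eq_set, THEN spec[of _ "cas k"]] cas_smooth[of k]
    unfolding deriv_cas by simp
  then have "(\<integral>t. (of_int k * cas (-k) t) *\<^sub>R u t \<partial>circ) \<bullet> b = - ((\<integral>t. cas k t *\<^sub>R v t \<partial>circ) \<bullet> b)"
    by simp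
  moreover have "(\<integral>t. ((of_int k * cas (-k) t) *\<^sub>R u t) \<bullet> b \<partial>circ) =
      (\<integral>t. (of_int k * cas (-k) t) *\<^sub>R u t \<partial>circ) \<bullet> b"
    using int(1) by (rule integral_inner_left)
  moreover have "(\<integral>t. (cas k t *\<^sub>R v t) \<bullet> b \<partial>circ) = (\<integral>t. cas k t *\<^sub>R v t \<partial>circ) \<bullet> b"
    using int(2) by (rule integral_inner_left)
  ultimately have "(\<integral>t. ((of_int k * cas (-k) t) *\<^sub>R u t) \<bullet> b \<partial>circ) = - (\<integral>t. (cas k t *\<^sub>R v t) \<bullet> b \<partial>circ)"
    by (simp only:)
  then show ?thesis by (simp add: coef_def mult.assoc)
qed

lemma H1_2piD:
  assumes "u \<in> H1_2pi"
  shows "continuous_on UNIV u" "periodic_2pi u" "L2_2pi u" "L2_2pi (weak_deriv u)"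
    "is_weak_deriv u (weak_deriv u)"
proof -
  have "\<exists>v. L2_2pi v \<and> is_weak_deriv u v" using assms by (auto simp: H1_2pi_def)
  from someI_ex[OF this] show "L2_2pi (weak_deriv u)" "is_weak_deriv u (weak_deriv u)"
    by (auto simp: weak_deriv_def)
qed (use assms in \<open>auto simp: H1_2pi_def L2_2pi_def\<close>)

lemma H1_2pi_inner:
  assumes "u \<in> H1_2pi"
  shows "continuous_on UNIV (\<lambda>t. u t \<bullet> b)" "periodic_2pi (\<lambda>t. u t \<bullet> b)"
    "sq_int (\<lambda>t. weak_deriv u t \<bullet> b)"
    "coef k (\<lambda>t. weak_deriv u t \<bullet> b) = - of_int k * coef (- k) (\<lambda>t. u t \<bullet> b)"
proof -
  note u = H1_2piD[OF assms]
  show "continuous_on UNIV (\<lambda>t. u t \<bullet> b)" by (intro continuous_intros u)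
  show "periodic_2pi (\<lambda>t. u t \<bullet> b)" using u(2) by (simp add: periodic_2pi_def)
  show "sq_int (\<lambda>t. weak_deriv u t \<bullet> b)" by (rule L2_2pi_inner[OF u(4)])
  show "coef k (\<lambda>t. weak_deriv u t \<bullet> b) = - of_int k * coef (- k) (\<lambda>t. u t \<bullet> b)"
    by (rule weak_deriv_coef[OF u(3-5)])
qed

lemma H1_2pi_coef_0:
  assumes "u \<in> H1_2pi" "integral\<^sup>L circ u = 0"
  shows "coef 0 (\<lambda>t. u t \<bullet> b) = 0"
proof -
  have "integrable circ u"
    by (rule integrable_circ_continuous[OF continuous_on_subset[OF H1_2piD(1)[OF assms(1)] subset_UNIV]])
  then have "(\<integral>t. u t \<bullet> b \<partial>circ) = integral\<^sup>L circ u \<bullet> b"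
    by (rule integral_inner_left)
  then have "(\<integral>t. u t \<bullet> b \<partial>circ) = 0"
    using assms(2) by simp
  then show ?thesis by (simp add: coef_def)
qed

theorem H1_poincare:
  fixes u :: "real \<Rightarrow> 'a::euclidean_space"
  assumes "u \<in> H1_2pi" "integral\<^sup>L circ u = 0"
  shows "(\<integral>t. (norm (u t))\<^sup>2 \<partial>circ) \<le> (\<integral>t. (norm (weak_deriv u t))\<^sup>2 \<partial>circ)"
  unfolding L2_2pi_norm_integral[OF H1_2piD(3)[OF assms(1)]] L2_2pi_norm_integral[OF H1_2piD(4)[OF assms(1)]]
  by (rule sum_mono) (rule poincare[OF H1_2pi_inner[OF assms(1)] H1_2pi_coef_0[OF assms]])

theorem H1_poincare_equality:
  fixes u :: "real \<Rightarrow> 'a::euclidean_space"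
  assumes u: "u \<in> H1_2pi" "integral\<^sup>L circ u = 0"
    and eq: "(\<integral>t. (norm (weak_deriv u t))\<^sup>2 \<partial>circ) \<le> (\<integral>t. (norm (u t))\<^sup>2 \<partial>circ)"
  shows "\<exists>A B. \<forall>t. u t = cos t *\<^sub>R A + sin t *\<^sub>R B"
proof -
  let ?U = "\<lambda>b. \<integral>t. (u t \<bullet> b)\<^sup>2 \<partial>circ" and ?V = "\<lambda>b. \<integral>t. (weak_deriv u t \<bullet> b)\<^sup>2 \<partial>circ"
  have le: "?U b \<le> ?V b" for b
    by (rule poincare[OF H1_2pi_inner[OF u(1)] H1_2pi_coef_0[OF u]])
  have "sum ?V Basis \<le> sum ?U Basis"
    using eq unfolding L2_2pi_norm_integral[OF H1_2piD(3)[OF u(1)]]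
      L2_2pi_norm_integral[OF H1_2piD(4)[OF u(1)]] .
  moreover have "sum ?U Basis \<le> sum ?V Basis" by (intro sum_mono le)
  ultimately have "sum ?U Basis = sum ?V Basis" by linarith
  then have "?U b = ?V b" if "b \<in> Basis" for b
    by (rule sum_mono_inv[OF _ le that finite_Basis])
  then have "\<exists>a c. \<forall>t. u t \<bullet> b = a * cos t + c * sin t" if "b \<in> Basis" for b
    using poincare_equality[OF H1_2pi_inner[OF u(1), where b = b] H1_2pi_coef_0[OF u, of b]] that by simp
  then have "\<forall>b. \<exists>a c. b \<in> Basis \<longrightarrow> (\<forall>t. u t \<bullet> b = a * cos t + c * sin t)"
    by blast
  then obtain a c where "\<forall>b. b \<in> Basis \<longrightarrow> (\<forall>t. u t \<bullet> b = a b * cos t + c b * sin t)"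
    unfolding choice_iff by blast
  then have ac: "u t \<bullet> b = a b * cos t + c b * sin t" if "b \<in> Basis" for b t
    using that by simp
  have "u t = cos t *\<^sub>R (\<Sum>b\<in>Basis. a b *\<^sub>R b) + sin t *\<^sub>R (\<Sum>b\<in>Basis. c b *\<^sub>R b)" for t
  proof (rule euclidean_eqI)
    fix b :: 'a assume b: "b \<in> Basis"
    show "u t \<bullet> b = (cos t *\<^sub>R (\<Sum>b\<in>Basis. a b *\<^sub>R b) + sin t *\<^sub>R (\<Sum>b\<in>Basis. c b *\<^sub>R b)) \<bullet> b"
      unfolding ac[OF b] inner_add_left inner_scaleR_left inner_sum_left_Basis[OF b]
      by (simp only: mult.commute)
  qed
  then show ?thesis by (intro exI allI)
qed

theorem H1_shift_difference_bound:
  fixes u :: "real \<Rightarrow> 'a::euclidean_space"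
  assumes "u \<in> H1_2pi"
  shows "(\<integral>t. (norm (u (t + h) - u t))\<^sup>2 \<partial>circ)
    \<le> 4 * (sin (h / 2))\<^sup>2 * (\<integral>t. (norm (weak_deriv u t))\<^sup>2 \<partial>circ)"
proof -
  have contS: "continuous_on {0..2*pi} (\<lambda>t. u (t + h))"
    by (rule continuous_on_compose2[OF H1_2piD(1)[OF assms]]) (auto intro!: continuous_intros)
  have contU: "continuous_on {0..2*pi} u"
    using H1_2piD(1)[OF assms] by (rule continuous_on_subset) simp
  have "(\<integral>t. (norm (u (t + h) - u t))\<^sup>2 \<partial>circ) = (\<Sum>b\<in>Basis. \<integral>t. (u (t + h) \<bullet> b - u t \<bullet> b)\<^sup>2 \<partial>circ)"
    unfolding norm_square_eq_sum_Basis inner_diff_left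
    by (intro Bochner_Integration.integral_sum integrable_circ_continuous continuous_intros contS contU)
  also have "\<dots> \<le> (\<Sum>b\<in>Basis. 4 * (sin (h / 2))\<^sup>2 * (\<integral>t. (weak_deriv u t \<bullet> b)\<^sup>2 \<partial>circ))"
    by (rule sum_mono) (rule shift_difference_bound[OF H1_2pi_inner[OF assms]])
  finally show ?thesis
    unfolding L2_2pi_norm_integral[OF H1_2piD(4)[OF assms]] by (simp add: sum_distrib_left)
qed

section \<open>Classical derivatives as weak derivatives\<close>

lemma periodic_2pi_continuous_L2:
  fixes f :: "real \<Rightarrow> 'a::euclidean_space"
  assumes "continuous_on UNIV f" "periodic_2pi f"
  shows "L2_2pi f"
  unfolding L2_2pi_def
proof (intro conjI)
  show "f \<in> borel_measurable lborel"
    using borel_measurable_continuous_onI[OF assms(1)] by simp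
  have "continuous_on {0..2*pi} f" using assms(1) by (rule continuous_on_subset) simp
  then show "set_integrable lborel {0..2*pi} (\<lambda>t. (norm (f t))\<^sup>2)"
    unfolding integrable_circ_iff_set[symmetric]
    by (intro integrable_circ_continuous continuous_on_power continuous_on_norm)
qed (fact assms(2))

context
  fixes u u' :: "real \<Rightarrow> 'a::euclidean_space"
  assumes deriv: "\<And>t. (u has_vector_derivative u' t) (at t)"
    and cont': "continuous_on UNIV u'" and per: "periodic_2pi u" and per': "periodic_2pi u'"
begin

lemma differentiable_continuous: "continuous_on S u"
  using has_vector_derivative_continuous[OF deriv] by (simp add: continuous_at_imp_continuous_on)

text \<open>Integration by parts over a period; the boundary terms cancel because both factors are
  periodic.\<close>

lemma differentiable_is_weak_deriv: "is_weak_deriv u u'"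
  unfolding is_weak_deriv_def
proof (intro allI impI)
  fix \<phi> assume \<phi>: "smooth_real \<phi> \<and> periodic_2pi \<phi>"
  then have smooth: "(deriv ^^ k) \<phi> differentiable (at t)" for k t
    unfolding smooth_real_def by blast
  have d\<phi>: "(\<phi> has_field_derivative deriv \<phi> t) (at t)" for t
    using smooth[of 0 t] by (simp add: DERIV_deriv_iff_real_differentiable)
  have "isCont (deriv \<phi>) t" for t
    using smooth[of 1 t] by (simp add: differentiable_imp_continuous_within)
  then have cont_d\<phi>: "continuous_on S (deriv \<phi>)" for S
    by (simp add: continuous_at_imp_continuous_on)
  have cont_\<phi>: "continuous_on S \<phi>" for S
    using DERIV_isCont[OF d\<phi>] by (simp add: continuous_at_imp_continuous_on)
  have cont_u': "continuous_on S u'" for S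
    using cont' by (rule continuous_on_subset) simp
  have cont1: "continuous_on {0..2*pi} (\<lambda>t. \<phi> t *\<^sub>R u' t)"
    by (rule continuous_on_scaleR[OF cont_\<phi> cont_u'])
  have cont2: "continuous_on {0..2*pi} (\<lambda>t. deriv \<phi> t *\<^sub>R u t)"
    by (rule continuous_on_scaleR[OF cont_d\<phi> differentiable_continuous])
  have parts: "(\<integral>t. \<phi> t *\<^sub>R u' t + deriv \<phi> t *\<^sub>R u t \<partial>circ) = \<phi> (2*pi) *\<^sub>R u (2*pi) - \<phi> 0 *\<^sub>R u 0"
  proof (rule integral_circ_FTC[where F = "\<lambda>t. \<phi> t *\<^sub>R u t"])
    show "((\<lambda>t. \<phi> t *\<^sub>R u t) has_vector_derivative \<phi> t *\<^sub>R u' t + deriv \<phi> t *\<^sub>R u t) (at t within {0..2*pi})" for t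
      by (rule has_vector_derivative_scaleR[OF has_field_derivative_at_within[OF d\<phi>]
            has_vector_derivative_at_within[OF deriv]])
  qed (rule continuous_on_add[OF cont1 cont2])
  have ends: "\<phi> (2*pi) *\<^sub>R u (2*pi) = \<phi> 0 *\<^sub>R u 0"
    unfolding periodic_2pi_endpoints[OF per] periodic_2pi_endpoints[OF conjunct2[OF \<phi>]] by (rule refl)
  have split: "(\<integral>t. \<phi> t *\<^sub>R u' t + deriv \<phi> t *\<^sub>R u t \<partial>circ) =
      (\<integral>t. \<phi> t *\<^sub>R u' t \<partial>circ) + (\<integral>t. deriv \<phi> t *\<^sub>R u t \<partial>circ)"
    by (rule Bochner_Integration.integral_add[OF integrable_circ_continuous integrable_circ_continuous, OF cont1 cont2])
  have "(\<integral>t. \<phi> t *\<^sub>R u' t \<partial>circ) + (\<integral>t. deriv \<phi> t *\<^sub>R u t \<partial>circ) = 0"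
    using split parts unfolding ends diff_self by (rule trans[OF sym])
  then have "(\<integral>t. deriv \<phi> t *\<^sub>R u t \<partial>circ) = - (\<integral>t. \<phi> t *\<^sub>R u' t \<partial>circ)"
    by (rule minus_unique[symmetric])
  then show "(LINT t:{0..2 * pi}|lborel. deriv \<phi> t *\<^sub>R u t) = - (LINT t:{0..2 * pi}|lborel. \<phi> t *\<^sub>R u' t)"
    by (simp only: integral_circ_eq_set)
qed

lemma differentiable_in_H1: "u \<in> H1_2pi"
proof -
  have cont: "continuous_on UNIV u" by (rule differentiable_continuous)
  have "L2_2pi u" using cont per by (rule periodic_2pi_continuous_L2)
  moreover have "L2_2pi u'" using cont' per' by (rule periodic_2pi_continuous_L2)
  ultimately show ?thesis
    using cont differentiable_is_weak_deriv unfolding H1_2pi_def by blast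
qed

text \<open>The coefficients of any weak derivative are determined by \<open>u\<close>, so each
  coordinate of the difference has vanishing Fourier coefficients. This is what makes the kinetic
  energy of a smooth motion computable in spite of the choice in \<open>weak_deriv\<close>.\<close>

lemma weak_deriv_differentiable: "AE t in circ. weak_deriv u t = u' t"
proof -
  note u = differentiable_in_H1
  have L2: "L2_2pi u'" using cont' per' by (rule periodic_2pi_continuous_L2)
  have ae: "AE t in circ. weak_deriv u t \<bullet> b - u' t \<bullet> b = 0" for b
  proof (rule coef_zero_imp_AE_zero)
    note sq = L2_2pi_inner[OF H1_2piD(4)[OF u], of b] L2_2pi_inner[OF L2, of b]
    show "sq_int (\<lambda>t. weak_deriv u t \<bullet> b - u' t \<bullet> b)"
      by (rule sq_int_diff[OF sq])
    show "coef k (\<lambda>t. weak_deriv u t \<bullet> b - u' t \<bullet> b) = 0" for k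
    proof -
      have "coef k (\<lambda>t. weak_deriv u t \<bullet> b) = - of_int k * coef (- k) (\<lambda>t. u t \<bullet> b)"
        by (rule H1_2pi_inner(4)[OF u])
      moreover have "coef k (\<lambda>t. u' t \<bullet> b) = - of_int k * coef (- k) (\<lambda>t. u t \<bullet> b)"
        by (rule weak_deriv_coef[OF H1_2piD(3)[OF u] L2 differentiable_is_weak_deriv])
      ultimately show ?thesis unfolding coef_diff[OF sq] by (simp only: diff_self)
    qed
  qed
  have ae_all: "AE t in circ. \<forall>b\<in>Basis. weak_deriv u t \<bullet> b - u' t \<bullet> b = 0"
  proof (rule AE_finite_allI)
    show "AE t in circ. weak_deriv u t \<bullet> b - u' t \<bullet> b = 0" for b by (rule ae)
  qed simp
  have eq: "weak_deriv u t = u' t" if zero: "\<forall>b\<in>Basis. weak_deriv u t \<bullet> b - u' t \<bullet> b = 0" for t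
  proof (rule euclidean_eqI)
    show "weak_deriv u t \<bullet> b = u' t \<bullet> b" if "b \<in> Basis" for b
      using bspec[OF zero that] by (rule eq_iff_diff_eq_0[THEN iffD2])
  qed
  show ?thesis using ae_all by (rule eventually_mono) (rule eq)
qed

end

section \<open>Invariant motions\<close>

text \<open>Frees all statements about \<open>time_act\<close> from the representative modulo
  \<open>2 * pi\<close> that it happens to pick.\<close>

lemma circle_point_eqD:
  assumes "circle_point s = circle_point t" "periodic_2pi f" shows "f s = f t"
proof -
  have "cos s = cos t \<and> sin s = sin t"
    using assms(1) by (simp add: circle_point_def vec_eq_iff forall_2)
  then obtain k :: int where "s = t + 2 * pi * k"
    using sin_cos_eq_iff[of s t] by auto
  then show ?thesis using periodic_2pi_int[OF assms(2)] by simp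
qed

text \<open>Orthogonal matrices preserve the unit circle, so the choice in \<open>time_act\<close>
  has a witness.\<close>

lemma circle_point_time_act:
  assumes "orthogonal_matrix A"
  shows "circle_point (time_act A t) = A *v circle_point t"
proof -
  let ?x = "A *v circle_point t"
  have "?x \<bullet> ?x = (transpose A *v ?x) \<bullet> circle_point t"
    unfolding transpose_matrix_vector dot_lmul_matrix ..
  also have "transpose A *v ?x = circle_point t"
    using assms unfolding orthogonal_matrix matrix_vector_mul_assoc by (simp only: matrix_vector_mul_lid)
  finally have "?x \<bullet> ?x = circle_point t \<bullet> circle_point t" .
  then have "(?x $ 1)\<^sup>2 + (?x $ 2)\<^sup>2 = 1"
    by (simp add: inner_vec_def sum_2 power2_eq_square circle_point_def sin_cos_squared_add3)
  then obtain s where "?x $ 1 = cos s" "?x $ 2 = sin s"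
    by (rule sincos_total_2pi)
  then have "\<exists>s. circle_point s = ?x"
    by (intro exI[of _ s]) (simp add: circle_point_def vec_eq_iff forall_2)
  then show ?thesis unfolding time_act_def by (rule someI_ex)
qed

lemma group_orthogonal_group: "group (orthogonal_group :: (real^'d^'d) monoid)"
proof (rule groupI)
  fix A :: "real^'d^'d" assume "A \<in> carrier orthogonal_group"
  then show "\<exists>B\<in>carrier orthogonal_group. B \<otimes>\<^bsub>orthogonal_group\<^esub> A = \<one>\<^bsub>orthogonal_group\<^esub>"
    by (intro bexI[of _ "transpose A"]) (auto simp: orthogonal_group_def orthogonal_matrix_def)
qed (auto simp: orthogonal_group_def orthogonal_matrix_mul orthogonal_matrix_id matrix_mul_assoc)

section \<open>Invariance under the two generators\<close>

definition choreography :: "nat \<Rightarrow> (nat \<Rightarrow> real \<Rightarrow> real^3) \<Rightarrow> bool" where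
  "choreography n q \<longleftrightarrow> (\<forall>i\<in>{1..n}. \<forall>t. q i t = q 1 (t + (real i - 1) * (2 * pi / real n)))"

text \<open>The form that invariance under \<open>g2\<close> takes; \<open>choreography\<close>
  comes likewise from \<open>g1\<close>.\<close>

definition antiperiodic :: "nat \<Rightarrow> (nat \<Rightarrow> real \<Rightarrow> real^3) \<Rightarrow> bool" where
  "antiperiodic n q \<longleftrightarrow> (\<forall>i\<in>{1..n}. \<forall>t. q i t = - q i (t + pi))"

lemma H_spaceD:
  assumes "q \<in> H_space n" "i \<in> {1..n}"
  shows "q i \<in> H1_2pi" "periodic_2pi (q i)"
proof -
  show "q i \<in> H1_2pi" using assms by (simp add: H_space_def)
  then show "periodic_2pi (q i)" by (rule H1_2piD(2))
qed

context
  fixes n :: nat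
    and G :: "('g, 'b) monoid_scheme" and g1 g2 :: 'g
    and \<rho> :: "'g \<Rightarrow> real^3^3" and \<tau> :: "'g \<Rightarrow> real^2^2" and \<sigma> :: "'g \<Rightarrow> nat \<Rightarrow> nat"
  assumes n: "n \<ge> 2"
    and G: "group G"
    and g1: "g1 \<in> carrier G" and g2: "g2 \<in> carrier G" and gen: "carrier G = generate G {g1, g2}"
    and \<rho>: "\<rho> \<in> hom G orthogonal_group"
    and \<tau>: "\<tau> \<in> hom G orthogonal_group"
    and \<sigma>: "\<sigma> \<in> hom G (sym_group n)"
    and \<rho>1: "\<rho> g1 = mat 1"
    and \<sigma>1: "\<forall>i\<in>{1..n}. [int (\<sigma> (inv\<^bsub>G\<^esub> g1) i) = int i - 1] (mod int n)"
    and \<tau>1: "\<forall>t. \<tau> (inv\<^bsub>G\<^esub> g1) *v circle_point t = circle_point (t + 2 * pi / real n)"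
    and \<rho>2: "\<rho> g2 = - mat 1"
    and \<sigma>2: "\<forall>i\<in>{1..n}. \<sigma> (inv\<^bsub>G\<^esub> g2) i = i"
    and \<tau>2: "\<forall>t. \<tau> (inv\<^bsub>G\<^esub> g2) *v circle_point t = circle_point (t + pi)"
begin

interpretation G: group G by (rule G)

lemma sigma_permutes: "g \<in> carrier G \<Longrightarrow> \<sigma> g permutes {1..n}"
  using \<sigma> by (auto simp: hom_def sym_group_def)

lemma sigma_in: "g \<in> carrier G \<Longrightarrow> i \<in> {1..n} \<Longrightarrow> \<sigma> g i \<in> {1..n}"
  using permutes_in_image[OF sigma_permutes] by blast

lemma tau_time_act:
  "g \<in> carrier G \<Longrightarrow> circle_point (time_act (\<tau> g) t) = \<tau> g *v circle_point t"
  using \<tau> by (intro circle_point_time_act) (auto simp: hom_def orthogonal_group_def)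

text \<open>The identity matrix moves \<open>t\<close> by an unknown multiple of
  \<open>2 * pi\<close>, because of the choice in \<open>time_act\<close>; the periodicity of the
  motions in \<open>H_space\<close> absorbs it.\<close>

lemma motion_act_one:
  assumes q: "q \<in> H_space n" and i: "i \<in> {1..n}"
  shows "motion_act G \<rho> \<tau> \<sigma> \<one>\<^bsub>G\<^esub> q i t = q i t"
proof -
  have "\<rho> \<one>\<^bsub>G\<^esub> = mat 1" "\<tau> \<one>\<^bsub>G\<^esub> = mat 1" "\<sigma> \<one>\<^bsub>G\<^esub> = id"
    using hom_one[OF \<rho> G group_orthogonal_group] hom_one[OF \<tau> G group_orthogonal_group]
      hom_one[OF \<sigma> G sym_group_is_group]
    by (simp_all add: orthogonal_group_def sym_group_def)
  moreover have "q i (time_act (\<tau> \<one>\<^bsub>G\<^esub>) t) = q i t"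
    by (rule circle_point_eqD[OF _ H_spaceD(2)[OF q i]])
       (simp add: calculation circle_point_time_act orthogonal_matrix_id)
  ultimately show ?thesis by (simp add: motion_act_def)
qed

text \<open>The inverses in the definition of the action reverse products in \<open>\<sigma>\<close>
  and \<open>\<tau>\<close>, which makes it a left action. The action of \<open>h\<close> is kept as
  a subterm so that invariance under \<open>h\<close> can be substituted.\<close>

lemma motion_act_mult:
  assumes q: "q \<in> H_space n" and i: "i \<in> {1..n}" and g: "g \<in> carrier G" "h \<in> carrier G"
  shows "motion_act G \<rho> \<tau> \<sigma> (g \<otimes>\<^bsub>G\<^esub> h) q i t =
    \<rho> g *v motion_act G \<rho> \<tau> \<sigma> h q (\<sigma> (inv\<^bsub>G\<^esub> g) i) (time_act (\<tau> (inv\<^bsub>G\<^esub> g)) t)"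
proof -
  have inv: "inv\<^bsub>G\<^esub> (g \<otimes>\<^bsub>G\<^esub> h) = inv\<^bsub>G\<^esub> h \<otimes>\<^bsub>G\<^esub> inv\<^bsub>G\<^esub> g" "inv\<^bsub>G\<^esub> g \<in> carrier G" "inv\<^bsub>G\<^esub> h \<in> carrier G"
    using g by (simp_all add: G.inv_mult_group)
  have \<rho>gh: "\<rho> (g \<otimes>\<^bsub>G\<^esub> h) = \<rho> g ** \<rho> h"
    using hom_mult[OF \<rho> g] by (simp add: orthogonal_group_def)
  have \<tau>gh: "\<tau> (inv\<^bsub>G\<^esub> h \<otimes>\<^bsub>G\<^esub> inv\<^bsub>G\<^esub> g) = \<tau> (inv\<^bsub>G\<^esub> h) ** \<tau> (inv\<^bsub>G\<^esub> g)"
    using hom_mult[OF \<tau> inv(3,2)] by (simp add: orthogonal_group_def)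
  have \<sigma>gh: "\<sigma> (inv\<^bsub>G\<^esub> h \<otimes>\<^bsub>G\<^esub> inv\<^bsub>G\<^esub> g) i = \<sigma> (inv\<^bsub>G\<^esub> h) (\<sigma> (inv\<^bsub>G\<^esub> g) i)"
    using hom_mult[OF \<sigma> inv(3,2)] by (simp add: sym_group_def)
  let ?j = "\<sigma> (inv\<^bsub>G\<^esub> h) (\<sigma> (inv\<^bsub>G\<^esub> g) i)"
  have j: "?j \<in> {1..n}" using inv i by (intro sigma_in) auto
  have "circle_point (time_act (\<tau> (inv\<^bsub>G\<^esub> h \<otimes>\<^bsub>G\<^esub> inv\<^bsub>G\<^esub> g)) t) =
      circle_point (time_act (\<tau> (inv\<^bsub>G\<^esub> h)) (time_act (\<tau> (inv\<^bsub>G\<^esub> g)) t))"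
    using inv by (subst tau_time_act) (simp_all add: tau_time_act \<tau>gh[symmetric] matrix_vector_mul_assoc)
  from circle_point_eqD[OF this H_spaceD(2)[OF q j]] show ?thesis
    by (simp add: motion_act_def inv(1) \<rho>gh \<sigma>gh matrix_vector_mul_assoc)
qed

lemma motion_act_g1:
  assumes q: "q \<in> H_space n" and i: "i \<in> {1..n}"
  shows "motion_act G \<rho> \<tau> \<sigma> g1 q i t = q (\<sigma> (inv\<^bsub>G\<^esub> g1) i) (t + 2 * pi / real n)"
proof -
  have j: "\<sigma> (inv\<^bsub>G\<^esub> g1) i \<in> {1..n}" using g1 i by (intro sigma_in) auto
  have "circle_point (time_act (\<tau> (inv\<^bsub>G\<^esub> g1)) t) = circle_point (t + 2 * pi / real n)"
    using \<tau>1 g1 by (simp add: tau_time_act)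
  from circle_point_eqD[OF this H_spaceD(2)[OF q j]] show ?thesis
    by (simp add: motion_act_def \<rho>1)
qed

lemma motion_act_g2:
  assumes q: "q \<in> H_space n" and i: "i \<in> {1..n}"
  shows "motion_act G \<rho> \<tau> \<sigma> g2 q i t = - q i (t + pi)"
proof -
  have "circle_point (time_act (\<tau> (inv\<^bsub>G\<^esub> g2)) t) = circle_point (t + pi)"
    using \<tau>2 g2 by (simp add: tau_time_act)
  from circle_point_eqD[OF this H_spaceD(2)[OF q i]] show ?thesis
    using \<sigma>2 i matrix_vector_mult_diff_rdistrib[of 0 "mat 1" "q i (t + pi)"] by (simp add: motion_act_def \<rho>2)
qed

text \<open>The congruence leaves a multiple of \<open>n\<close> open. Since \<open>\<sigma>\<close>
  takes values in the permutations of \<open>{1..n}\<close>, only \<open>0\<close> and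
  \<open>n\<close> are possible, the latter for \<open>i = 1\<close>.\<close>

lemma sigma_g1:
  assumes i: "i \<in> {1..n}"
  shows "\<sigma> (inv\<^bsub>G\<^esub> g1) i = (if i = 1 then n else i - 1)"
proof -
  let ?j = "\<sigma> (inv\<^bsub>G\<^esub> g1) i"
  have j: "?j \<in> {1..n}" using g1 i by (intro sigma_in) auto
  have "[int ?j = int i - 1] (mod int n)" using \<sigma>1 i by (rule bspec)
  then have "int n dvd int ?j - (int i - 1)" by (simp only: cong_iff_dvd_diff)
  then obtain k where k: "int ?j - (int i - 1) = int n * k" by (elim dvdE)
  have bounds: "1 \<le> int ?j" "int ?j \<le> int n" "1 \<le> int i" "int i \<le> int n" "2 \<le> int n"
    using j i n unfolding atLeastAtMost_iff by linarith+
  have "k \<ge> 0"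
  proof (rule ccontr)
    assume "\<not> k \<ge> 0"
    then have "int n * k \<le> int n * (-1)" by (intro mult_left_mono) linarith+
    with k bounds show False by linarith
  qed
  moreover have "k \<le> 1"
  proof (rule ccontr)
    assume "\<not> k \<le> 1"
    then have "int n * 2 \<le> int n * k" by (intro mult_left_mono) linarith+
    with k bounds show False by linarith
  qed
  ultimately consider "k = 0" | "k = 1" by linarith
  then show ?thesis
  proof cases
    case 1
    with k have "int ?j = int i - 1" by (simp only: mult_zero_right)
    with bounds have "i \<noteq> 1" "?j = i - 1" by linarith+
    then show ?thesis by (simp only: if_False)
  next
    case 2
    with k have "int ?j = int i - 1 + int n" by (simp only: mult_1_right)
    with bounds have "i = 1" "?j = n" by linarith+
    then show ?thesis by (simp only: if_True refl)
  qed
qed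

text \<open>Iterated invariance under \<open>g1\<close> expresses every particle by the first one.
  Conversely, the two conditions give invariance under the generators, which passes to products and
  inverses and so, by induction over \<open>generate\<close>, to the whole group.\<close>

lemma HG_space_eq:
  "HG_space G \<rho> \<tau> \<sigma> n = {q \<in> H_space n. choreography n q \<and> antiperiodic n q}"
proof (intro Set.set_eqI iffI)
  fix q assume "q \<in> HG_space G \<rho> \<tau> \<sigma> n"
  then have q: "q \<in> H_space n"
    and inv: "\<And>g i t. g \<in> carrier G \<Longrightarrow> i \<in> {1..n} \<Longrightarrow> motion_act G \<rho> \<tau> \<sigma> g q i t = q i t"
    by (auto simp: HG_space_def)
  have shift: "q (Suc i) t = q 1 (t + real i * (2 * pi / real n))" if "Suc i \<in> {1..n}" for i t
    using that
  proof (induction i arbitrary: t)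
    case (Suc i)
    have "q (Suc (Suc i)) t = q (\<sigma> (inv\<^bsub>G\<^esub> g1) (Suc (Suc i))) (t + 2 * pi / real n)"
      using inv[OF g1 Suc.prems] motion_act_g1[OF q Suc.prems] by simp
    also have "\<dots> = q (Suc i) (t + 2 * pi / real n)" using sigma_g1[OF Suc.prems] by simp
    also have "\<dots> = q 1 (t + 2 * pi / real n + real i * (2 * pi / real n))"
      using Suc.prems by (intro Suc.IH) auto
    also have "t + 2 * pi / real n + real i * (2 * pi / real n) = t + real (Suc i) * (2 * pi / real n)"
      by (simp add: distrib_right add_divide_distrib)
    finally show ?case .
  next
    case 0
    show ?case by simp
  qed
  have "q i t = q 1 (t + (real i - 1) * (2 * pi / real n))" if "i \<in> {1..n}" for i t
  proof -
    obtain j where "i = Suc j" using \<open>i \<in> {1..n}\<close> by (cases i) auto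
    then show ?thesis using shift[of j t] that by (simp only: of_nat_Suc add_diff_cancel_left')
  qed
  moreover have "q i t = - q i (t + pi)" if "i \<in> {1..n}" for i t
    using inv[OF g2 that, of t] unfolding motion_act_g2[OF q that] by (rule sym)
  ultimately show "q \<in> {q \<in> H_space n. choreography n q \<and> antiperiodic n q}"
    using q unfolding choreography_def antiperiodic_def by blast
next
  fix q assume "q \<in> {q \<in> H_space n. choreography n q \<and> antiperiodic n q}"
  then have q: "q \<in> H_space n" and chor: "\<And>i t. i \<in> {1..n} \<Longrightarrow> q i t = q 1 (t + (real i - 1) * (2 * pi / real n))"
    and anti: "\<And>i t. i \<in> {1..n} \<Longrightarrow> q i t = - q i (t + pi)"
    unfolding choreography_def antiperiodic_def by blast+
  have per: "q 1 (t + 2 * pi) = q 1 t" for t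
    using H_spaceD(2)[OF q, of 1] n by (simp add: periodic_2pi_def)
  define Inv where "Inv g \<longleftrightarrow> (\<forall>i\<in>{1..n}. \<forall>t. motion_act G \<rho> \<tau> \<sigma> g q i t = q i t)" for g
  have Inv1: "Inv g1"
    unfolding Inv_def
  proof (intro ballI allI)
    fix i t assume i: "i \<in> {1..n}"
    show "motion_act G \<rho> \<tau> \<sigma> g1 q i t = q i t"
    proof (cases "i = 1")
      case True
      \<comment> \<open>Cyclically, particle 1 is preceded by particle \<open>n\<close>; the time
        shifts add up to a full period.\<close>
      have "q n (t + 2 * pi / real n) = q 1 (t + 2 * pi / real n + (real n - 1) * (2 * pi / real n))"
        using n by (intro chor) auto
      also have "t + 2 * pi / real n + (real n - 1) * (2 * pi / real n) = t + 2 * pi"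
        using n by (simp add: field_simps)
      finally have "q n (t + 2 * pi / real n) = q 1 t" unfolding per .
      then show ?thesis
        unfolding motion_act_g1[OF q i] sigma_g1[OF i] using True by simp
    next
      case False
      with i have i': "i - 1 \<in> {1..n}" "real (i - 1) = real i - 1" by auto
      have "q (i - 1) (t + 2 * pi / real n) = q 1 (t + 2 * pi / real n + (real (i - 1) - 1) * (2 * pi / real n))"
        by (rule chor[OF i'(1)])
      also have "t + 2 * pi / real n + (real (i - 1) - 1) * (2 * pi / real n) = t + (real i - 1) * (2 * pi / real n)"
        unfolding i'(2) using n by (simp add: field_simps)
      also have "q 1 (t + (real i - 1) * (2 * pi / real n)) = q i t" by (rule chor[OF i, symmetric])
      finally show ?thesis
        unfolding motion_act_g1[OF q i] sigma_g1[OF i] using False by (simp only: if_False)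
    qed
  qed
  have Inv2: "Inv g2"
    unfolding Inv_def
  proof (intro ballI allI)
    fix i t assume i: "i \<in> {1..n}"
    show "motion_act G \<rho> \<tau> \<sigma> g2 q i t = q i t"
      unfolding motion_act_g2[OF q i] by (rule anti[OF i, symmetric])
  qed
  have Inv_mult: "Inv (g \<otimes>\<^bsub>G\<^esub> h)" if "Inv g" "Inv h" "g \<in> carrier G" "h \<in> carrier G" for g h
    unfolding Inv_def
  proof (intro ballI allI)
    fix i t assume i: "i \<in> {1..n}"
    have "\<sigma> (inv\<^bsub>G\<^esub> g) i \<in> {1..n}" using that i by (intro sigma_in) auto
    then have "motion_act G \<rho> \<tau> \<sigma> (g \<otimes>\<^bsub>G\<^esub> h) q i t = motion_act G \<rho> \<tau> \<sigma> g q i t"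
      using that(2) unfolding motion_act_mult[OF q i that(3,4)] by (simp add: Inv_def motion_act_def)
    then show "motion_act G \<rho> \<tau> \<sigma> (g \<otimes>\<^bsub>G\<^esub> h) q i t = q i t"
      using that(1) i by (simp add: Inv_def)
  qed
  have Inv_inv: "Inv (inv\<^bsub>G\<^esub> g)" if "Inv g" "g \<in> carrier G" for g
    unfolding Inv_def
  proof (intro ballI allI)
    fix i t assume i: "i \<in> {1..n}"
    have g': "inv\<^bsub>G\<^esub> g \<in> carrier G" using that by simp
    have "\<sigma> (inv\<^bsub>G\<^esub> (inv\<^bsub>G\<^esub> g)) i \<in> {1..n}" using that i by (intro sigma_in) auto
    then have "motion_act G \<rho> \<tau> \<sigma> (inv\<^bsub>G\<^esub> g \<otimes>\<^bsub>G\<^esub> g) q i t = motion_act G \<rho> \<tau> \<sigma> (inv\<^bsub>G\<^esub> g) q i t"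
      using that(1) unfolding motion_act_mult[OF q i g' that(2)] by (simp add: Inv_def motion_act_def)
    then show "motion_act G \<rho> \<tau> \<sigma> (inv\<^bsub>G\<^esub> g) q i t = q i t"
      using that(2) motion_act_one[OF q i] by simp
  qed
  have "g \<in> carrier G \<and> Inv g" if "g \<in> generate G {g1, g2}" for g
    using that
  proof (induction rule: generate.induct)
    case one
    then show ?case using motion_act_one[OF q] by (simp add: Inv_def)
  next
    case (incl h)
    then show ?case using Inv1 Inv2 g1 g2 by auto
  next
    case (inv h)
    then show ?case using Inv1 Inv2 g1 g2 Inv_inv by auto
  next
    case (eng h1 h2)
    then show ?case using Inv_mult by simp
  qed
  then show "q \<in> HG_space G \<rho> \<tau> \<sigma> n"
    using q gen by (auto simp: HG_space_def Inv_def)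
qed

end

lemma choreography_antiperiodic_Lambda:
  assumes "q \<in> H_space n" "choreography n q" "antiperiodic n q"
  shows "q \<in> Lambda_space n"
proof -
  have "integral\<^sup>L circ (q i) = 0" if i: "i \<in> {1..n}" for i
  proof -
    note qi = H_spaceD[OF assms(1) i]
    have "integral\<^sup>L circ (q i) = (\<integral>t. - q i (t + pi) \<partial>circ)"
      using assms(3) i unfolding antiperiodic_def
      by (intro Bochner_Integration.integral_cong) blast+
    also have "\<dots> = - integral\<^sup>L circ (q i)"
      using integral_circ_shift[OF H1_2piD(1)[OF qi(1)] qi(2), of pi] by simp
    finally have "integral\<^sup>L circ (q i) + integral\<^sup>L circ (q i) = 0"
      by (simp only: eq_neg_iff_add_eq_0)
    then have "2 *\<^sub>R integral\<^sup>L circ (q i) = 0" by (simp only: scaleR_2)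
    then show ?thesis by simp
  qed
  then show ?thesis
    using assms unfolding Lambda_space_def choreography_def integral_circ_eq_set by blast
qed

lemma Lambda_spaceD:
  assumes "q \<in> Lambda_space n"
  shows "q \<in> H_space n" "choreography n q" "i \<in> {1..n} \<Longrightarrow> integral\<^sup>L circ (q i) = 0"
  using assms unfolding Lambda_space_def choreography_def integral_circ_eq_set by blast+

section \<open>Lower bound for the action\<close>

text \<open>The distance at \<open>x\<close> between the graph of \<open>x powr (- a)\<close> and its tangent at \<open>c\<close>.\<close>

definition tangent_gap :: "real \<Rightarrow> real \<Rightarrow> real \<Rightarrow> real" where
  "tangent_gap a c x = x powr (- a) - (c powr (- a) - a * c powr (- a - 1) * (x - c))"

text \<open>Up to scaling the gap depends on \<open>y = x / c\<close> only. In this form it is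
  nonnegative by the two inequalities \<open>exp z \<ge> 1 + z\<close>, at
  \<open>z = - a * ln y\<close>, and \<open>ln y \<le> y - 1\<close>.\<close>

lemma tangent_gap_eq:
  assumes "x > 0" "c > 0"
  shows "tangent_gap a c x = c powr (- a) * (exp (- a * ln (x / c)) - 1 + a * (x / c - 1))"
proof -
  have power: "x powr (- a) = c powr (- a) * exp (- a * ln (x / c))"
    using assms by (simp add: powr_def ln_div algebra_simps flip: exp_add)
  have linear: "c powr (- a - 1) * (x - c) = c powr (- a) * (x / c - 1)"
    using assms by (simp add: powr_diff field_simps)
  show ?thesis unfolding tangent_gap_def power mult.assoc[of a] linear by (simp add: algebra_simps)
qed

lemma tangent_gap_nonneg:
  assumes "x > 0" "c > 0" "a > 0" shows "tangent_gap a c x \<ge> 0"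
proof -
  have "- a * ln (x / c) \<ge> - a * (x / c - 1)"
    using assms ln_le_minus_one[of "x / c"] by (intro mult_left_mono_neg) auto
  then have "exp (- a * ln (x / c)) - 1 + a * (x / c - 1) \<ge> 0"
    using exp_ge_add_one_self[of "- a * ln (x / c)"] by linarith
  then show ?thesis unfolding tangent_gap_eq[OF assms(1,2)] using assms by simp
qed

text \<open>Strict convexity: a vanishing gap forces equality in \<open>ln y \<le> y - 1\<close> for
  \<open>y = x / c\<close>, hence \<open>y = 1\<close>.\<close>

lemma tangent_gap_zero:
  assumes "x > 0" "c > 0" "a > 0" "tangent_gap a c x = 0" shows "x = c"
proof -
  have "exp (- a * ln (x / c)) - 1 + a * (x / c - 1) = 0"
    using assms unfolding tangent_gap_eq[OF assms(1,2)] by simp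
  then have "a * (x / c - 1) \<le> a * ln (x / c)"
    using exp_ge_add_one_self[of "- a * ln (x / c)"] by linarith
  then have "x / c - 1 \<le> ln (x / c)" using assms by simp
  then have "ln (x / c) = x / c - 1" using assms ln_le_minus_one[of "x / c"] by (intro antisym) auto
  then have "x / c = 1" using assms ln_eq_minus_one[of "x / c"] by simp
  then show ?thesis using assms by simp
qed

lemma sum_pairs:
  fixes F :: "nat \<Rightarrow> nat \<Rightarrow> real"
  assumes sym: "\<And>i j. F i j = F j i"
  shows "(\<Sum>i\<in>{1..n}. \<Sum>j\<in>{i<..n}. F i j) = (\<Sum>i\<in>{1..n}. 1/2 * (\<Sum>j\<in>{1..n}-{i}. F i j))"
proof -
  have "(\<Sum>i\<in>{1..n}. \<Sum>j\<in>{1..<i}. F i j) = (\<Sum>i\<in>{1..n}. \<Sum>j | j \<in> {1..n} \<and> j < i. F i j)"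
    by (intro sum.cong) auto
  also have "\<dots> = (\<Sum>j\<in>{1..n}. \<Sum>i | i \<in> {1..n} \<and> j < i. F i j)"
    by (intro sum.swap_restrict) auto
  also have "\<dots> = (\<Sum>j\<in>{1..n}. \<Sum>i\<in>{j<..n}. F j i)"
    by (intro sum.cong sym) auto
  finally have swap: "(\<Sum>i\<in>{1..n}. \<Sum>j\<in>{1..<i}. F i j) = (\<Sum>i\<in>{1..n}. \<Sum>j\<in>{i<..n}. F i j)" .
  have "(\<Sum>i\<in>{1..n}. \<Sum>j\<in>{1..n}-{i}. F i j) =
      (\<Sum>i\<in>{1..n}. (\<Sum>j\<in>{1..<i}. F i j) + (\<Sum>j\<in>{i<..n}. F i j))"
  proof (rule sum.cong)
    fix i assume "i \<in> {1..n}"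
    then have split: "{1..n} - {i} = {1..<i} \<union> {i<..n}" by auto
    show "(\<Sum>j\<in>{1..n}-{i}. F i j) = (\<Sum>j\<in>{1..<i}. F i j) + (\<Sum>j\<in>{i<..n}. F i j)"
      unfolding split by (rule sum.union_disjoint) auto
  qed simp
  also have "\<dots> = 2 * (\<Sum>i\<in>{1..n}. \<Sum>j\<in>{i<..n}. F i j)"
    by (simp only: sum.distrib swap)
  finally show ?thesis by (simp only: sum_distrib_left[symmetric])
qed

text \<open>For fixed \<open>i\<close> the differences \<open>j - i\<close> run once through the
  nonzero residues modulo \<open>n\<close>: every vertex of a regular polygon sees the same
  picture.\<close>

lemma sum_periodic_differences:
  fixes g :: "int \<Rightarrow> 'b::comm_monoid_add"
  assumes per: "\<And>k. g (k + int n) = g k" and i: "i \<in> {1..n}"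
  shows "(\<Sum>j\<in>{1..n}-{i}. g (int j - int i)) = (\<Sum>h\<in>{1..<n}. g (int h))"
proof (rule sum.reindex_bij_witness[where i = "\<lambda>h. if i + h \<le> n then i + h else i + h - n"
      and j = "\<lambda>j. if j > i then j - i else j + n - i"])
  fix j assume j: "j \<in> {1..n} - {i}"
  show "g (int (if j > i then j - i else j + n - i)) = g (int j - int i)"
  proof (cases "j > i")
    case False
    then have "int (j + n - i) = (int j - int i) + int n" using i j by auto
    then show ?thesis using False per by simp
  qed (simp add: of_nat_diff)
qed (use i in auto)

text \<open>The share of particle \<open>i\<close> in the potential: every pair is split evenly between its members.\<close>

definition vpart :: "nat \<Rightarrow> real \<Rightarrow> real \<Rightarrow> real \<Rightarrow> real \<Rightarrow> (nat \<Rightarrow> real^3) \<Rightarrow> nat \<Rightarrow> real" where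
  "vpart n \<alpha> \<beta> m M x i = 1/2 * (\<Sum>j\<in>{1..n}-{i}. m\<^sup>2 / norm (x i - x j) powr \<alpha>) +
     (m * M / norm (x i - C1) powr \<beta> + m * M / norm (x i - C2) powr \<beta>)"

lemma potential_eq_sum_vpart: "potential n \<alpha> \<beta> m M x = (\<Sum>i\<in>{1..n}. vpart n \<alpha> \<beta> m M x i)"
  unfolding potential_def vpart_def sum.distrib
  by (subst sum_pairs[where F = "\<lambda>i j. m\<^sup>2 / norm (x i - x j) powr \<alpha>"]) (simp_all add: norm_minus_commute)

lemma H_space_collisions:
  assumes "q \<in> H_space n" "i \<in> {1..n}"
  shows "j \<in> {1..n} - {i} \<Longrightarrow> q i t \<noteq> q j t" "q i t \<noteq> C1" "q i t \<noteq> C2"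
  using assms by (auto simp: H_space_def)

lemma continuous_H_space:
  assumes "q \<in> H_space n" "i \<in> {1..n}" shows "continuous_on S (q i)"
  using H1_2piD(1)[OF H_spaceD(1)[OF assms]] by (rule continuous_on_subset) simp

lemma continuous_vpart:
  assumes q: "q \<in> H_space n" and i: "i \<in> {1..n}"
  shows "continuous_on S (\<lambda>t. vpart n \<alpha> \<beta> m M (\<lambda>j. q j t) i)"
proof -
  have *: "continuous_on S (\<lambda>t. c / norm (f t) powr a)"
    if "continuous_on S f" "\<And>t. f t \<noteq> 0" for f :: "real \<Rightarrow> real^3" and a c
    using that by (intro continuous_on_divide continuous_on_const continuous_on_powr continuous_on_norm) auto
  show ?thesis
    unfolding vpart_def
  proof (intro continuous_on_add continuous_on_mult continuous_on_const continuous_on_sum *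
      continuous_on_diff continuous_H_space[OF q])
  qed (use H_space_collisions[OF q i] i in auto)
qed

text \<open>The share of particle \<open>i\<close> in the action. Once every share has the same
  lower bound, a minimal action makes each single share minimal.\<close>

definition paction :: "nat \<Rightarrow> real \<Rightarrow> real \<Rightarrow> real \<Rightarrow> real \<Rightarrow> (nat \<Rightarrow> real \<Rightarrow> real^3) \<Rightarrow> nat \<Rightarrow> real" where
  "paction n \<alpha> \<beta> m M q i = m / 2 * (\<integral>t. (norm (weak_deriv (q i) t))\<^sup>2 \<partial>circ) +
     (\<integral>t. vpart n \<alpha> \<beta> m M (\<lambda>j. q j t) i \<partial>circ)"

lemma vpart_nonneg: "m > 0 \<Longrightarrow> M > 0 \<Longrightarrow> vpart n \<alpha> \<beta> m M x i \<ge> 0"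
  unfolding vpart_def by (intro add_nonneg_nonneg mult_nonneg_nonneg sum_nonneg divide_nonneg_nonneg) auto

lemma action_eq_sum_paction:
  assumes q: "q \<in> H_space n" and pos: "m > 0" "M > 0"
  shows "action n \<alpha> \<beta> m M q = ennreal (\<Sum>i\<in>{1..n}. paction n \<alpha> \<beta> m M q i)"
proof -
  let ?k = "\<lambda>i t. m / 2 * (norm (weak_deriv (q i) t))\<^sup>2" and ?v = "\<lambda>i t. vpart n \<alpha> \<beta> m M (\<lambda>j. q j t) i"
  let ?F = "\<lambda>t. \<Sum>i\<in>{1..n}. ?k i t + ?v i t"
  have F: "m / 2 * (\<Sum>i\<in>{1..n}. (norm (weak_deriv (q i) t))\<^sup>2) + potential n \<alpha> \<beta> m M (\<lambda>i. q i t) = ?F t" for t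
    by (simp add: potential_eq_sum_vpart sum.distrib sum_distrib_left)
  have int: "integrable circ (?k i)" "integrable circ (?v i)" if "i \<in> {1..n}" for i
    using L2_2pi_circ(2)[OF H1_2piD(4)[OF H_spaceD(1)[OF q that]]]
      integrable_circ_continuous[OF continuous_vpart[OF q that]] by auto
  have "action n \<alpha> \<beta> m M q = (\<integral>\<^sup>+ t. ennreal (?F t) \<partial>circ)"
    unfolding action_def F circ_def by (subst nn_integral_restrict_space) auto
  also have "\<dots> = ennreal (\<integral>t. ?F t \<partial>circ)"
  proof (rule nn_integral_eq_integral)
    show "integrable circ ?F" by (intro Bochner_Integration.integrable_sum Bochner_Integration.integrable_add int)
    show "AE t in circ. 0 \<le> ?F t"
      using pos by (intro AE_I2 sum_nonneg add_nonneg_nonneg vpart_nonneg) auto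
  qed
  also have "(\<integral>t. ?F t \<partial>circ) = (\<Sum>i\<in>{1..n}. \<integral>t. ?k i t + ?v i t \<partial>circ)"
    by (intro Bochner_Integration.integral_sum Bochner_Integration.integrable_add int)
  also have "\<dots> = (\<Sum>i\<in>{1..n}. paction n \<alpha> \<beta> m M q i)"
  proof (rule sum.cong)
    fix i assume i: "i \<in> {1..n}"
    show "(\<integral>t. ?k i t + ?v i t \<partial>circ) = paction n \<alpha> \<beta> m M q i"
      unfolding paction_def Bochner_Integration.integral_add[OF int[OF i]] by simp
  qed simp
  finally show ?thesis .
qed

text \<open>The squared distance of two vertices of the unit \<open>n\<close>-gon that are \<open>k\<close> steps apart.\<close>

definition chord :: "nat \<Rightarrow> int \<Rightarrow> real" where
  "chord n k = 4 * (sin (pi * of_int k / real n))\<^sup>2"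

lemma chord_periodic: "n > 0 \<Longrightarrow> chord n (k + int n) = chord n k"
  by (simp add: chord_def distrib_left add_divide_distrib)

lemma chord_uminus: "chord n (- k) = chord n k"
  by (simp add: chord_def)

lemma chord_pos:
  assumes "k \<noteq> 0" "\<bar>k\<bar> < int n" shows "chord n k > 0"
proof -
  have "chord n k = chord n \<bar>k\<bar>" by (cases "k \<ge> 0") (simp_all add: chord_uminus)
  moreover have "sin (pi * of_int \<bar>k\<bar> / real n) > 0"
  proof (rule sin_gt_zero)
    have n: "real n > 0" using assms by linarith
    show "0 < pi * of_int \<bar>k\<bar> / real n" using assms n by simp
    have "real_of_int \<bar>k\<bar> < real n" using assms(2) by linarith
    then have "pi * of_int \<bar>k\<bar> < pi * real n" by (intro mult_strict_left_mono) auto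
    then show "pi * of_int \<bar>k\<bar> / real n < pi" using n by (simp add: divide_less_eq)
  qed
  ultimately show ?thesis by (simp add: chord_def)
qed

lemma chord_diff_pos: "i \<in> {1..n} \<Longrightarrow> j \<in> {1..n} - {i} \<Longrightarrow> chord n (int j - int i) > 0"
  by (rule chord_pos) auto

text \<open>Squared distances serve as the variable because their integrals are quadratic in the
  loops and hence accessible to Fourier series.\<close>

lemma divide_norm_powr:
  fixes x :: "'a::real_normed_vector"
  assumes "x \<noteq> 0" shows "c / norm x powr a = c * ((norm x)\<^sup>2) powr (- (a / 2))"
proof -
  have eq: "(norm x)\<^sup>2 powr (- (a / 2)) = norm x powr (- a)"
  proof -
    have square: "(norm x)\<^sup>2 = norm x powr 2" using assms by (simp add: powr_numeral)
    show ?thesis unfolding square powr_powr by simp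
  qed
  show ?thesis unfolding eq unfolding powr_minus by (rule divide_inverse)
qed

text \<open>The first identity is the parallelogram law, as \<open>C2\<close> is
  \<open>- C1\<close>; it has no term linear in \<open>x\<close>. By the second, equal distances to
  both centers put \<open>x\<close> into the \<open>yz\<close>-plane.\<close>

lemma center_distances: "(norm (x - C1))\<^sup>2 + (norm (x - C2))\<^sup>2 = 2 * (norm x)\<^sup>2 + 2"
  "(norm (x - C1))\<^sup>2 - (norm (x - C2))\<^sup>2 = - 4 * x $ 1"
  by (simp_all add: power2_norm_eq_inner inner_vec_def sum_3 C1_def C2_def algebra_simps)

text \<open>The shift is written as twice an angle, since the estimate for translates contains the
  sine of half the shift; this becomes the sine in \<open>chord\<close>.\<close>

lemma choreography_shift:
  assumes "choreography n q" "i \<in> {1..n}" "j \<in> {1..n}"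
  shows "q j t = q i (t + 2 * (pi * of_int (int j - int i) / real n))"
proof -
  have chor: "q k t = q 1 (t + (real k - 1) * (2 * pi / real n))" if "k \<in> {1..n}" for k t
    using assms(1) that unfolding choreography_def by blast
  have "q i (t + 2 * (pi * of_int (int j - int i) / real n)) =
      q 1 (t + 2 * (pi * of_int (int j - int i) / real n) + (real i - 1) * (2 * pi / real n))"
    by (rule chor[OF assms(2)])
  also have "t + 2 * (pi * of_int (int j - int i) / real n) + (real i - 1) * (2 * pi / real n) =
      t + (real j - 1) * (2 * pi / real n)"
    using assms(2) by (simp add: field_simps)
  also have "q 1 \<dots> = q j t"
    by (rule chor[OF assms(3), symmetric])
  finally show ?thesis ..
qed

text \<open>
  The last assumption says that the action of a rotating \<open>n\<close>-gon of squared radius \<open>K\<close>, which is a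
  multiple of
  \<open>m / 2 * K + m\<^sup>2 / 2 * (\<Sum>h. (chord n h * K) powr (- \<alpha> / 2)) + 2 * m * M * (K + 1) powr (- \<beta> / 2)\<close>,
  has a critical point at \<open>K\<close>.
\<close>

locale critical_radius =
  fixes n :: nat and \<alpha> \<beta> m M K :: real
  assumes n: "n \<ge> 2" and pos: "\<alpha> > 0" "\<beta> > 0" "m > 0" "M > 0" "K > 0"
    and crit: "m / 2 = 1/2 * m\<^sup>2 * (\<Sum>h\<in>{1..<n}. \<alpha> / 2 * (chord n (int h) * K) powr (- (\<alpha> / 2) - 1) * chord n (int h))
      + m * M * (\<beta> * (K + 1) powr (- (\<beta> / 2) - 1))"
begin

text \<open>Minus the derivative of \<open>x powr (- (\<alpha> / 2))\<close> at the squared distance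
  of two vertices \<open>k\<close> steps apart, the polygon having squared radius
  \<open>K\<close>.\<close>

definition slope_pair :: "int \<Rightarrow> real" where
  "slope_pair k = \<alpha> / 2 * (chord n k * K) powr (- (\<alpha> / 2) - 1)"

text \<open>Minus twice the derivative of \<open>x powr (- (\<beta> / 2))\<close> at
  \<open>K + 1\<close>, the squared distance of a vertex to either center; the factor two accounts
  for both centers.\<close>

definition slope_center :: real where
  "slope_center = \<beta> * (K + 1) powr (- (\<beta> / 2) - 1)"

text \<open>The constant part of the tangents, left when the terms quadratic in positions are split
  off. One particle of the rotating polygon has the share \<open>2 * pi * level\<close> in the
  action.\<close>

definition level :: real where
  "level = 1/2 * m\<^sup>2 * (\<Sum>h\<in>{1..<n}. (chord n (int h) * K) powr (- (\<alpha> / 2)) + slope_pair (int h) * (chord n (int h) * K))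
     + m * M * (2 * (K + 1) powr (- (\<beta> / 2)) + slope_center * K)"

definition excess :: "(nat \<Rightarrow> real^3) \<Rightarrow> nat \<Rightarrow> real" where
  "excess x i = 1/2 * m\<^sup>2 * (\<Sum>j\<in>{1..n}-{i}. tangent_gap (\<alpha>/2) (chord n (int j - int i) * K) ((norm (x i - x j))\<^sup>2))
     + m * M * (tangent_gap (\<beta>/2) (K + 1) ((norm (x i - C1))\<^sup>2) + tangent_gap (\<beta>/2) (K + 1) ((norm (x i - C2))\<^sup>2))"

lemma slope_nonneg: "slope_pair k \<ge> 0" "slope_center > 0"
  using pos by (auto simp: slope_pair_def slope_center_def)

lemma tangent_gap_slope:
  "tangent_gap (\<alpha>/2) (chord n k * K) y =
    y powr (- (\<alpha>/2)) - ((chord n k * K) powr (- (\<alpha>/2)) - slope_pair k * (y - chord n k * K))"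
  "tangent_gap (\<beta>/2) (K + 1) y =
    y powr (- (\<beta>/2)) - ((K + 1) powr (- (\<beta>/2)) - slope_center / 2 * (y - (K + 1)))"
  by (simp_all add: tangent_gap_def slope_pair_def slope_center_def)

lemma level_nonneg: "level \<ge> 0"
proof -
  have "chord n k \<ge> 0" for k by (simp add: chord_def)
  then show ?thesis unfolding level_def using pos slope_nonneg(1) less_imp_le[OF slope_nonneg(2)]
    by (intro add_nonneg_nonneg mult_nonneg_nonneg sum_nonneg) auto
qed

lemma sum_chord_differences:
  assumes "i \<in> {1..n}"
  shows "(\<Sum>j\<in>{1..n}-{i}. f (chord n (int j - int i))) = (\<Sum>h\<in>{1..<n}. f (chord n (int h)))"
  using sum_periodic_differences[of "\<lambda>k. f (chord n k)" n i] assms n by (simp add: chord_periodic)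

text \<open>Criticality of \<open>K\<close> as seen from particle \<open>i\<close>: the coefficient
  of the kinetic energy is the total price of the estimates for its pairs and for both
  centers.\<close>

lemma critical: "i \<in> {1..n} \<Longrightarrow> m / 2 = 1/2 * m\<^sup>2 * (\<Sum>j\<in>{1..n}-{i}. slope_pair (int j - int i) * chord n (int j - int i))
      + m * M * slope_center"
  unfolding slope_pair_def slope_center_def
  by (subst sum_chord_differences[where f = "\<lambda>c. \<alpha> / 2 * (c * K) powr (- (\<alpha> / 2) - 1) * c"]) (auto simp: crit)

text \<open>An identity instead of an estimate, because the equality case needs the gaps collected
  in \<open>excess\<close>. The linear parts at the two centers combine, by the parallelogram law,
  into a multiple of \<open>(norm (x i))\<^sup>2\<close>.\<close>

lemma vpart_eq_tangent:
  assumes i: "i \<in> {1..n}" and coll: "\<And>j. j \<in> {1..n}-{i} \<Longrightarrow> x i \<noteq> x j" "x i \<noteq> C1" "x i \<noteq> C2"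
  shows "vpart n \<alpha> \<beta> m M x i = level
    - 1/2 * m\<^sup>2 * (\<Sum>j\<in>{1..n}-{i}. slope_pair (int j - int i) * (norm (x i - x j))\<^sup>2)
    - m * M * (slope_center * (norm (x i))\<^sup>2) + excess x i"
proof -
  let ?D = "\<lambda>j. chord n (int j - int i) * K" and ?h = "slope_center / 2"
  have pair: "m\<^sup>2 / norm (x i - x j) powr \<alpha> = m\<^sup>2 * (?D j powr (- (\<alpha>/2)) + slope_pair (int j - int i) * ?D j
      - slope_pair (int j - int i) * (norm (x i - x j))\<^sup>2 + tangent_gap (\<alpha>/2) (?D j) ((norm (x i - x j))\<^sup>2))"
    if "j \<in> {1..n}-{i}" for j
  proof -
    have "m\<^sup>2 / norm (x i - x j) powr \<alpha> = m\<^sup>2 * ((norm (x i - x j))\<^sup>2) powr (- (\<alpha> / 2))"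
      using coll(1)[OF that] by (intro divide_norm_powr) simp
    then show ?thesis unfolding tangent_gap_slope by (simp add: algebra_simps)
  qed
  have pairs: "(\<Sum>j\<in>{1..n}-{i}. m\<^sup>2 / norm (x i - x j) powr \<alpha>) =
      m\<^sup>2 * ((\<Sum>h\<in>{1..<n}. (chord n (int h) * K) powr (- (\<alpha> / 2)) + slope_pair (int h) * (chord n (int h) * K))
        - (\<Sum>j\<in>{1..n}-{i}. slope_pair (int j - int i) * (norm (x i - x j))\<^sup>2)
        + (\<Sum>j\<in>{1..n}-{i}. tangent_gap (\<alpha>/2) (?D j) ((norm (x i - x j))\<^sup>2)))"
    unfolding slope_pair_def
      sum_chord_differences[OF i, of "\<lambda>c. (c * K) powr (- (\<alpha> / 2)) + \<alpha> / 2 * (c * K) powr (- (\<alpha> / 2) - 1) * (c * K)", symmetric]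
    by (simp only: pair slope_pair_def sum.distrib sum_subtractf sum_distrib_left[symmetric] cong: sum.cong)
  have center: "m * M / norm (x i - c) powr \<beta> = m * M * ((K + 1) powr (- (\<beta>/2))
      - ?h * ((norm (x i - c))\<^sup>2 - (K + 1)) + tangent_gap (\<beta>/2) (K + 1) ((norm (x i - c))\<^sup>2))"
    if "x i \<noteq> c" for c
    using that unfolding tangent_gap_slope
    by (subst divide_norm_powr) (simp_all add: algebra_simps add_divide_distrib diff_divide_distrib)
  have "m * M / norm (x i - C1) powr \<beta> + m * M / norm (x i - C2) powr \<beta> =
     m * M * (2 * (K + 1) powr (- (\<beta>/2))
      - ?h * (((norm (x i - C1))\<^sup>2 + (norm (x i - C2))\<^sup>2) - 2 * (K + 1))
      + (tangent_gap (\<beta>/2) (K + 1) ((norm (x i - C1))\<^sup>2) + tangent_gap (\<beta>/2) (K + 1) ((norm (x i - C2))\<^sup>2)))"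
    unfolding center[OF coll(2)] center[OF coll(3)]
    by (simp only: distrib_left right_diff_distrib mult_2 add_ac diff_conv_add_uminus minus_add_distrib minus_minus)
  also have "\<dots> = m * M * (2 * (K + 1) powr (- (\<beta>/2)) + slope_center * K - slope_center * (norm (x i))\<^sup>2
      + (tangent_gap (\<beta>/2) (K + 1) ((norm (x i - C1))\<^sup>2) + tangent_gap (\<beta>/2) (K + 1) ((norm (x i - C2))\<^sup>2)))"
    unfolding center_distances(1) by (simp add: algebra_simps add_divide_distrib diff_divide_distrib)
  finally show ?thesis
    unfolding vpart_def pairs level_def excess_def by (simp add: algebra_simps)
qed

text \<open>All gaps are nonnegative. If they vanish, those at the centers fix both distances, and
  with them the norm and the first coordinate of \<open>x i\<close>.\<close>

lemma excess_nonneg: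
  assumes i: "i \<in> {1..n}" and coll: "\<And>j. j \<in> {1..n}-{i} \<Longrightarrow> x i \<noteq> x j" "x i \<noteq> C1" "x i \<noteq> C2"
  shows "excess x i \<ge> 0"
    and "excess x i = 0 \<Longrightarrow> (norm (x i - C1))\<^sup>2 = K + 1 \<and> (norm (x i - C2))\<^sup>2 = K + 1"
proof -
  let ?c = "\<lambda>c. tangent_gap (\<beta>/2) (K + 1) ((norm (x i - c))\<^sup>2)"
  let ?p = "1/2 * m\<^sup>2 * (\<Sum>j\<in>{1..n}-{i}. tangent_gap (\<alpha>/2) (chord n (int j - int i) * K) ((norm (x i - x j))\<^sup>2))"
  have p: "?p \<ge> 0"
    using pos coll(1) chord_diff_pos[OF i]
    by (intro mult_nonneg_nonneg sum_nonneg tangent_gap_nonneg) auto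
  have c: "?c C1 \<ge> 0" "?c C2 \<ge> 0"
    using pos coll(2,3) by (auto intro!: tangent_gap_nonneg)
  have ex: "excess x i = ?p + m * M * (?c C1 + ?c C2)" by (simp add: excess_def)
  have mc: "m * M * (?c C1 + ?c C2) \<ge> 0" using c pos by simp
  show "excess x i \<ge> 0" unfolding ex using p mc by linarith
  assume "excess x i = 0"
  then have "m * M * (?c C1 + ?c C2) = 0" unfolding ex using p mc by linarith
  then have "?c C1 = 0 \<and> ?c C2 = 0" using c pos by (simp add: add_nonneg_eq_0_iff)
  then show "(norm (x i - C1))\<^sup>2 = K + 1 \<and> (norm (x i - C2))\<^sup>2 = K + 1"
    using pos coll(2,3) tangent_gap_zero[of _ "K + 1" "\<beta>/2"] by auto
qed

text \<open>By \<open>critical\<close> the kinetic energy splits into one portion for each pair and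
  one for the centers, and each portion is set against the integral that it has to dominate.
  Continuity of \<open>excess\<close> allows pointwise conclusions from its integral.\<close>

lemma paction_eq:
  assumes q: "q \<in> H_space n" and i: "i \<in> {1..n}"
  defines "V \<equiv> \<integral>t. (norm (weak_deriv (q i) t))\<^sup>2 \<partial>circ"
  shows "paction n \<alpha> \<beta> m M q i = 2 * pi * level
    + 1/2 * m\<^sup>2 * (\<Sum>j\<in>{1..n}-{i}. slope_pair (int j - int i) *
        (chord n (int j - int i) * V - (\<integral>t. (norm (q i t - q j t))\<^sup>2 \<partial>circ)))
    + m * M * (slope_center * (V - (\<integral>t. (norm (q i t))\<^sup>2 \<partial>circ)))
    + (\<integral>t. excess (\<lambda>j. q j t) i \<partial>circ)"
    and "continuous_on S (\<lambda>t. excess (\<lambda>j. q j t) i)"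
proof -
  let ?s = "\<lambda>j. slope_pair (int j - int i)"
  let ?d = "\<lambda>t. \<Sum>j\<in>{1..n}-{i}. ?s j * (norm (q i t - q j t))\<^sup>2"
  let ?e = "\<lambda>t. excess (\<lambda>j. q j t) i"
  have v: "vpart n \<alpha> \<beta> m M (\<lambda>j. q j t) i = level - 1/2 * m\<^sup>2 * ?d t - m * M * (slope_center * (norm (q i t))\<^sup>2) + ?e t" for t
    using H_space_collisions[OF q i] by (intro vpart_eq_tangent i) auto
  have contd: "continuous_on S (\<lambda>t. ?s j * (norm (q i t - q j t))\<^sup>2)" if "j \<in> {1..n}-{i}" for j S
    using that by (intro continuous_on_mult continuous_on_const continuous_on_power continuous_on_norm
        continuous_on_diff continuous_H_space[OF q] i) auto
  have contD: "continuous_on S ?d" for S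
    by (intro continuous_on_sum contd)
  have contq: "continuous_on S (\<lambda>t. (norm (q i t))\<^sup>2)" for S
    by (intro continuous_on_power continuous_on_norm continuous_H_space[OF q i])
  have e: "?e = (\<lambda>t. vpart n \<alpha> \<beta> m M (\<lambda>j. q j t) i - level + 1/2 * m\<^sup>2 * ?d t + m * M * (slope_center * (norm (q i t))\<^sup>2))"
    unfolding v by (simp add: fun_eq_iff)
  show conte: "continuous_on S ?e" for S
    unfolding e by (intro continuous_on_add continuous_on_diff continuous_on_mult continuous_on_const
        continuous_vpart[OF q i] contD contq)
  have int: "integrable circ ?d" "integrable circ ?e" "integrable circ (\<lambda>t. (norm (q i t))\<^sup>2)"
    by (intro integrable_circ_continuous contD conte contq)+
  have "(\<integral>t. vpart n \<alpha> \<beta> m M (\<lambda>j. q j t) i \<partial>circ) = 2 * pi * level - 1/2 * m\<^sup>2 * (\<integral>t. ?d t \<partial>circ)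
      - m * M * (slope_center * (\<integral>t. (norm (q i t))\<^sup>2 \<partial>circ)) + (\<integral>t. ?e t \<partial>circ)"
    unfolding v using int by simp
  moreover have "(\<integral>t. ?d t \<partial>circ) = (\<Sum>j\<in>{1..n}-{i}. ?s j * (\<integral>t. (norm (q i t - q j t))\<^sup>2 \<partial>circ))"
    by (subst Bochner_Integration.integral_sum) (rule integrable_circ_continuous[OF contd], assumption, simp)
  moreover have "m / 2 * V = 1/2 * m\<^sup>2 * (\<Sum>j\<in>{1..n}-{i}. ?s j * (chord n (int j - int i) * V)) + m * M * (slope_center * V)"
    unfolding critical[OF i] by (simp add: distrib_right sum_distrib_right mult.assoc)
  ultimately show "paction n \<alpha> \<beta> m M q i = 2 * pi * level
    + 1/2 * m\<^sup>2 * (\<Sum>j\<in>{1..n}-{i}. ?s j * (chord n (int j - int i) * V - (\<integral>t. (norm (q i t - q j t))\<^sup>2 \<partial>circ)))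
    + m * M * (slope_center * (V - (\<integral>t. (norm (q i t))\<^sup>2 \<partial>circ))) + (\<integral>t. ?e t \<partial>circ)"
    unfolding paction_def V_def[symmetric] by (simp add: right_diff_distrib sum_subtractf)
qed

text \<open>The summands beyond the constant are nonnegative by the estimate for translates, by
  Wirtinger's inequality and by convexity. If they vanish, \<open>slope_center > 0\<close> gives
  equality in Wirtinger's inequality, and \<open>excess\<close> is zero at all times of the
  period.\<close>

lemma paction_lower_bound:
  assumes q: "q \<in> Lambda_space n" and i: "i \<in> {1..n}"
  shows "2 * pi * level \<le> paction n \<alpha> \<beta> m M q i"
    and "paction n \<alpha> \<beta> m M q i \<le> 2 * pi * level \<Longrightarrow>
      (\<integral>t. (norm (weak_deriv (q i) t))\<^sup>2 \<partial>circ) \<le> (\<integral>t. (norm (q i t))\<^sup>2 \<partial>circ) \<and>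
      (\<forall>t\<in>{0..2*pi}. (norm (q i t - C1))\<^sup>2 = K + 1 \<and> (norm (q i t - C2))\<^sup>2 = K + 1)"
proof -
  note qH = Lambda_spaceD(1)[OF q]
  note qi = H_spaceD(1)[OF qH i]
  define V where "V = (\<integral>t. (norm (weak_deriv (q i) t))\<^sup>2 \<partial>circ)"
  define A where "A = 1/2 * m\<^sup>2 * (\<Sum>j\<in>{1..n}-{i}. slope_pair (int j - int i) *
        (chord n (int j - int i) * V - (\<integral>t. (norm (q i t - q j t))\<^sup>2 \<partial>circ)))"
  define B where "B = V - (\<integral>t. (norm (q i t))\<^sup>2 \<partial>circ)"
  define E where "E = (\<integral>t. excess (\<lambda>j. q j t) i \<partial>circ)"
  have P: "paction n \<alpha> \<beta> m M q i = 2 * pi * level + A + m * M * (slope_center * B) + E"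
    unfolding paction_eq(1)[OF qH i] A_def B_def E_def V_def ..
  have ex: "excess (\<lambda>j. q j t) i \<ge> 0" for t
    using H_space_collisions[OF qH i] by (intro excess_nonneg(1) i) auto
  have "(\<integral>t. (norm (q i t - q j t))\<^sup>2 \<partial>circ) \<le> chord n (int j - int i) * V" if "j \<in> {1..n}-{i}" for j
  proof -
    let ?h = "2 * (pi * of_int (int j - int i) / real n)"
    have "q j t = q i (t + ?h)" for t
      using that by (intro choreography_shift[OF Lambda_spaceD(2)[OF q] i]) auto
    then have "(\<integral>t. (norm (q i t - q j t))\<^sup>2 \<partial>circ) = (\<integral>t. (norm (q i (t + ?h) - q i t))\<^sup>2 \<partial>circ)"
      by (simp only: norm_minus_commute)
    also have "\<dots> \<le> 4 * (sin (?h / 2))\<^sup>2 * V"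
      unfolding V_def by (rule H1_shift_difference_bound[OF qi])
    finally show ?thesis by (simp add: chord_def)
  qed
  then have A: "A \<ge> 0"
    unfolding A_def using slope_nonneg(1) by (intro mult_nonneg_nonneg sum_nonneg) auto
  have B: "B \<ge> 0"
    unfolding B_def V_def using H1_poincare[OF qi Lambda_spaceD(3)[OF q i]] by simp
  then have B': "m * M * (slope_center * B) \<ge> 0" using pos slope_nonneg(2) by simp
  have E: "E \<ge> 0" unfolding E_def using ex by simp
  show "2 * pi * level \<le> paction n \<alpha> \<beta> m M q i" unfolding P using A B' E by linarith
  assume "paction n \<alpha> \<beta> m M q i \<le> 2 * pi * level"
  then have "m * M * (slope_center * B) = 0" "E \<le> 0" unfolding P using A B' E by linarith+
  then have "B = 0" using pos slope_nonneg(2) by simp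
  moreover have "(norm (q i t - C1))\<^sup>2 = K + 1 \<and> (norm (q i t - C2))\<^sup>2 = K + 1" if "t \<in> {0..2*pi}" for t
  proof -
    have "excess (\<lambda>j. q j t) i = 0"
      using paction_eq(2)[OF qH i] ex \<open>E \<le> 0\<close> that unfolding E_def by (rule continuous_integral_circ_zero)
    then show ?thesis
      using H_space_collisions[OF qH i] excess_nonneg(2)[of i "\<lambda>j. q j t"] i by auto
  qed
  ultimately show "(\<integral>t. (norm (weak_deriv (q i) t))\<^sup>2 \<partial>circ) \<le> (\<integral>t. (norm (q i t))\<^sup>2 \<partial>circ) \<and>
      (\<forall>t\<in>{0..2*pi}. (norm (q i t - C1))\<^sup>2 = K + 1 \<and> (norm (q i t - C2))\<^sup>2 = K + 1)"
    unfolding B_def V_def by simp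
qed

end

section \<open>Rotating polygons\<close>

text \<open>The values \<open>1\<close> and \<open>-1\<close> of \<open>s\<close> are the two senses
  of rotation. \<open>R\<close> may be negative: each time derivative multiplies it by
  \<open>s\<close> and advances the phase by \<open>pi / 2\<close>, so velocities and accelerations
  stay in the family.\<close>

definition circular :: "real \<Rightarrow> real \<Rightarrow> real \<Rightarrow> real \<Rightarrow> real^3" where
  "circular R s \<theta> t = (R * cos (s * t + \<theta>)) *\<^sub>R vector [0, 1, 0] + (R * sin (s * t + \<theta>)) *\<^sub>R vector [0, 0, 1]"

lemma circular_nth [simp]:
  "circular R s \<theta> t $ 1 = 0" "circular R s \<theta> t $ 2 = R * cos (s * t + \<theta>)"
  "circular R s \<theta> t $ 3 = R * sin (s * t + \<theta>)"
  by (simp_all add: circular_def)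

lemma vec3_eq_iff: "(x :: real^3) = y \<longleftrightarrow> x $ 1 = y $ 1 \<and> x $ 2 = y $ 2 \<and> x $ 3 = y $ 3"
  by (simp add: vec_eq_iff forall_3)

lemma norm_square_3: "(norm (x :: real^3))\<^sup>2 = (x $ 1)\<^sup>2 + (x $ 2)\<^sup>2 + (x $ 3)\<^sup>2"
  unfolding power2_norm_eq_inner inner_vec_def sum_3 by (simp add: power2_eq_square)

lemma norm_square_circular: "(norm (circular R s \<theta> t))\<^sup>2 = R\<^sup>2"
proof -
  have "(norm (circular R s \<theta> t))\<^sup>2 = R\<^sup>2 * ((cos (s * t + \<theta>))\<^sup>2 + (sin (s * t + \<theta>))\<^sup>2)"
    unfolding norm_square_3 circular_nth by (simp only: power_mult_distrib distrib_left) simp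
  then show ?thesis by simp
qed

lemma circular_shift: "circular R s \<theta> (t + c) = circular R s (\<theta> + s * c) t"
  by (simp add: vec3_eq_iff algebra_simps)

text \<open>Resolves a rotated position into a radial and a tangential part, the latter along the
  position with phase advanced by a quarter turn.\<close>

lemma circular_rotate:
  "circular R s (\<theta> + \<delta>) t = cos \<delta> *\<^sub>R circular R s \<theta> t + sin \<delta> *\<^sub>R circular R s (\<theta> + pi / 2) t"
proof -
  have a: "s * t + (\<theta> + \<delta>) = (s * t + \<theta>) + \<delta>" "s * t + (\<theta> + pi/2) = (s * t + \<theta>) + pi/2" by simp_all
  show ?thesis
    unfolding vec3_eq_iff vector_add_component vector_scaleR_component circular_nth a
    by (simp add: cos_add sin_add algebra_simps)
qed

lemma circular_uminus: "circular R s (\<theta> + pi) t = - circular R s \<theta> t"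
  using circular_rotate[of R s \<theta> pi t] by simp

lemma norm_square_circular_diff:
  "(norm (circular R s \<theta> t - circular R s (\<theta> + \<delta>) t))\<^sup>2 = R\<^sup>2 * (4 * (sin (\<delta> / 2))\<^sup>2)"
proof -
  define x where "x = s * t + \<theta>"
  have a: "s * t + (\<theta> + \<delta>) = x + \<delta>" "s * t + \<theta> = x" by (simp_all add: x_def)
  have "(cos x - cos (x + \<delta>))\<^sup>2 + (sin x - sin (x + \<delta>))\<^sup>2 =
      ((cos x)\<^sup>2 + (sin x)\<^sup>2) + ((cos (x + \<delta>))\<^sup>2 + (sin (x + \<delta>))\<^sup>2)
      - 2 * (cos (x + \<delta>) * cos x + sin (x + \<delta>) * sin x)"
    by (simp only: power2_diff) (simp add: algebra_simps)
  also have "\<dots> = 2 - 2 * cos \<delta>"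
    using cos_diff[of "x + \<delta>" x] by simp
  also have "\<dots> = 4 * (sin (\<delta> / 2))\<^sup>2"
    using cos_double_sin[of "\<delta> / 2"] by simp
  finally have "R\<^sup>2 * ((cos x - cos (x + \<delta>))\<^sup>2 + (sin x - sin (x + \<delta>))\<^sup>2) = R\<^sup>2 * (4 * (sin (\<delta> / 2))\<^sup>2)"
    by (simp only:)
  then show ?thesis
    unfolding norm_square_3 vector_minus_component circular_nth a
    by (simp only: right_diff_distrib[symmetric] power_mult_distrib distrib_left) simp
qed

lemma circular_has_vector_derivative:
  "(circular R s \<theta> has_vector_derivative circular (R * s) s (\<theta> + pi / 2) t) (at t)"
proof -
  have a: "s * t + (\<theta> + pi/2) = (s * t + \<theta>) + pi/2" by simp
  have "((\<lambda>t. R * cos (s * t + \<theta>)) has_real_derivative (R * s) * cos (s * t + (\<theta> + pi/2))) (at t)"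
    unfolding a by (auto intro!: derivative_eq_intros simp: cos_add[of "s * t + \<theta>"])
  moreover have "((\<lambda>t. R * sin (s * t + \<theta>)) has_real_derivative (R * s) * sin (s * t + (\<theta> + pi/2))) (at t)"
    unfolding a by (auto intro!: derivative_eq_intros simp: sin_add[of "s * t + \<theta>"])
  ultimately have "((\<lambda>t. (R * cos (s * t + \<theta>)) *\<^sub>R vector [0, 1, 0] + (R * sin (s * t + \<theta>)) *\<^sub>R vector [0, 0, 1] :: real^3)
      has_vector_derivative
      (((R * cos (s * t + \<theta>)) *\<^sub>R 0 + ((R * s) * cos (s * t + (\<theta> + pi/2))) *\<^sub>R vector [0, 1, 0])
      + ((R * sin (s * t + \<theta>)) *\<^sub>R 0 + ((R * s) * sin (s * t + (\<theta> + pi/2))) *\<^sub>R vector [0, 0, 1]))) (at t)"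
    by (intro has_vector_derivative_add has_vector_derivative_scaleR has_vector_derivative_const)
  then show ?thesis by (simp add: circular_def[abs_def])
qed

lemma circular_periodic: "\<bar>s\<bar> = 1 \<Longrightarrow> periodic_2pi (circular R s \<theta>)"
proof -
  assume "\<bar>s\<bar> = 1"
  then have "circular R s \<theta> (t + 2 * pi) = circular R s \<theta> t" for t
  proof (cases "s = 1")
    case False
    with \<open>\<bar>s\<bar> = 1\<close> have s: "s = - 1" by linarith
    have "- 1 * (t + 2 * pi) + \<theta> + 2 * pi = - 1 * t + \<theta>" by simp
    then show ?thesis
      unfolding s vec3_eq_iff circular_nth by (metis cos_periodic sin_periodic)
  next
    case True
    have "1 * (t + 2 * pi) + \<theta> = (1 * t + \<theta>) + 2 * pi" by simp
    then show ?thesis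
      unfolding True vec3_eq_iff circular_nth by (metis cos_periodic sin_periodic)
  qed
  then show ?thesis by (simp add: periodic_2pi_def)
qed

lemma circular_antiperiodic:
  assumes "\<bar>s\<bar> = 1" shows "circular R s \<theta> (t + pi) = - circular R s \<theta> t"
proof -
  have "s = 1 \<or> s = -1" using assms by linarith
  then show ?thesis
    unfolding circular_shift circular_rotate[of R s \<theta> "s * pi"] by auto
qed

lemma circular_continuous: "continuous_on S (circular R s \<theta>)"
  by (intro continuous_at_imp_continuous_on ballI has_vector_derivative_continuous[OF circular_has_vector_derivative])

lemma circular_H1: "\<bar>s\<bar> = 1 \<Longrightarrow> circular R s \<theta> \<in> H1_2pi"
  using differentiable_in_H1[OF circular_has_vector_derivative circular_continuous circular_periodic circular_periodic] .

lemma circular_kinetic: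
  assumes "\<bar>s\<bar> = 1"
  shows "(\<integral>t. (norm (weak_deriv (circular R s \<theta>) t))\<^sup>2 \<partial>circ) = 2 * pi * R\<^sup>2"
proof -
  have "(\<integral>t. (norm (weak_deriv (circular R s \<theta>) t))\<^sup>2 \<partial>circ) = (\<integral>t. R\<^sup>2 \<partial>circ)"
  proof (rule integral_cong_AE)
    have s2: "s\<^sup>2 = 1" using assms by (metis one_power2 power2_abs)
    have "AE t in circ. weak_deriv (circular R s \<theta>) t = circular (R * s) s (\<theta> + pi / 2) t"
      by (rule weak_deriv_differentiable[OF circular_has_vector_derivative circular_continuous
            circular_periodic[OF assms] circular_periodic[OF assms]])
    then show "AE t in circ. (norm (weak_deriv (circular R s \<theta>) t))\<^sup>2 = R\<^sup>2"
      by (rule eventually_mono) (simp only: norm_square_circular power_mult_distrib s2 mult_1_right)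
    show "(\<lambda>t. (norm (weak_deriv (circular R s \<theta>) t))\<^sup>2) \<in> borel_measurable circ"
      using L2_2pi_circ(2)[OF H1_2piD(4)[OF circular_H1[OF assms]]] by (rule borel_measurable_integrable)
  qed simp
  then show ?thesis using integral_circ_const[of "R\<^sup>2"] by simp
qed

text \<open>The offset of the phase carries the factor \<open>s\<close>, as it comes from a time
  shift; this gives a choreography for both senses of rotation, with phase \<open>\<theta>\<close>
  for particle 1.\<close>

definition polygon :: "nat \<Rightarrow> real \<Rightarrow> real \<Rightarrow> real \<Rightarrow> nat \<Rightarrow> real \<Rightarrow> real^3" where
  "polygon n R s \<theta> i = circular R s (\<theta> + s * ((real i - 1) * (2 * pi / real n)))"

lemma polygon_choreography: "choreography n (polygon n R s \<theta>)"
  by (simp add: choreography_def polygon_def circular_shift)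

lemma polygon_difference:
  "polygon n R s \<theta> j = circular R s ((\<theta> + s * ((real i - 1) * (2 * pi / real n))) + s * (2 * (pi * of_int (int j - int i) / real n)))"
  unfolding polygon_def by (rule arg_cong[where f = "circular R s"]) (simp add: field_simps add_divide_distrib diff_divide_distrib)

lemma polygon_distance:
  assumes "\<bar>s\<bar> = 1"
  shows "(norm (polygon n R s \<theta> i t - polygon n R s \<theta> j t))\<^sup>2 = chord n (int j - int i) * R\<^sup>2"
proof -
  have "(sin (s * x))\<^sup>2 = (sin x)\<^sup>2" for x
  proof -
    have "s = 1 \<or> s = -1" using assms by linarith
    then show ?thesis by auto
  qed
  from this[of "pi * of_int (int j - int i) / real n"] show ?thesis
    unfolding polygon_difference[of n R s \<theta> j i] unfolding polygon_def norm_square_circular_diff chord_def by simp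
qed

lemma polygon_H_space:
  assumes s: "\<bar>s\<bar> = 1" and R: "R \<noteq> 0"
  shows "polygon n R s \<theta> \<in> H_space n"
  unfolding H_space_def
proof (intro CollectI conjI ballI allI impI)
  show "polygon n R s \<theta> i \<in> H1_2pi" for i
    unfolding polygon_def by (rule circular_H1[OF s])
  fix i j t assume ij: "i \<in> {1..n}" "j \<in> {1..n}" "i \<noteq> j"
  have "chord n (int j - int i) > 0" using ij by (intro chord_diff_pos) auto
  then have "(norm (polygon n R s \<theta> i t - polygon n R s \<theta> j t))\<^sup>2 \<noteq> 0"
    using R unfolding polygon_distance[OF s] by simp
  then show "polygon n R s \<theta> i t \<noteq> polygon n R s \<theta> j t" by auto
next
  fix i t
  have "polygon n R s \<theta> i t $ 1 = 0" by (simp add: polygon_def)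
  then show "polygon n R s \<theta> i t \<noteq> C1" "polygon n R s \<theta> i t \<noteq> C2"
    by (auto simp: C1_def C2_def)
qed

lemma polygon_antiperiodic: "\<bar>s\<bar> = 1 \<Longrightarrow> antiperiodic n (polygon n R s \<theta>)"
  unfolding antiperiodic_def polygon_def using circular_antiperiodic by simp

lemma polygon_relative_equilibrium:
  assumes n: "n \<ge> 2" and s: "\<bar>s\<bar> = 1" and R: "R > 0"
  shows "relative_equilibrium n 0 (vector [0, 1, 0]) (vector [0, 0, 1]) (polygon n R s \<theta>)"
proof -
  let ?a = "vector [0, 1, 0] :: real^3" and ?b = "vector [0, 0, 1] :: real^3"
  have ab: "norm ?a = 1" "norm ?b = 1" "?a \<bullet> ?b = 0"
    by (simp_all add: norm_eq_1 inner_vec_def sum_3)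
  \<comment> \<open>For \<open>s = -1\<close> the vertices are numbered in the opposite sense, with \<open>n\<close> in the role of \<open>0\<close>.\<close>
  define p where "p i = (if s = -1 \<and> 1 \<le> i \<and> i < n then n - i else i)" for i
  have "p permutes {1..n}"
  proof (rule bij_imp_permutes)
    show "bij_betw p {1..n} {1..n}"
      by (rule bij_betwI[of _ _ _ p]) (auto simp: p_def)
  qed (auto simp: p_def)
  \<comment> \<open>The vertices are counted from \<open>1\<close> in
    \<open>relative_equilibrium\<close> but from \<open>0\<close> in \<open>polygon\<close>;
    subtracting \<open>s * (2 * pi / real n)\<close> from the phase makes up for this.\<close>
  moreover have "polygon n R s \<theta> i t = 0 + (R * cos (s * t + (\<theta> - s * (2 * pi / real n)) + 2 * pi * real (p i) / real n)) *\<^sub>R ?a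
      + (R * sin (s * t + (\<theta> - s * (2 * pi / real n)) + 2 * pi * real (p i) / real n)) *\<^sub>R ?b"
    if i: "i \<in> {1..n}" for i t
  proof -
    let ?x = "s * t + (\<theta> + s * ((real i - 1) * (2 * pi / real n)))"
    let ?y = "s * t + (\<theta> - s * (2 * pi / real n)) + 2 * pi * real (p i) / real n"
    have "\<exists>k::int. ?y = ?x + 2 * pi * of_int k"
    proof (cases "s = 1")
      case True
      then have "?y = ?x + 2 * pi * of_int 0" using n by (simp add: p_def field_simps)
      then show ?thesis by blast
    next
      case False
      with s have s': "s = -1" by linarith
      show ?thesis
      proof (cases "i = n")
        case True
        \<comment> \<open>Two turns and not one, since \<open>p n\<close> is \<open>n\<close> in
          place of \<open>0\<close>.\<close>
        then have "?y = ?x + 2 * pi * of_int 2" using n unfolding s' by (simp add: p_def s' field_simps)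
        then show ?thesis by blast
      next
        case False
        then have "p i = n - i" "i \<le> n" using i s' by (auto simp: p_def)
        then have "?y = ?x + 2 * pi * of_int 1" using n unfolding s' by (simp add: of_nat_diff field_simps)
        then show ?thesis by blast
      qed
    qed
    then have "sin ?y = sin ?x \<and> cos ?y = cos ?x" unfolding sin_cos_eq_iff .
    then show ?thesis unfolding polygon_def circular_def by simp
  qed
  moreover have "s \<noteq> 0" using s by auto
  ultimately show ?thesis
    unfolding relative_equilibrium_def using ab R by blast
qed

text \<open>In the plane, a vector orthogonal to \<open>A\<close> and of the same length is
  \<open>A\<close> turned by a quarter to one of two sides; \<open>s\<close> records the
  side.\<close>

lemma circular_if_orthogonal:
  fixes A B :: "real^3"
  assumes R: "R > 0" and A: "A $ 1 = 0" "(norm A)\<^sup>2 = R\<^sup>2" and B: "B $ 1 = 0" "(norm B)\<^sup>2 = R\<^sup>2" and AB: "A \<bullet> B = 0"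
  shows "\<exists>s \<theta>. \<bar>s\<bar> = 1 \<and> (\<forall>t. cos t *\<^sub>R A + sin t *\<^sub>R B = circular R s \<theta> t)"
proof -
  have a: "(A $ 2)\<^sup>2 + (A $ 3)\<^sup>2 = R\<^sup>2" and b: "(B $ 2)\<^sup>2 + (B $ 3)\<^sup>2 = R\<^sup>2"
    using A B by (simp_all add: norm_square_3)
  have ab: "A $ 2 * B $ 2 + A $ 3 * B $ 3 = 0"
    using AB A(1) by (simp add: inner_vec_def sum_3)
  have "(A $ 2 / R)\<^sup>2 + (A $ 3 / R)\<^sup>2 = ((A $ 2)\<^sup>2 + (A $ 3)\<^sup>2) / R\<^sup>2"
    by (simp add: power_divide add_divide_distrib)
  also have "\<dots> = 1" using a R by simp
  finally obtain \<theta> where \<theta>: "A $ 2 / R = cos \<theta>" "A $ 3 / R = sin \<theta>"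
    by (rule sincos_total_2pi)
  then have A': "A $ 2 = R * cos \<theta>" "A $ 3 = R * sin \<theta>" using R by (simp_all add: field_simps)
  \<comment> \<open>The component of \<open>B\<close> along the unit vector orthogonal to
    \<open>A\<close>, divided by \<open>R\<close>. As \<open>B\<close> has no other component and
    length \<open>R\<close>, this is a sign.\<close>
  define s where "s = (cos \<theta> * B $ 3 - sin \<theta> * B $ 2) / R"
  have "R * (cos \<theta> * B $ 2 + sin \<theta> * B $ 3) = 0" using ab unfolding A' by (simp add: algebra_simps)
  then have orth: "cos \<theta> * B $ 2 + sin \<theta> * B $ 3 = 0" using R by simp
  have Rs: "R * s = cos \<theta> * B $ 3 - sin \<theta> * B $ 2" using R by (simp add: s_def)
  have one: "cos \<theta> * cos \<theta> + sin \<theta> * sin \<theta> = 1" by (rule sin_cos_squared_add3)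
  have "R * s * cos \<theta> = (cos \<theta> * cos \<theta> + sin \<theta> * sin \<theta>) * B $ 3 - sin \<theta> * (cos \<theta> * B $ 2 + sin \<theta> * B $ 3)"
    unfolding Rs by algebra
  then have B3: "B $ 3 = R * s * cos \<theta>" unfolding one orth by simp
  have "- (R * s * sin \<theta>) = (cos \<theta> * cos \<theta> + sin \<theta> * sin \<theta>) * B $ 2 - cos \<theta> * (cos \<theta> * B $ 2 + sin \<theta> * B $ 3)"
    unfolding Rs by algebra
  then have B2: "B $ 2 = - (R * s * sin \<theta>)" unfolding one orth by simp
  have "(B $ 2)\<^sup>2 + (B $ 3)\<^sup>2 = (R * s)\<^sup>2 * ((sin \<theta>)\<^sup>2 + (cos \<theta>)\<^sup>2)"
    unfolding B2 B3 by algebra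
  then have "(R * s)\<^sup>2 = R\<^sup>2" unfolding b sin_cos_squared_add by simp
  then have "s\<^sup>2 = 1" using R by (simp add: power_mult_distrib)
  then have s: "s = 1 \<or> s = -1" by (simp add: power2_eq_1_iff)
  have "cos t *\<^sub>R A + sin t *\<^sub>R B = circular R s \<theta> t" for t
    unfolding vec3_eq_iff vector_add_component vector_scaleR_component circular_nth A(1) B(1) A' B2 B3
    using s by (auto simp: cos_add sin_add algebra_simps)
  moreover have "\<bar>s\<bar> = 1" using s by auto
  ultimately show ?thesis by blast
qed

context critical_radius
begin

lemma polygon_paction:
  assumes s: "\<bar>s\<bar> = 1" and i: "i \<in> {1..n}"
  shows "paction n \<alpha> \<beta> m M (polygon n (sqrt K) s \<theta>) i = 2 * pi * level"
proof -
  let ?q = "polygon n (sqrt K) s \<theta>"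
  have RK: "(sqrt K)\<^sup>2 = K" "sqrt K \<noteq> 0" using pos by simp_all
  note H = polygon_H_space[OF s RK(2), of n \<theta>]
  have V: "(\<integral>t. (norm (weak_deriv (?q i) t))\<^sup>2 \<partial>circ) = 2 * pi * K"
    unfolding polygon_def circular_kinetic[OF s] RK ..
  have nq: "(norm (?q i t))\<^sup>2 = K" for t
    unfolding polygon_def norm_square_circular RK ..
  have dq: "(norm (?q i t - ?q j t))\<^sup>2 = chord n (int j - int i) * K" for j t
    unfolding polygon_distance[OF s] RK ..
  have q1: "?q i t $ 1 = 0" for t by (simp add: polygon_def)
  have c: "(norm (?q i t - C1))\<^sup>2 = K + 1" "(norm (?q i t - C2))\<^sup>2 = K + 1" for t
    using center_distances[of "?q i t"] unfolding nq q1 by linarith+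
  have ex: "excess (\<lambda>j. ?q j t) i = 0" for t
    unfolding excess_def dq c by (simp add: tangent_gap_def)
  show ?thesis
    unfolding paction_eq(1)[OF H i] V nq dq ex integral_circ_const by simp
qed

lemma polygon_if_paction_minimal:
  assumes q: "q \<in> Lambda_space n" and le: "paction n \<alpha> \<beta> m M q 1 \<le> 2 * pi * level"
  shows "\<exists>s \<theta>. \<bar>s\<bar> = 1 \<and> (\<forall>i\<in>{1..n}. q i = polygon n (sqrt K) s \<theta> i)"
proof -
  have one: "1 \<in> {1..n}" using n by auto
  note low = paction_lower_bound(2)[OF q one le]
  obtain A B where AB: "\<And>t. q 1 t = cos t *\<^sub>R A + sin t *\<^sub>R B"
    using H1_poincare_equality[OF H_spaceD(1)[OF Lambda_spaceD(1)[OF q] one] Lambda_spaceD(3)[OF q one]] low by blast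
  have on_circle: "q 1 t $ 1 = 0 \<and> (norm (q 1 t))\<^sup>2 = K" if "t \<in> {0..2*pi}" for t
    using low that center_distances[of "q 1 t"] by auto
  \<comment> \<open>At \<open>0\<close> and \<open>pi/2\<close> the position is \<open>A\<close> and
    \<open>B\<close>, which gives their lengths; at \<open>pi/4\<close> it is their sum divided by
    \<open>sqrt 2\<close>, which gives their orthogonality.\<close>
  have "0 \<in> {0..2*pi}" "pi/2 \<in> {0..2*pi}" "pi/4 \<in> {0..2*pi}" by auto
  note on = this[THEN on_circle]
  have K: "(sqrt K)\<^sup>2 = K" using pos by simp
  have A: "A $ 1 = 0" "(norm A)\<^sup>2 = (sqrt K)\<^sup>2" using on(1) unfolding K AB by simp_all
  have B: "B $ 1 = 0" "(norm B)\<^sup>2 = (sqrt K)\<^sup>2" using on(2) unfolding K AB by simp_all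
  have "(norm (cos (pi/4) *\<^sub>R A + sin (pi/4) *\<^sub>R B))\<^sup>2 = (cos (pi/4))\<^sup>2 * (norm A)\<^sup>2 + (sin (pi/4))\<^sup>2 * (norm B)\<^sup>2
      + 2 * (cos (pi/4) * sin (pi/4)) * (A \<bullet> B)"
    unfolding power2_norm_eq_inner by (simp add: inner_add_left inner_add_right inner_commute power2_eq_square algebra_simps)
  moreover have "cos (pi/4) * sin (pi/4) = (1/2::real)" "(cos (pi/4))\<^sup>2 = (1/2::real)" "(sin (pi/4))\<^sup>2 = (1/2::real)"
    by (simp_all add: cos_45 sin_45 power_divide)
  ultimately have "A \<bullet> B = 0"
    using on(3) A(2) B(2) unfolding AB K by simp
  then obtain s \<theta> where s: "\<bar>s\<bar> = 1" and c: "\<And>t. cos t *\<^sub>R A + sin t *\<^sub>R B = circular (sqrt K) s \<theta> t"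
    using circular_if_orthogonal[OF _ A B] pos by auto
  have "q i = polygon n (sqrt K) s \<theta> i" if i: "i \<in> {1..n}" for i
  proof
    fix t
    have "q i t = q 1 (t + (real i - 1) * (2 * pi / real n))"
      using Lambda_spaceD(2)[OF q] i unfolding choreography_def by blast
    also have "\<dots> = polygon n (sqrt K) s \<theta> i t" unfolding AB c polygon_def by (rule circular_shift)
    finally show "q i t = polygon n (sqrt K) s \<theta> i t" .
  qed
  then show ?thesis using s by blast
qed

end

section \<open>Newton's equations\<close>

lemma GDERIV_sum:
  fixes f :: "'i \<Rightarrow> 'a::real_inner \<Rightarrow> real"
  assumes "finite I" "\<And>i. i \<in> I \<Longrightarrow> GDERIV (f i) x :> d i"
  shows "GDERIV (\<lambda>x. \<Sum>i\<in>I. f i x) x :> (\<Sum>i\<in>I. d i)"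
  using assms by (induction I rule: finite_induct) (auto intro!: GDERIV_add GDERIV_const)

text \<open>The power is taken of the squared norm, so that at a vertex the coefficient becomes a
  multiple of \<open>slope_pair\<close> or \<open>slope_center\<close>.\<close>

lemma GDERIV_power_law:
  fixes y a :: "'a::real_inner"
  assumes "y \<noteq> a"
  shows "GDERIV (\<lambda>y. c / norm (y - a) powr p) y :> (- (c * p * ((norm (y - a))\<^sup>2) powr (- (p / 2) - 1))) *\<^sub>R (y - a)"
proof -
  have pos: "norm (y - a) > 0" using assms by simp
  have "GDERIV norm (y - a) :> sgn (y - a)" using assms by (intro GDERIV_norm) simp
  then have "((\<lambda>y. norm (y - a)) has_derivative (\<lambda>h. inner (h - 0) (sgn (y - a)))) (at y)"
    unfolding gderiv_def
    by (rule has_derivative_compose[OF has_derivative_diff[OF has_derivative_ident has_derivative_const]])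
  then have "GDERIV (\<lambda>y. norm (y - a)) y :> sgn (y - a)" by (simp add: gderiv_def)
  moreover have "DERIV (\<lambda>r. c / r powr p) (norm (y - a)) :> - (c * p * norm (y - a) powr (- p - 1))"
  proof -
    have eq: "(\<lambda>r. c / r powr p) = (\<lambda>r. c * r powr (- p))"
      by (simp add: powr_minus divide_inverse)
    show ?thesis
      unfolding eq using DERIV_cmult[OF has_real_derivative_powr[OF pos, of "- p"], of c]
      by (simp add: algebra_simps)
  qed
  ultimately have "GDERIV (\<lambda>y. c / norm (y - a) powr p) y :>
      (- (c * p * norm (y - a) powr (- p - 1))) *\<^sub>R sgn (y - a)"
    by (rule GDERIV_DERIV_compose)
  also have "(- (c * p * norm (y - a) powr (- p - 1))) *\<^sub>R sgn (y - a) =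
      (- (c * p * ((norm (y - a))\<^sup>2) powr (- (p / 2) - 1))) *\<^sub>R (y - a)"
  proof -
    have sq: "(norm (y - a))\<^sup>2 = norm (y - a) powr 2" using pos by (simp add: powr_numeral)
    have "norm (y - a) powr (- p - 1) = norm (y - a) * ((norm (y - a))\<^sup>2) powr (- (p / 2) - 1)"
    proof -
      have "norm (y - a) powr (- p - 1) = norm (y - a) powr (1 + 2 * (- (p / 2) - 1))"
        by (rule arg_cong[where f = "\<lambda>e. norm (y - a) powr e"]) simp
      also have "\<dots> = norm (y - a) powr 1 * norm (y - a) powr (2 * (- (p / 2) - 1))" by (rule powr_add)
      finally show ?thesis unfolding sq powr_powr using pos by simp
    qed
    then show ?thesis using pos by (simp add: sgn_div_norm)
  qed
  finally show ?thesis .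
qed

text \<open>Each pair containing \<open>i\<close> has one half in the share of \<open>i\<close> and
  one in that of its partner; reunited, they form the sum that depends on \<open>y\<close>. The
  remaining terms make up \<open>c\<close>.\<close>

lemma potential_update:
  assumes i: "i \<in> {1..n}"
  obtains c where "\<And>y. potential n \<alpha> \<beta> m M (x(i := y)) =
    c + ((\<Sum>j\<in>{1..n}-{i}. m\<^sup>2 / norm (y - x j) powr \<alpha>)
      + (m * M / norm (y - C1) powr \<beta> + m * M / norm (y - C2) powr \<beta>))"
proof -
  define c where "c = (\<Sum>k\<in>{1..n}-{i}. 1/2 * (\<Sum>j\<in>{1..n}-{k}-{i}. m\<^sup>2 / norm (x k - x j) powr \<alpha>)
      + (m * M / norm (x k - C1) powr \<beta> + m * M / norm (x k - C2) powr \<beta>))"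
  have "potential n \<alpha> \<beta> m M (x(i := y)) =
    c + ((\<Sum>j\<in>{1..n}-{i}. m\<^sup>2 / norm (y - x j) powr \<alpha>)
      + (m * M / norm (y - C1) powr \<beta> + m * M / norm (y - C2) powr \<beta>))" for y
  proof -
    let ?f = "\<lambda>j. m\<^sup>2 / norm (y - x j) powr \<alpha>"
    have vi: "vpart n \<alpha> \<beta> m M (x(i := y)) i = 1/2 * (\<Sum>j\<in>{1..n}-{i}. ?f j)
        + (m * M / norm (y - C1) powr \<beta> + m * M / norm (y - C2) powr \<beta>)"
      unfolding vpart_def by (auto intro!: sum.cong)
    have vk: "vpart n \<alpha> \<beta> m M (x(i := y)) k = 1/2 * ?f k
        + (1/2 * (\<Sum>j\<in>{1..n}-{k}-{i}. m\<^sup>2 / norm (x k - x j) powr \<alpha>)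
        + (m * M / norm (x k - C1) powr \<beta> + m * M / norm (x k - C2) powr \<beta>))"
      if k: "k \<in> {1..n}-{i}" for k
    proof -
      have "(\<Sum>j\<in>{1..n}-{k}. m\<^sup>2 / norm ((x(i := y)) k - (x(i := y)) j) powr \<alpha>) =
          m\<^sup>2 / norm (x k - y) powr \<alpha> + (\<Sum>j\<in>{1..n}-{k}-{i}. m\<^sup>2 / norm (x k - x j) powr \<alpha>)"
        using k i by (subst sum.remove[of _ i]) (auto intro!: sum.cong)
      then show ?thesis using k unfolding vpart_def by (simp add: norm_minus_commute algebra_simps)
    qed
    have "potential n \<alpha> \<beta> m M (x(i := y)) =
        vpart n \<alpha> \<beta> m M (x(i := y)) i + (\<Sum>k\<in>{1..n}-{i}. vpart n \<alpha> \<beta> m M (x(i := y)) k)"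
      unfolding potential_eq_sum_vpart using i by (subst sum.remove[of _ i]) auto
    also have "(\<Sum>k\<in>{1..n}-{i}. vpart n \<alpha> \<beta> m M (x(i := y)) k) = (\<Sum>k\<in>{1..n}-{i}. 1/2 * ?f k) + c"
      unfolding c_def sum.distrib[of "\<lambda>k. 1/2 * ?f k", symmetric] by (intro sum.cong vk refl)
    also have "(\<Sum>k\<in>{1..n}-{i}. 1/2 * ?f k) = 1/2 * (\<Sum>k\<in>{1..n}-{i}. ?f k)"
      by (rule sum_distrib_left[symmetric])
    finally show ?thesis unfolding vi by linarith
  qed
  then show thesis by (rule that)
qed

text \<open>Exchanging \<open>h\<close> and \<open>n - h\<close> reverses the sign of each term.
  This cancels the tangential forces of vertices placed symmetrically to a given one.\<close>

lemma sum_periodic_odd: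
  fixes g :: "int \<Rightarrow> real"
  assumes per: "\<And>k. g (k + int n) = g k" and odd: "\<And>k. g (- k) = - g k"
  shows "(\<Sum>h\<in>{1..<n}. g (int h)) = 0"
proof -
  have "(\<Sum>h\<in>{1..<n}. g (int h)) = (\<Sum>h\<in>{1..<n}. - g (int h))"
  proof (rule sum.reindex_bij_witness[where i = "\<lambda>h. n - h" and j = "\<lambda>h. n - h"])
    fix h assume "h \<in> {1..<n}"
    then have eq: "int (n - h) = - int h + int n" by auto
    show "- g (int (n - h)) = g (int h)" unfolding eq per odd by simp
  qed auto
  then show ?thesis by (simp add: sum_negf)
qed

context critical_radius
begin

text \<open>The tangential parts are odd in \<open>j - i\<close> and cancel. The radial part of a
  difference has the factor \<open>1 - cos\<close>, which is half the squared chord.\<close>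

lemma polygon_force:
  assumes s: "\<bar>s\<bar> = 1" and i: "i \<in> {1..n}"
  shows "(\<Sum>j\<in>{1..n}-{i}. slope_pair (int j - int i) *\<^sub>R (polygon n R s \<theta> i t - polygon n R s \<theta> j t)) =
    (1/2 * (\<Sum>j\<in>{1..n}-{i}. slope_pair (int j - int i) * chord n (int j - int i))) *\<^sub>R polygon n R s \<theta> i t"
proof -
  define \<theta>' where "\<theta>' = \<theta> + s * ((real i - 1) * (2 * pi / real n))"
  define \<delta> where "\<delta> k = s * (2 * (pi * of_int k / real n))" for k
  let ?q = "circular R s \<theta>' t" and ?p = "circular R s (\<theta>' + pi / 2) t"
  have s': "s = 1 \<or> s = -1" using s by linarith
  have cos\<delta>: "1 - cos (\<delta> k) = chord n k / 2" for k
  proof -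
    have "cos (\<delta> k) = cos (2 * (pi * of_int k / real n))" using s' unfolding \<delta>_def by auto
    then show ?thesis unfolding chord_def cos_double_sin by simp
  qed
  have diff: "polygon n R s \<theta> i t - polygon n R s \<theta> j t =
      (chord n (int j - int i) / 2) *\<^sub>R ?q - sin (\<delta> (int j - int i)) *\<^sub>R ?p" for j
  proof -
    have "polygon n R s \<theta> i t - polygon n R s \<theta> j t = (1 - cos (\<delta> (int j - int i))) *\<^sub>R ?q - sin (\<delta> (int j - int i)) *\<^sub>R ?p"
      unfolding polygon_difference[of n R s \<theta> j i] unfolding \<delta>_def[symmetric] \<theta>'_def[symmetric] circular_rotate[of R s \<theta>' "\<delta> _"]
      by (simp add: polygon_def \<theta>'_def algebra_simps)
    then show ?thesis unfolding cos\<delta> .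
  qed
  let ?g = "\<lambda>k. slope_pair k * sin (\<delta> k)"
  have "(\<Sum>j\<in>{1..n}-{i}. ?g (int j - int i)) = (\<Sum>h\<in>{1..<n}. ?g (int h))"
    and "(\<Sum>h\<in>{1..<n}. ?g (int h)) = 0"
  proof -
    have per: "?g (k + int n) = ?g k" for k
    proof -
      have "\<delta> (k + int n) = \<delta> k + s * (2 * pi)" using n by (simp add: \<delta>_def field_simps)
      then have "sin (\<delta> (k + int n)) = sin (\<delta> k)" using s' by (auto simp: sin_add)
      moreover have "slope_pair (k + int n) = slope_pair k" using n by (simp add: slope_pair_def chord_periodic)
      ultimately show ?thesis by simp
    qed
    have odd: "?g (- k) = - ?g k" for k
      by (simp add: slope_pair_def chord_uminus \<delta>_def)
    show "(\<Sum>j\<in>{1..n}-{i}. ?g (int j - int i)) = (\<Sum>h\<in>{1..<n}. ?g (int h))"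
      by (rule sum_periodic_differences[of ?g n i, OF per i])
    show "(\<Sum>h\<in>{1..<n}. ?g (int h)) = 0"
      by (rule sum_periodic_odd[of ?g n, OF per odd])
  qed
  then have tangential: "(\<Sum>j\<in>{1..n}-{i}. ?g (int j - int i)) = 0" by simp
  have "(\<Sum>j\<in>{1..n}-{i}. slope_pair (int j - int i) *\<^sub>R (polygon n R s \<theta> i t - polygon n R s \<theta> j t)) =
      (\<Sum>j\<in>{1..n}-{i}. (1/2 * (slope_pair (int j - int i) * chord n (int j - int i))) *\<^sub>R ?q - ?g (int j - int i) *\<^sub>R ?p)"
    unfolding diff by (simp add: scaleR_right_diff_distrib)
  also have "\<dots> = (1/2 * (\<Sum>j\<in>{1..n}-{i}. slope_pair (int j - int i) * chord n (int j - int i))) *\<^sub>R ?q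
      - (\<Sum>j\<in>{1..n}-{i}. ?g (int j - int i)) *\<^sub>R ?p"
    unfolding sum_subtractf scaleR_sum_left[symmetric] sum_distrib_left[symmetric] ..
  finally show ?thesis unfolding tangential by (simp add: polygon_def \<theta>'_def)
qed

text \<open>At unit angular speed the acceleration is minus the position, so Newton's equation is a
  balance of radial forces, and this is \<open>critical\<close>. The two centers together pull
  radially, as their distances agree and \<open>C1 + C2 = 0\<close>.\<close>

lemma polygon_solves_newton:
  assumes s: "\<bar>s\<bar> = 1" and q: "\<And>i. i \<in> {1..n} \<Longrightarrow> q i = polygon n (sqrt K) s \<theta> i"
  shows "solves_newton n \<alpha> \<beta> m M q"
proof -
  let ?\<theta> = "\<lambda>i. \<theta> + s * ((real i - 1) * (2 * pi / real n))"
  let ?v = "\<lambda>i. circular (sqrt K * s) s (?\<theta> i + pi / 2)"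
  let ?a = "\<lambda>i. circular (sqrt K * s * s) s (?\<theta> i + pi / 2 + pi / 2)"
  have RK: "(sqrt K)\<^sup>2 = K" "sqrt K \<noteq> 0" using pos by simp_all
  note H = polygon_H_space[OF s RK(2), of n \<theta>]
  have "GDERIV (\<lambda>y. potential n \<alpha> \<beta> m M ((\<lambda>j. q j t)(i := y))) (q i t) :> (m *\<^sub>R ?a i t)"
    if i: "i \<in> {1..n}" for i t
  proof -
    let ?x = "\<lambda>j. polygon n (sqrt K) s \<theta> j t"
    have nq: "(norm (?x i))\<^sup>2 = K" unfolding polygon_def norm_square_circular RK ..
    have q1: "?x i $ 1 = 0" by (simp add: polygon_def)
    have dq: "(norm (?x i - ?x j))\<^sup>2 = chord n (int j - int i) * K" for j
      unfolding polygon_distance[OF s] RK ..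
    have c: "(norm (?x i - C1))\<^sup>2 = K + 1" "(norm (?x i - C2))\<^sup>2 = K + 1"
      using center_distances[of "?x i"] unfolding nq q1 by linarith+
    have C12: "C1 + C2 = 0" by (simp add: C1_def C2_def vec3_eq_iff)
    have a: "?a i t = - ?x i"
    proof -
      have "s * s = 1" using s by (metis abs_mult_self_eq mult_1_right)
      then have "sqrt K * s * s = sqrt K" by (simp add: mult.assoc)
      moreover have "?\<theta> i + pi / 2 + pi / 2 = ?\<theta> i + pi" by simp
      ultimately show ?thesis unfolding polygon_def by (simp only: circular_uminus)
    qed
    obtain e where e: "\<And>y. potential n \<alpha> \<beta> m M ((\<lambda>j. q j t)(i := y)) =
      e + ((\<Sum>j\<in>{1..n}-{i}. m\<^sup>2 / norm (y - q j t) powr \<alpha>)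
      + (m * M / norm (y - C1) powr \<beta> + m * M / norm (y - C2) powr \<beta>))"
      using potential_update[OF i] by blast
    have qx: "(\<Sum>j\<in>{1..n}-{i}. m\<^sup>2 / norm (y - q j t) powr \<alpha>) = (\<Sum>j\<in>{1..n}-{i}. m\<^sup>2 / norm (y - ?x j) powr \<alpha>)" for y
      by (rule sum.cong) (auto simp: q)
    have pair: "GDERIV (\<lambda>y. m\<^sup>2 / norm (y - ?x j) powr \<alpha>) (?x i) :>
        (- (2 * m\<^sup>2)) *\<^sub>R (slope_pair (int j - int i) *\<^sub>R (?x i - ?x j))" if j: "j \<in> {1..n}-{i}" for j
      using GDERIV_power_law[OF H_space_collisions(1)[OF H i j, of t], of "m\<^sup>2" \<alpha>] unfolding dq slope_pair_def by (simp add: mult.assoc)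
    have center: "GDERIV (\<lambda>y. m * M / norm (y - C1) powr \<beta>) (?x i) :> (- (m * M * slope_center)) *\<^sub>R (?x i - C1)"
       "GDERIV (\<lambda>y. m * M / norm (y - C2) powr \<beta>) (?x i) :> (- (m * M * slope_center)) *\<^sub>R (?x i - C2)"
      using GDERIV_power_law[OF H_space_collisions(2)[OF H i, of t], of "m * M" \<beta>]
        GDERIV_power_law[OF H_space_collisions(3)[OF H i, of t], of "m * M" \<beta>]
      unfolding c slope_center_def by (simp_all add: mult.assoc)
    have centers: "b *\<^sub>R (?x i - C1) + b *\<^sub>R (?x i - C2) = b *\<^sub>R (2 *\<^sub>R ?x i - (C1 + C2))" for b
      by (simp add: scaleR_2 algebra_simps)
    have "GDERIV (\<lambda>y. potential n \<alpha> \<beta> m M ((\<lambda>j. q j t)(i := y))) (?x i) :>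
        0 + ((\<Sum>j\<in>{1..n}-{i}. (- (2 * m\<^sup>2)) *\<^sub>R (slope_pair (int j - int i) *\<^sub>R (?x i - ?x j)))
        + ((- (m * M * slope_center)) *\<^sub>R (?x i - C1) + (- (m * M * slope_center)) *\<^sub>R (?x i - C2)))"
      unfolding e qx by (intro GDERIV_add GDERIV_const GDERIV_sum pair center) auto
    also have "0 + ((\<Sum>j\<in>{1..n}-{i}. (- (2 * m\<^sup>2)) *\<^sub>R (slope_pair (int j - int i) *\<^sub>R (?x i - ?x j)))
        + ((- (m * M * slope_center)) *\<^sub>R (?x i - C1) + (- (m * M * slope_center)) *\<^sub>R (?x i - C2))) =
        (- (2 * m\<^sup>2)) *\<^sub>R (\<Sum>j\<in>{1..n}-{i}. slope_pair (int j - int i) *\<^sub>R (?x i - ?x j))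
        + (- (m * M * slope_center)) *\<^sub>R (2 *\<^sub>R ?x i - (C1 + C2))"
      by (simp only: add_0_left scaleR_sum_right[symmetric] centers)
    also have "\<dots> = (- (2 * (1/2 * m\<^sup>2 * (\<Sum>j\<in>{1..n}-{i}. slope_pair (int j - int i) * chord n (int j - int i))
        + m * M * slope_center))) *\<^sub>R ?x i"
      unfolding polygon_force[OF s i] C12 by (simp add: algebra_simps)
    also have "\<dots> = m *\<^sub>R ?a i t"
      unfolding critical[OF i, symmetric] a by simp
    finally show ?thesis unfolding q[OF i] .
  qed
  moreover have "(q i has_vector_derivative ?v i t) (at t)" if "i \<in> {1..n}" for i t
    unfolding q[OF that] polygon_def by (rule circular_has_vector_derivative)
  moreover have "(?v i has_vector_derivative ?a i t) (at t)" for i t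
    by (rule circular_has_vector_derivative)
  ultimately show ?thesis
    unfolding solves_newton_def by (intro exI[of _ ?v] exI[of _ ?a]) blast
qed

end

section \<open>Minimizers\<close>

text \<open>Intermediate value theorem: the right-hand side of the critical equation is continuous
  in \<open>K\<close>, at least \<open>m / 2\<close> at some \<open>a > 0\<close>, and tends to zero
  at infinity.\<close>

lemma exists_critical_radius:
  assumes n: "n \<ge> 2" and pos: "\<alpha> > 0" "\<beta> > 0" "m > 0" "M > 0"
  shows "\<exists>K. critical_radius n \<alpha> \<beta> m M K"
proof -
  define f where "f h K = \<alpha> / 2 * (chord n (int h) * K) powr (- (\<alpha> / 2) - 1) * chord n (int h)" for h K
  define F where "F K = 1/2 * m\<^sup>2 * (\<Sum>h\<in>{1..<n}. f h K) + m * M * (\<beta> * (K + 1) powr (- (\<beta> / 2) - 1))" for K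
  have chord: "chord n (int h) > 0" if "h \<in> {1..<n}" for h
    using that by (intro chord_pos) auto
  have one: "1 \<in> {1..<n}" using n by auto
  define c where "c = chord n (int 1)"
  have c: "c > 0" unfolding c_def by (rule chord[OF one])
  define d where "d = 1/2 * m\<^sup>2 * (\<alpha> / 2 * c)"
  have d: "d > 0" using pos c by (simp add: d_def)
  \<comment> \<open>Solves \<open>d * (c * a) powr (- (\<alpha> / 2) - 1) = m / 2\<close>: the term
    \<open>h = 1\<close>, which exists as \<open>n \<ge> 2\<close>, alone contributes
    \<open>m / 2\<close>, and the others are nonnegative.\<close>
  define a where "a = (m / 2 / d) powr (1 / (- (\<alpha> / 2) - 1)) / c"
  have a: "a > 0" using pos c d by (simp add: a_def)
  have "c * a = (m / 2 / d) powr (1 / (- (\<alpha> / 2) - 1))" using c by (simp add: a_def)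
  then have "(c * a) powr (- (\<alpha> / 2) - 1) = (m / 2 / d) powr (1 / (- (\<alpha> / 2) - 1) * (- (\<alpha> / 2) - 1))"
    by (simp only: powr_powr)
  also have "1 / (- (\<alpha> / 2) - 1) * (- (\<alpha> / 2) - 1) = 1" using pos by simp
  finally have "d * (c * a) powr (- (\<alpha> / 2) - 1) = m / 2" using pos d by simp
  then have "m / 2 = 1/2 * m\<^sup>2 * f 1 a" by (simp add: d_def f_def c_def mult_ac)
  also have "\<dots> \<le> 1/2 * m\<^sup>2 * (\<Sum>h\<in>{1..<n}. f h a)"
  proof (intro mult_left_mono member_le_sum one)
    show "0 \<le> f h a" if "h \<in> {1..<n} - {1}" for h
      using that chord[of h] pos by (simp add: f_def)
  qed auto
  also have "\<dots> \<le> F a" unfolding F_def using pos by simp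
  finally have Fa: "m / 2 \<le> F a" .
  have lim_pair: "(f h \<longlongrightarrow> \<alpha> / 2 * 0 * chord n (int h)) at_top" if h: "h \<in> {1..<n}" for h
    unfolding f_def
  proof (rule tendsto_mult[OF tendsto_mult[OF tendsto_const tendsto_neg_powr] tendsto_const])
    show "filterlim (\<lambda>K. chord n (int h) * K) at_top at_top"
      by (rule filterlim_tendsto_pos_mult_at_top[OF tendsto_const chord[OF h] filterlim_ident])
  qed (use pos in simp)
  have lim_center: "((\<lambda>K. (K + 1) powr (- (\<beta> / 2) - 1)) \<longlongrightarrow> 0) at_top"
  proof (rule tendsto_neg_powr)
    show "filterlim (\<lambda>K::real. K + 1) at_top at_top"
      using filterlim_tendsto_add_at_top[OF tendsto_const filterlim_ident, of "1::real"]
      by (simp add: add.commute)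
  qed (use pos in simp)
  have "(F \<longlongrightarrow> 1/2 * m\<^sup>2 * (\<Sum>h\<in>{1..<n}. \<alpha> / 2 * 0 * chord n (int h)) + m * M * (\<beta> * 0)) at_top"
    unfolding F_def
    by (rule tendsto_add[OF tendsto_mult[OF tendsto_const tendsto_sum]
          tendsto_mult[OF tendsto_const tendsto_mult[OF tendsto_const lim_center]]]) (rule lim_pair)
  then have "(F \<longlongrightarrow> 0) at_top" by simp
  then have "\<forall>\<^sub>F K in at_top. F K < m / 2" using pos by (intro order_tendstoD(2)) auto
  then have "\<forall>\<^sub>F K in at_top. F K < m / 2 \<and> a \<le> K"
    by (intro eventually_conj eventually_ge_at_top)
  from eventually_happens'[OF trivial_limit_at_top_linorder this]
  obtain b where b: "F b < m / 2" "a \<le> b" by blast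
  have "continuous_on {a..b} F"
    unfolding F_def f_def
  proof (intro continuous_on_add continuous_on_mult continuous_on_const continuous_on_sum
      continuous_on_powr continuous_on_id ballI)
    show "chord n (int h) * K \<noteq> 0" if "h \<in> {1..<n}" "K \<in> {a..b}" for h K
      using that chord[of h] a by auto
    show "K + 1 \<noteq> 0" if "K \<in> {a..b}" for K
      using that a by auto
  qed
  then obtain K where K: "a \<le> K" "K \<le> b" "F K = m / 2"
    using IVT2'[of F b "m / 2" a, OF less_imp_le[OF b(1)] Fa b(2)] by blast
  have "critical_radius n \<alpha> \<beta> m M K"
  proof
    show "K > 0" using a K(1) by linarith
    show "m / 2 = 1/2 * m\<^sup>2 * (\<Sum>h\<in>{1..<n}. \<alpha> / 2 * (chord n (int h) * K) powr (- (\<alpha> / 2) - 1) * chord n (int h))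
      + m * M * (\<beta> * (K + 1) powr (- (\<beta> / 2) - 1))"
      using K(3) unfolding F_def f_def by (rule sym)
  qed (fact n pos)+
  then show ?thesis ..
qed

section \<open>Characterization of the minimizers\<close>

context critical_radius
begin

text \<open>A minimizer agrees with a polygon only at the indices in \<open>{1..n}\<close>, its
  other values being arbitrary. Hence the properties of polygons are transferred to all such
  motions.\<close>

lemma polygon_cong:
  assumes s: "\<bar>s\<bar> = 1" and q: "\<And>i. i \<in> {1..n} \<Longrightarrow> q i = polygon n (sqrt K) s \<theta> i"
  shows "q \<in> H_space n" "choreography n q" "antiperiodic n q"
    "relative_equilibrium n 0 (vector [0, 1, 0]) (vector [0, 0, 1]) q"
    "action n \<alpha> \<beta> m M q = ennreal (real n * (2 * pi * level))"
proof -
  have R: "sqrt K > 0" using pos by simp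
  have one: "1 \<in> {1..n}" using n by auto
  show H: "q \<in> H_space n"
    using polygon_H_space[OF s, of "sqrt K" n \<theta>] R q by (simp add: H_space_def)
  show "choreography n q"
    unfolding choreography_def
  proof (intro ballI allI)
    fix i t assume "i \<in> {1..n}"
    then show "q i t = q 1 (t + (real i - 1) * (2 * pi / real n))"
      using polygon_choreography[of n "sqrt K" s \<theta>] unfolding choreography_def q[OF one] by (simp only: q)
  qed
  show "antiperiodic n q"
    unfolding antiperiodic_def
  proof (intro ballI allI)
    fix i t assume i: "i \<in> {1..n}"
    show "q i t = - q i (t + pi)"
      using polygon_antiperiodic[OF s, of n "sqrt K" \<theta>] i unfolding antiperiodic_def q[OF i] by blast
  qed
  show "relative_equilibrium n 0 (vector [0, 1, 0]) (vector [0, 0, 1]) q"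
    using polygon_relative_equilibrium[OF n s R, of \<theta>] unfolding relative_equilibrium_def
    by (simp only: q cong: ball_cong)
  have "paction n \<alpha> \<beta> m M q i = 2 * pi * level" if "i \<in> {1..n}" for i
  proof -
    let ?p = "polygon n (sqrt K) s \<theta>"
    have sums: "(\<Sum>j\<in>{1..n}-{i}. m\<^sup>2 / norm (?p i t - q j t) powr \<alpha>) =
        (\<Sum>j\<in>{1..n}-{i}. m\<^sup>2 / norm (?p i t - ?p j t) powr \<alpha>)" for t
    proof (rule sum.cong)
      fix j assume "j \<in> {1..n}-{i}"
      then have "q j = ?p j" by (intro q) blast
      then show "m\<^sup>2 / norm (?p i t - q j t) powr \<alpha> = m\<^sup>2 / norm (?p i t - ?p j t) powr \<alpha>"
        by (simp only:)
    qed (rule refl)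
    have "paction n \<alpha> \<beta> m M q i = paction n \<alpha> \<beta> m M ?p i"
      unfolding paction_def vpart_def q[OF that] sums ..
    then show ?thesis unfolding polygon_paction[OF s that] .
  qed
  then show "action n \<alpha> \<beta> m M q = ennreal (real n * (2 * pi * level))"
    unfolding action_eq_sum_paction[OF H pos(3,4)] by simp
qed

lemma polygon_attains:
  "polygon n (sqrt K) 1 0 \<in> H_space n" "choreography n (polygon n (sqrt K) 1 0)"
  "antiperiodic n (polygon n (sqrt K) 1 0)"
  "action n \<alpha> \<beta> m M (polygon n (sqrt K) 1 0) = ennreal (real n * (2 * pi * level))"
  by (rule polygon_cong[of 1 _ 0]; simp)+

text \<open>Every share is at least \<open>2 * pi * level\<close>. If their sum does not exceed
  \<open>n\<close> times this value, neither does the share of particle 1, and that one determines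
  the choreography.\<close>

lemma action_lower_bound:
  assumes q: "q \<in> Lambda_space n"
  shows "ennreal (real n * (2 * pi * level)) \<le> action n \<alpha> \<beta> m M q"
    and "action n \<alpha> \<beta> m M q \<le> ennreal (real n * (2 * pi * level)) \<Longrightarrow>
      \<exists>s \<theta>. \<bar>s\<bar> = 1 \<and> (\<forall>i\<in>{1..n}. q i = polygon n (sqrt K) s \<theta> i)"
proof -
  note act = action_eq_sum_paction[OF Lambda_spaceD(1)[OF q] pos(3,4)]
  have low: "2 * pi * level \<le> paction n \<alpha> \<beta> m M q i" if "i \<in> {1..n}" for i
    by (rule paction_lower_bound(1)[OF q that])
  have sum_low: "(\<Sum>i\<in>I. 2 * pi * level) \<le> (\<Sum>i\<in>I. paction n \<alpha> \<beta> m M q i)" if "I \<subseteq> {1..n}" for I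
    using that low by (intro sum_mono) auto
  have const: "(\<Sum>i\<in>{1..n}. 2 * pi * level) = real n * (2 * pi * level)" by simp
  show "ennreal (real n * (2 * pi * level)) \<le> action n \<alpha> \<beta> m M q"
    unfolding act const[symmetric] by (intro ennreal_leI sum_low) simp
  assume "action n \<alpha> \<beta> m M q \<le> ennreal (real n * (2 * pi * level))"
  then have le: "(\<Sum>i\<in>{1..n}. paction n \<alpha> \<beta> m M q i) \<le> (\<Sum>i\<in>{1..n}. 2 * pi * level)"
    unfolding act const using level_nonneg by (subst (asm) ennreal_le_iff) auto
  have one: "1 \<in> {1..n}" using n by auto
  have split: "(\<Sum>i\<in>{1..n}. h i) = h 1 + (\<Sum>i\<in>{1..n}-{1}. h i)" for h :: "nat \<Rightarrow> real"
    using one by (intro sum.remove) auto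
  have "paction n \<alpha> \<beta> m M q 1 \<le> 2 * pi * level"
    using le sum_low[of "{1..n} - {1}"] unfolding split by auto
  then show "\<exists>s \<theta>. \<bar>s\<bar> = 1 \<and> (\<forall>i\<in>{1..n}. q i = polygon n (sqrt K) s \<theta> i)"
    by (rule polygon_if_paction_minimal[OF q])
qed

text \<open>\<open>S\<close> is any class between the antiperiodic choreographies and
  \<open>Lambda_space n\<close>. It is applied to both extremes, which therefore have the same
  minimizers.\<close>

lemma is_arg_min_iff:
  assumes sub: "S \<subseteq> Lambda_space n"
    and mem: "\<And>q. q \<in> H_space n \<Longrightarrow> choreography n q \<Longrightarrow> antiperiodic n q \<Longrightarrow> q \<in> S"
  shows "is_arg_min (action n \<alpha> \<beta> m M) (\<lambda>r. r \<in> S) q \<longleftrightarrow>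
    (\<exists>s \<theta>. \<bar>s\<bar> = 1 \<and> (\<forall>i\<in>{1..n}. q i = polygon n (sqrt K) s \<theta> i))" (is "_ \<longleftrightarrow> ?R q")
proof
  assume "is_arg_min (action n \<alpha> \<beta> m M) (\<lambda>r. r \<in> S) q"
  then have q: "q \<in> S" and min: "\<And>r. r \<in> S \<Longrightarrow> \<not> action n \<alpha> \<beta> m M r < action n \<alpha> \<beta> m M q"
    unfolding is_arg_min_def by auto
  have "polygon n (sqrt K) 1 0 \<in> S" using polygon_attains by (intro mem)
  from min[OF this] show "?R q"
    using q sub unfolding polygon_attains(4) by (intro action_lower_bound(2)) auto
next
  assume "?R q"
  then obtain s \<theta> where s: "\<bar>s\<bar> = 1" and q: "\<And>i. i \<in> {1..n} \<Longrightarrow> q i = polygon n (sqrt K) s \<theta> i" by blast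
  note c = polygon_cong[where q = q and \<theta> = \<theta>, OF s q]
  have act: "action n \<alpha> \<beta> m M q = ennreal (real n * (2 * pi * level))" by (rule c(5))
  have "q \<in> S" using c(1-3) by (intro mem)
  moreover have "\<not> action n \<alpha> \<beta> m M r < action n \<alpha> \<beta> m M q" if "r \<in> S" for r
  proof -
    have "ennreal (real n * (2 * pi * level)) \<le> action n \<alpha> \<beta> m M r"
      using that sub by (intro action_lower_bound(1)) blast
    then show ?thesis unfolding not_less act .
  qed
  ultimately show "is_arg_min (action n \<alpha> \<beta> m M) (\<lambda>r. r \<in> S) q"
    unfolding is_arg_min_def by blast
qed

lemma is_tilde_q_iff:
  "is_tilde_q n \<alpha> \<beta> m M q \<longleftrightarrow> (\<exists>s \<theta>. \<bar>s\<bar> = 1 \<and> (\<forall>i\<in>{1..n}. q i = polygon n (sqrt K) s \<theta> i))"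
proof -
  have "is_arg_min (action n \<alpha> \<beta> m M) (\<lambda>r. r \<in> Lambda_space n) q \<longleftrightarrow>
      (\<exists>s \<theta>. \<bar>s\<bar> = 1 \<and> (\<forall>i\<in>{1..n}. q i = polygon n (sqrt K) s \<theta> i))"
    by (rule is_arg_min_iff[OF subset_refl]) (rule choreography_antiperiodic_Lambda)
  then show ?thesis
    unfolding is_tilde_q_def using polygon_cong(4) by blast
qed

end

theorem corollary1p2:
  fixes n :: nat and \<alpha> \<beta> m M :: real
    and G :: "('g, 'b) monoid_scheme" and g1 g2 :: 'g
    and \<rho> :: "'g \<Rightarrow> real^3^3" and \<tau> :: "'g \<Rightarrow> real^2^2" and \<sigma> :: "'g \<Rightarrow> nat \<Rightarrow> nat"
  assumes "n \<ge> 2" and "\<alpha> > 0" and "\<beta> > 0" and "m > 0" and "M > 0"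
    and "group G" and "finite (carrier G)"
    and "g1 \<in> carrier G" and "g2 \<in> carrier G" and "carrier G = generate G {g1, g2}"
    and "\<rho> \<in> hom G orthogonal_group"
    and "\<tau> \<in> hom G orthogonal_group"
    and "\<sigma> \<in> hom G (sym_group n)"
    and "\<rho> g1 = mat 1"
    and "\<forall>i\<in>{1..n}. [int (\<sigma> (inv\<^bsub>G\<^esub> g1) i) = int i - 1] (mod int n)"
    and "\<forall>t. \<tau> (inv\<^bsub>G\<^esub> g1) *v circle_point t = circle_point (t + 2 * pi / real n)"
    and "\<rho> g2 = - mat 1"
    and "\<forall>i\<in>{1..n}. \<sigma> (inv\<^bsub>G\<^esub> g2) i = i"
    and "\<forall>t. \<tau> (inv\<^bsub>G\<^esub> g2) *v circle_point t = circle_point (t + pi)"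
  shows "(\<exists>q. is_tilde_q n \<alpha> \<beta> m M q) \<and>
    (\<forall>q. is_arg_min (action n \<alpha> \<beta> m M) (\<lambda>r. r \<in> HG_space G \<rho> \<tau> \<sigma> n) q \<longleftrightarrow>
         is_tilde_q n \<alpha> \<beta> m M q) \<and>
    (\<forall>q. is_tilde_q n \<alpha> \<beta> m M q \<longrightarrow> solves_newton n \<alpha> \<beta> m M q)"
proof -
  obtain K where "critical_radius n \<alpha> \<beta> m M K"
    using exists_critical_radius[OF assms(1-5)] by blast
  then interpret critical_radius n \<alpha> \<beta> m M K .
  have HG: "HG_space G \<rho> \<tau> \<sigma> n = {q \<in> H_space n. choreography n q \<and> antiperiodic n q}"
    by (rule HG_space_eq) (fact assms)+
  have "is_arg_min (action n \<alpha> \<beta> m M) (\<lambda>r. r \<in> HG_space G \<rho> \<tau> \<sigma> n) q \<longleftrightarrow> is_tilde_q n \<alpha> \<beta> m M q" for q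
    unfolding is_tilde_q_iff
    by (rule is_arg_min_iff) (auto simp: HG intro: choreography_antiperiodic_Lambda)
  moreover have "\<exists>q. is_tilde_q n \<alpha> \<beta> m M q"
    unfolding is_tilde_q_iff by (intro exI[of _ "polygon n (sqrt K) 1 0"] exI[of _ 1] exI[of _ 0]) simp
  moreover have "solves_newton n \<alpha> \<beta> m M q" if "is_tilde_q n \<alpha> \<beta> m M q" for q
    using that polygon_solves_newton unfolding is_tilde_q_iff by blast
  ultimately show ?thesis by blast
qed

end
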